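(* Let $E\subset\mathbb{P}^2_{\mathbb{C}}$ be a nodal cubic curve (an irreducible plane cubic with one ordinary node as its only singularity). Let $Q$ be a hyperosculating conic to $E$ and let $L$ be an inflectional line of $E$. Then the reduced plane curve $\mathcal{C}=E\cup Q\cup L$ (of degree $d=6$) is free with exponents $(2,3)$; that is, $\mathrm{mdr}(f)=2$ and $\tau(\mathcal{C})=(d-1)^2-2(d-3)=19$, where $f=0$ is a defining equation of $\mathcal{C}$.
   Context: Let $S=\mathbb{C}[x,y,z]$. For a reduced plane curve $C: f=0$ of degree $d$, the module of Jacobian syzygies is $AR(f)=\{(a,b,c)\in S^3: af_x+bf_y+cf_z=0\}$, graded by degree, and $\mathrm{mdr}(f)=\min\{k: AR(f)_k\neq 0\}$. Let $\tau(C)$ denote the total Tjurina number of $C$ (sum of the Tjurina numbers of its singular points). The curve $C$ is called free if, with $r=\mathrm{mdr}(f)$, one has $r\le (d-1)/2$ and $\tau(C)=(d-1)^2-r(d-r-1)$; in this case its exponents are $(r,d-1-r)$. For a smooth point $p$ of a plane curve $C$ with tangent line $T_pC$, the inflection order is $\iota_p(C)=(C\cdot T_pC)_p-2$; $p$ is an inflection point (flex) if $\iota_p(C)>0$, and the tangent line at a flex is called an inflectional line. At a smooth point of a plane curve of degree $\ge 3$ there is a unique osculating conic (local intersection multiplicity with the curve at least $5$); a point where this conic has intersection multiplicity at least $6$ with the curve is a sextactic point, and the corresponding conic is a hyperosculating conic. A nodal cubic has exactly three flexes and exactly three sextactic points. *)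

theory Defs
  imports Complex_Main "HOL-Library.Poly_Mapping" "HOL-Library.Product_Plus"
    "HOL-Library.Extended_Nat"
begin

text \<open>A polynomial in C[x,y,z] is a finitely supported map from exponent
  triples (i,j,k) (standing for the monomial x^i y^j z^k) to its coefficient.
  Multiplication is the convolution from Poly_Mapping (exponents add).\<close>

type_synonym poly3 = "(nat \<times> nat \<times> nat) \<Rightarrow>\<^sub>0 complex"

text \<open>Points of C^3; a point of P^2 is represented by a nonzero vector.\<close>
type_synonym pt = "complex \<times> complex \<times> complex"

definition peval :: "poly3 \<Rightarrow> pt \<Rightarrow> complex" where
  "peval f p = (case p of (a, b, c) \<Rightarrow>
     (\<Sum>m\<in>Poly_Mapping.keys f. case m of (i, j, k) \<Rightarrow> Poly_Mapping.lookup f m * a ^ i * b ^ j * c ^ k))"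

definition const3 :: "complex \<Rightarrow> poly3" where
  "const3 c = Poly_Mapping.single (0, 0, 0) c"

definition var3 :: "nat \<Rightarrow> poly3" where
  "var3 i = Poly_Mapping.single (if i = 0 then (1, 0, 0) else if i = 1 then (0, 1, 0) else (0, 0, 1)) 1"

definition homog :: "nat \<Rightarrow> poly3 \<Rightarrow> bool" where
  "homog d f \<longleftrightarrow> (\<forall>m\<in>Poly_Mapping.keys f. case m of (i, j, k) \<Rightarrow> i + j + k = d)"

definition pd :: "nat \<Rightarrow> poly3 \<Rightarrow> poly3" where
  "pd v f = (\<Sum>m\<in>Poly_Mapping.keys f. case m of (i, j, k) \<Rightarrow>
      (if v = 0 then Poly_Mapping.single (i - 1, j, k) (of_nat i * Poly_Mapping.lookup f m)
       else if v = 1 then Poly_Mapping.single (i, j - 1, k) (of_nat j * Poly_Mapping.lookup f m)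
       else Poly_Mapping.single (i, j, k - 1) (of_nat k * Poly_Mapping.lookup f m)))"

definition is_const :: "poly3 \<Rightarrow> bool" where
  "is_const g \<longleftrightarrow> (\<exists>c. g = const3 c)"

definition irreducible3 :: "poly3 \<Rightarrow> bool" where
  "irreducible3 f \<longleftrightarrow> \<not> is_const f \<and> (\<forall>g h. f = g * h \<longrightarrow> is_const g \<or> is_const h)"

definition reduced3 :: "poly3 \<Rightarrow> bool" where
  "reduced3 f \<longleftrightarrow> f \<noteq> 0 \<and> (\<forall>g h. f = g * g * h \<longrightarrow> is_const g)"

definition in_ideal :: "poly3 list \<Rightarrow> poly3 \<Rightarrow> bool" where
  "in_ideal gs h \<longleftrightarrow> (\<exists>as. length as = length gs \<and> h = (\<Sum>i<length gs. as ! i * gs ! i))"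

definition scale :: "complex \<Rightarrow> pt \<Rightarrow> pt" where
  "scale c p = (case p of (a, b, d) \<Rightarrow> (c * a, c * b, c * d))"

definition proj :: "pt \<Rightarrow> pt set" where
  "proj p = {scale c p | c. c \<noteq> 0}"

text \<open>Elements of the local ring O_{P^2,p} are fractions h/s with h, s
  homogeneous of the same degree e and s(p) \<noteq> 0.  Finitely many elements
  can be brought to a common denominator, so a family of n elements is
  h_1/s, ..., h_n/s with h_i homogeneous of one degree e.  A combination
  (\<Sum> c_i h_i)/s lies in the extended ideal (gs)O_p iff t*(\<Sum> c_i h_i) lies in the
  homogeneous ideal (gs) for some homogeneous t with t(p) \<noteq> 0.  The length
  is the supremum of the sizes of families linearly independent modulo (gs)O_p.\<close>

definition lin_indep_mod :: "poly3 list \<Rightarrow> pt \<Rightarrow> poly3 list \<Rightarrow> bool" where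
  "lin_indep_mod gs p hs \<longleftrightarrow>
     (\<forall>c :: nat \<Rightarrow> complex. (\<exists>i<length hs. c i \<noteq> 0) \<longrightarrow>
        \<not> (\<exists>t e. homog e t \<and> peval t p \<noteq> 0 \<and>
              in_ideal gs (t * (\<Sum>i<length hs. const3 (c i) * hs ! i))))"

definition loc_len :: "poly3 list \<Rightarrow> pt \<Rightarrow> enat" where
  "loc_len gs p = Sup {enat n | n. \<exists>e hs. length hs = n \<and> (\<forall>h\<in>set hs. homog e h)
                                     \<and> lin_indep_mod gs p hs}"

definition on_curve :: "poly3 \<Rightarrow> pt \<Rightarrow> bool" where
  "on_curve f p \<longleftrightarrow> p \<noteq> 0 \<and> peval f p = 0"

definition singular_pt :: "poly3 \<Rightarrow> pt \<Rightarrow> bool" where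
  "singular_pt f p \<longleftrightarrow> on_curve f p \<and> (\<forall>v<3. peval (pd v f) p = 0)"

definition smooth_pt :: "poly3 \<Rightarrow> pt \<Rightarrow> bool" where
  "smooth_pt f p \<longleftrightarrow> on_curve f p \<and> \<not> singular_pt f p"

definition int_mult :: "poly3 \<Rightarrow> poly3 \<Rightarrow> pt \<Rightarrow> enat" where
  "int_mult f g p = loc_len [f, g] p"

text \<open>Tjurina number at p: dim O_p/(f, f_x, f_y, f_z); in an affine chart z=1
  with g = f(u,v,1) this ideal is (g, g_u, g_v) (Euler formula).\<close>
definition tjurina :: "poly3 \<Rightarrow> pt \<Rightarrow> enat" where
  "tjurina f p = loc_len [f, pd 0 f, pd 1 f, pd 2 f] p"

definition total_tjurina :: "poly3 \<Rightarrow> enat" where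
  "total_tjurina f = (\<Sum>P\<in>proj ` {p. singular_pt f p}. tjurina f (SOME p. p \<in> P))"

definition tangent_line :: "poly3 \<Rightarrow> pt \<Rightarrow> poly3" where
  "tangent_line f p = (\<Sum>v<3. const3 (peval (pd v f) p) * var3 v)"

text \<open>Ordinary node: singular point whose (projective) Hessian has rank 2,
  i.e. the quadratic part of the local equation is a nondegenerate binary
  form (two distinct tangents).\<close>
definition ordinary_node :: "poly3 \<Rightarrow> pt \<Rightarrow> bool" where
  "ordinary_node f p \<longleftrightarrow> singular_pt f p \<and>
     (\<exists>i<3. \<exists>j<3. \<exists>k<3. \<exists>l<3.
        peval (pd i (pd k f)) p * peval (pd j (pd l f)) p
        - peval (pd i (pd l f)) p * peval (pd j (pd k f)) p \<noteq> 0)"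

definition nodal_cubic :: "poly3 \<Rightarrow> bool" where
  "nodal_cubic e \<longleftrightarrow> homog 3 e \<and> irreducible3 e \<and>
     (\<exists>p. ordinary_node e p \<and> (\<forall>q. singular_pt e q \<longrightarrow> q \<in> proj p))"

definition inflectional_line :: "poly3 \<Rightarrow> poly3 \<Rightarrow> bool" where
  "inflectional_line e l \<longleftrightarrow> (\<exists>p c. smooth_pt e p \<and> c \<noteq> 0 \<and>
       l = const3 c * tangent_line e p \<and> int_mult e (tangent_line e p) p \<ge> 3)"

text \<open>Osculating conic at a smooth point: a conic with intersection multiplicity
  at least 5; hyperosculating: at least 6 (at a sextactic point).  The
  osculating conic at a sextactic point is a smooth (irreducible) conic.\<close>
definition hyperosculating_conic :: "poly3 \<Rightarrow> poly3 \<Rightarrow> bool" where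
  "hyperosculating_conic e q \<longleftrightarrow> homog 2 q \<and> irreducible3 q \<and>
     (\<exists>p. smooth_pt e p \<and> int_mult e q p \<ge> 6)"

definition AR_nonzero :: "poly3 \<Rightarrow> nat \<Rightarrow> bool" where
  "AR_nonzero f k \<longleftrightarrow> (\<exists>a b c. homog k a \<and> homog k b \<and> homog k c \<and>
      (a, b, c) \<noteq> (0, 0, 0) \<and> a * pd 0 f + b * pd 1 f + c * pd 2 f = 0)"

definition mdr :: "poly3 \<Rightarrow> nat" where
  "mdr f = (LEAST k. AR_nonzero f k)"

definition free_curve :: "poly3 \<Rightarrow> nat \<Rightarrow> bool" where
  "free_curve f d \<longleftrightarrow> reduced3 f \<and> homog d f \<and>
     2 * mdr f \<le> d - 1 \<and>
     total_tjurina f = enat ((d - 1)^2 - mdr f * (d - mdr f - 1))"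

definition free_with_exponents :: "poly3 \<Rightarrow> nat \<Rightarrow> nat \<Rightarrow> nat \<Rightarrow> bool" where
  "free_with_exponents f d r1 r2 \<longleftrightarrow> free_curve f d \<and> r1 = mdr f \<and> r2 = d - 1 - mdr f"

end

theory Submission
  imports Defs "HOL-Computational_Algebra.Polynomial" "HOL-Computational_Algebra.Fundamental_Theorem_Algebra"
begin

text \<open>A linear change of coordinates brings the nodal cubic to \<open>xyz = x^3 + y^3\<close>, parametrised by
  \<open>(t, t^2, 1 + t^3)\<close>. A form restricted to it vanishes to order six (a conic) or three (a line) at a
  single \<open>t\<close> only if the product of the roots of the restriction is right, that is \<open>t^6 = 1\<close> resp.
  \<open>t^3 = - 1\<close>; this determines conic and line up to the symmetry \<open>t \<mapsto> \<alpha> t\<close> with \<open>\<alpha>^3 = 1\<close>.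

  For the resulting sextics the Jacobian ideal \<open>J\<close> has no linear syzygy, so it has codimension at most 19
  in degree 6; a generic linear form \<open>\<mu>\<close> satisfies \<open>S_n = J_n + \<mu> S_(n-1)\<close> for \<open>n \<ge> 7\<close>, so the bound
  persists in all higher degrees. On the other hand every \<open>A_(2k-1)\<close> point carries a curve germ running
  between the two branches along which all of \<open>J\<close> vanishes to order \<open>2k - 1\<close>; the germs at the points of
  type \<open>A_11\<close>, \<open>A_5\<close>, \<open>A_1\<close>, \<open>A_1\<close>, \<open>A_1\<close> impose \<open>11 + 5 + 1 + 1 + 1 = 19\<close> independent conditions
  in large degree. Hence both counts are sharp: there are no further singular points, the local Tjurina
  numbers are the jet lengths, and a quadratic syzygy must exist.\<close>

section \<open>Polynomials in three variables\<close>

subsection \<open>Evaluation homomorphisms\<close>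

text \<open>The number 19 is a difference: degree 6 has 28 monomials, and without a linear syzygy
  the 9 products of a variable with a partial derivative are independent. In degree 7 the absence of
  quadratic syzygies would leave 36 - 18 = 18, one less than the jets permit, which is why such a
  syzygy must exist. The germs see the whole local algebra: for \<open>y^2 = x^(2 k)\<close> the
  Tjurina ideal is \<open>(y, x^(2 k - 1))\<close>, so restriction to \<open>y = 0\<close> loses
  nothing. A germ is needed only up to finite order, so polynomial germs suffice and no local
  algebra enters; a unit of the local ring is simply a form that does not vanish at the point. Once
  the conic is fixed at \<open>t = 1\<close>, three flex lines remain. The symmetry
  \<open>t \<mapsto> 1 / t\<close> exchanges the two belonging to primitive cube roots of unity, so
  there are two essentially different sextics; the primitive case is computed for both roots at
  once, modulo \<open>a^2 + a + 1\<close>.\<close>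

lemma sum_keys_add:
  fixes T :: "'a \<Rightarrow> 'c::comm_monoid_add \<Rightarrow> 'b::comm_monoid_add"
  assumes T0: "\<And>m. T m 0 = 0" and Tadd: "\<And>m c d. T m (c + d) = T m c + T m d"
  shows "(\<Sum>m\<in>Poly_Mapping.keys (f + g). T m (Poly_Mapping.lookup (f + g) m)) =
    (\<Sum>m\<in>Poly_Mapping.keys f. T m (Poly_Mapping.lookup f m)) +
    (\<Sum>m\<in>Poly_Mapping.keys g. T m (Poly_Mapping.lookup g m))"
proof -
  \<comment> \<open>Cancellation can make the support of \<open>f + g\<close> smaller than this
    union, so all three sums are extended to it; the extra terms vanish by
    \<open>T0\<close>.\<close>
  let ?K = "Poly_Mapping.keys f \<union> Poly_Mapping.keys g"
  have ext: "(\<Sum>m\<in>Poly_Mapping.keys h. T m (Poly_Mapping.lookup h m)) = (\<Sum>m\<in>?K. T m (Poly_Mapping.lookup h m))"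
    if "Poly_Mapping.keys h \<subseteq> ?K" for h
    by (rule sum.mono_neutral_left) (use that in \<open>auto simp: in_keys_iff T0\<close>)
  show ?thesis
    by (subst (1 2 3) ext) (auto simp: Poly_Mapping.keys_add lookup_add Tadd sum.distrib intro: subsetD[OF Poly_Mapping.keys_add])
qed

lemma poly_mapping_sum_singles:
  "f = (\<Sum>m\<in>Poly_Mapping.keys f. Poly_Mapping.single m (Poly_Mapping.lookup f m))"
  by (rule poly_mapping_eqI) (auto simp: lookup_sum lookup_single when_def in_keys_iff)

lemma poly3_add_induct [case_names single add]:
  assumes "\<And>m c. P (Poly_Mapping.single m c)" "\<And>f g. P f \<Longrightarrow> P g \<Longrightarrow> P (f + g)"
  shows "P (f :: poly3)"
proof -
  have "P (\<Sum>m\<in>A. Poly_Mapping.single m (Poly_Mapping.lookup f m))" if "finite A" for A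
    using that by (induction A) (use assms(1)[of 0 0] assms in auto)
  then show ?thesis by (subst poly_mapping_sum_singles) auto
qed

lemma zero_triple: "(0, 0, 0) = (0 :: nat \<times> nat \<times> nat)"
  by (simp add: zero_prod_def)

lemma const3_0 [simp]: "const3 0 = 0" and const3_1 [simp]: "const3 1 = 1"
  by (simp_all add: const3_def zero_triple)

lemma const3_add: "const3 (c + d) = const3 c + const3 d"
  by (simp add: const3_def single_add)

lemma const3_mult: "const3 (c * d) = const3 c * const3 d"
  by (simp add: const3_def mult_single)

lemma const3_numeral [simp]: "const3 (numeral n) = numeral n"
  by (simp add: const3_def zero_triple)

lemma const3_of_nat [simp]: "const3 (of_nat n) = of_nat n"
  by (simp add: const3_def zero_triple)

lemma lookup_const3_mult [simp]: "Poly_Mapping.lookup (const3 c * f) m = c * Poly_Mapping.lookup f m"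
  by (induction f rule: poly3_add_induct)
    (auto simp: const3_def mult_single lookup_single when_def distrib_left lookup_add zero_triple)

lemma var3_power:
  "var3 0 ^ n = Poly_Mapping.single (n, 0, 0) 1"
  "var3 1 ^ n = Poly_Mapping.single (0, n, 0) 1"
  "var3 2 ^ n = Poly_Mapping.single (0, 0, n) 1"
  by (induction n) (auto simp: var3_def mult_single zero_triple)

lemma single_eq_monomial:
  "Poly_Mapping.single (i, j, k) c = const3 c * var3 0 ^ i * var3 1 ^ j * var3 2 ^ k"
  by (simp only: var3_power const3_def mult_single) simp

text \<open>Constants and variables generate the ring, so an identity between homomorphisms, or a
  chain rule, needs checking on them only.\<close>

lemma poly3_ring_induct [case_names const var add mult]:
  assumes "\<And>c. P (const3 c)" "\<And>v. v < 3 \<Longrightarrow> P (var3 v)"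
    and add: "\<And>f g. P f \<Longrightarrow> P g \<Longrightarrow> P (f + g)" and mult: "\<And>f g. P f \<Longrightarrow> P g \<Longrightarrow> P (f * g)"
  shows "P f"
proof (induction f rule: poly3_add_induct)
  case (single m c)
  obtain i j k where m: "m = (i, j, k)" by (cases m)
  have pow: "P (var3 v ^ n)" if "v < 3" for v n
    by (induction n) (use assms(1)[of 1] assms(2)[OF that] mult in auto)
  show ?case unfolding m single_eq_monomial by (intro mult assms(1) pow) auto
qed (rule add)

text \<open>One evaluation serves three targets: numbers (\<open>peval\<close>), forms
  (\<open>sub\<close>, a change of variables) and univariate polynomials (\<open>jet\<close>,
  restriction to a parametrised curve germ).\<close>

definition ev :: "(complex \<Rightarrow> 'r::comm_ring_1) \<Rightarrow> 'r \<times> 'r \<times> 'r \<Rightarrow> poly3 \<Rightarrow> 'r" where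
  "ev \<kappa> p f = (case p of (a, b, c) \<Rightarrow>
     (\<Sum>m\<in>Poly_Mapping.keys f. case m of (i, j, k) \<Rightarrow> \<kappa> (Poly_Mapping.lookup f m) * a ^ i * b ^ j * c ^ k))"

locale coeff_hom =
  fixes \<kappa> :: "complex \<Rightarrow> 'r::comm_ring_1"
  assumes coeff_add: "\<kappa> (x + y) = \<kappa> x + \<kappa> y"
    and coeff_mult: "\<kappa> (x * y) = \<kappa> x * \<kappa> y"
    and coeff_1: "\<kappa> 1 = 1"
begin

lemma coeff_0: "\<kappa> 0 = 0"
  using coeff_add[of 0 0] by simp

lemma ev_add: "ev \<kappa> p (f + g) = ev \<kappa> p f + ev \<kappa> p g"
  unfolding ev_def by (cases p) (auto intro!: sum_keys_add simp: coeff_0 coeff_add algebra_simps)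

lemma ev_single: "ev \<kappa> (a, b, c) (Poly_Mapping.single (i, j, k) d) = \<kappa> d * a ^ i * b ^ j * c ^ k"
  by (cases "d = 0") (auto simp: ev_def coeff_0)

lemma ev_0: "ev \<kappa> p 0 = 0"
  by (cases p) (simp add: ev_def)

lemma ev_mult: "ev \<kappa> p (f * g) = ev \<kappa> p f * ev \<kappa> p g"
proof (induction f rule: poly3_add_induct)
  case (single m d)
  show ?case
  proof (induction g rule: poly3_add_induct)
    case (single m' d')
    show ?case
      by (cases p; cases m; cases m')
        (auto simp: mult_single ev_single coeff_mult power_add algebra_simps)
  qed (simp add: distrib_left ev_add)
qed (simp add: distrib_right ev_add)

lemma ev_const: "ev \<kappa> p (const3 d) = \<kappa> d"
  by (cases p) (simp add: const3_def ev_single)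

lemma ev_1: "ev \<kappa> p 1 = 1"
  using ev_const[of p 1] by (simp add: coeff_1)

lemma ev_of_nat: "ev \<kappa> p (of_nat n) = of_nat n"
  by (induction n) (auto simp: ev_0 ev_add ev_1)

lemma ev_numeral: "ev \<kappa> p (numeral n) = numeral n"
  using ev_of_nat[of p "numeral n"] by simp

lemma ev_var:
  "ev \<kappa> (a, b, c) (var3 0) = a" "ev \<kappa> (a, b, c) (var3 1) = b"
  "ev \<kappa> (a, b, c) (var3 (Suc 0)) = b" "ev \<kappa> (a, b, c) (var3 2) = c"
  by (simp_all add: var3_def ev_single coeff_1)

lemma ev_uminus: "ev \<kappa> p (- f) = - ev \<kappa> p f"
  using ev_add[of p f "- f"] by (simp add: ev_0 eq_neg_iff_add_eq_0 add.commute)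

lemma ev_diff: "ev \<kappa> p (f - g) = ev \<kappa> p f - ev \<kappa> p g"
  using ev_add[of p f "- g"] by (simp add: ev_uminus)

lemma ev_power: "ev \<kappa> p (f ^ n) = ev \<kappa> p f ^ n"
  by (induction n) (auto simp: ev_1 ev_mult)

lemma ev_sum: "ev \<kappa> p (sum h A) = (\<Sum>i\<in>A. ev \<kappa> p (h i))"
  by (induction A rule: infinite_finite_induct) (auto simp: ev_0 ev_add)

lemma ev_prod: "ev \<kappa> p (prod h A) = (\<Prod>i\<in>A. ev \<kappa> p (h i))"
  by (induction A rule: infinite_finite_induct) (auto simp: ev_1 ev_mult)

lemmas ev_simps = ev_0 ev_1 ev_numeral ev_add ev_mult ev_const ev_var ev_uminus ev_diff ev_power
  ev_sum ev_prod

end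

section \<open>The three evaluation maps\<close>

lemma peval_eq_ev: "peval f p = ev (\<lambda>c. c) p f"
  by (simp add: peval_def ev_def)

interpretation peval: coeff_hom "\<lambda>c. c :: complex"
  by unfold_locales auto

lemmas peval_simps [simp] = peval.ev_simps[folded peval_eq_ev]

interpretation const3: coeff_hom const3
  by unfold_locales (auto simp: const3_add const3_mult)

abbreviation "sub \<equiv> ev const3"

lemmas sub_simps [simp] = const3.ev_simps

abbreviation const1 :: "complex \<Rightarrow> complex poly" where "const1 c \<equiv> [:c:]"

interpretation const1: coeff_hom const1
  by unfold_locales (auto simp: one_pCons)

abbreviation "jet \<equiv> ev const1"

lemmas jet_simps [simp] = const1.ev_simps

lemma var3_cases: "v < 3 \<Longrightarrow> (v = 0 \<Longrightarrow> P) \<Longrightarrow> (v = 1 \<Longrightarrow> P) \<Longrightarrow> (v = 2 \<Longrightarrow> P) \<Longrightarrow> P" for v :: nat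
  by linarith

lemma (in coeff_hom) ev_sub:
  "ev \<kappa> p (sub (a, b, c) f) = ev \<kappa> (ev \<kappa> p a, ev \<kappa> p b, ev \<kappa> p c) f"
  by (induction f rule: poly3_ring_induct) (auto elim!: var3_cases simp: ev_simps)

lemma poly_jet: "poly (jet (a, b, c) f) x = peval f (poly a x, poly b x, poly c x)"
  by (induction f rule: poly3_ring_induct) (auto elim!: var3_cases)

subsection \<open>Partial derivatives\<close>

definition pds :: "nat \<Rightarrow> nat \<times> nat \<times> nat \<Rightarrow> complex \<Rightarrow> poly3" where
  "pds v m c = (case m of (i, j, k) \<Rightarrow>
      (if v = 0 then Poly_Mapping.single (i - 1, j, k) (of_nat i * c)
       else if v = 1 then Poly_Mapping.single (i, j - 1, k) (of_nat j * c)
       else Poly_Mapping.single (i, j, k - 1) (of_nat k * c)))"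

lemma pd_eq: "pd v f = (\<Sum>m\<in>Poly_Mapping.keys f. pds v m (Poly_Mapping.lookup f m))"
  by (simp add: pd_def pds_def)

lemma pd_add [simp]: "pd v (f + g) = pd v f + pd v g"
  unfolding pd_eq by (rule sum_keys_add) (auto simp: pds_def single_add distrib_left)

lemma pd_single: "pd v (Poly_Mapping.single m c) = pds v m c"
  by (cases "c = 0"; cases m) (auto simp: pd_eq pds_def)

text \<open>Exponent 0 needs a case of its own, because \<open>i - 1\<close> is truncated
  subtraction; the factor \<open>of_nat i\<close> then makes the term vanish.\<close>

lemma pd_mult [simp]: "pd v (f * g) = pd v f * g + f * pd v g"
proof (induction f rule: poly3_add_induct)
  case (single m c)
  show ?case
  proof (induction g rule: poly3_add_induct)
    case (single m' c')
    obtain i j k i' j' k' where [simp]: "m = (i, j, k)" "m' = (i', j', k')" by (cases m; cases m')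
    consider "v = 0" | "v = 1" | "v \<noteq> 0" "v \<noteq> 1" by blast
    then show ?case
    proof cases
      case 1
      then show ?thesis
        by (cases i; cases i') (simp_all add: mult_single pd_single pds_def single_add[symmetric] algebra_simps)
    next
      case 2
      then show ?thesis
        by (cases j; cases j') (simp_all add: mult_single pd_single pds_def single_add[symmetric] algebra_simps)
    next
      case 3
      then show ?thesis
        by (cases k; cases k') (simp_all add: mult_single pd_single pds_def single_add[symmetric] algebra_simps)
    qed
  qed (simp add: algebra_simps)
qed (simp add: algebra_simps)

lemma pd_const [simp]: "pd v (const3 c) = 0"
  by (simp add: const3_def pd_single pds_def)

lemma pd_0 [simp]: "pd v 0 = 0" and pd_1 [simp]: "pd v 1 = 0" and pd_numeral [simp]: "pd v (numeral n) = 0"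
  using pd_const[of v 0] pd_const[of v 1] pd_const[of v "numeral n"] by simp_all

lemma pd_var [simp]:
  "pd 0 (var3 0) = 1" "pd 0 (var3 1) = 0" "pd 0 (var3 2) = 0"
  "pd 1 (var3 0) = 0" "pd 1 (var3 1) = 1" "pd 1 (var3 2) = 0"
  "pd 2 (var3 0) = 0" "pd 2 (var3 1) = 0" "pd 2 (var3 2) = 1"
  by (simp_all add: var3_def pd_single pds_def zero_triple)

lemmas pd_var_Suc [simp] = pd_var[unfolded One_nat_def]

lemma pd_uminus [simp]: "pd v (- f) = - pd v f"
  using pd_add[of v f "- f"] by (simp add: eq_neg_iff_add_eq_0 add.commute)

lemma pd_diff [simp]: "pd v (f - g) = pd v f - pd v g"
  using pd_add[of v f "- g"] by simp

lemma pd_power [simp]: "pd v (f ^ n) = of_nat n * f ^ (n - 1) * pd v f"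
proof (induction n)
  case (Suc n)
  have "pd v (f ^ Suc n) = pd v f * f ^ n + f * pd v (f ^ n)"
    by (simp only: power_Suc pd_mult)
  also have "f * pd v (f ^ n) = of_nat n * f ^ n * pd v f"
    unfolding Suc.IH by (cases n) (simp_all only: power_Suc diff_Suc_1 of_nat_0 mult_zero_left mult_zero_right mult_ac)
  finally show ?case by (simp add: algebra_simps)
qed simp

lemma pd_sub:
  "pd v (sub (a, b, c) f) = pd v a * sub (a, b, c) (pd 0 f) + pd v b * sub (a, b, c) (pd 1 f)
     + pd v c * sub (a, b, c) (pd 2 f)"
proof (induction f rule: poly3_ring_induct)
  case (add f g)
  show ?case unfolding const3.ev_add pd_add add by (simp only: distrib_left add_ac)
next
  case (mult f g)
  show ?case
    unfolding const3.ev_mult const3.ev_add pd_mult mult by (simp only: distrib_left distrib_right mult_ac add_ac)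
next
  case (var u)
  then show ?case by (elim var3_cases) simp_all
qed simp

subsection \<open>Homogeneous polynomials\<close>

lemma homog_0 [simp]: "homog d 0"
  by (simp add: homog_def)

lemma homog_single: "i + j + k = d \<Longrightarrow> homog d (Poly_Mapping.single (i, j, k) c)"
  by (auto simp: homog_def split: if_splits)

lemma homog_add: "homog d f \<Longrightarrow> homog d g \<Longrightarrow> homog d (f + g)"
  unfolding homog_def by (metis (no_types, lifting) Poly_Mapping.keys_add UnE subsetD)

lemma homog_sum: "(\<And>i. i \<in> A \<Longrightarrow> homog d (h i)) \<Longrightarrow> homog d (sum h A)"
  by (induction A rule: infinite_finite_induct) (auto intro: homog_add)

lemma homog_induct [consumes 1, case_names zero single add]:
  assumes "homog d f" "P 0" "\<And>i j k c. i + j + k = d \<Longrightarrow> P (Poly_Mapping.single (i, j, k) c)"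
    "\<And>f g. P f \<Longrightarrow> P g \<Longrightarrow> P (f + g)"
  shows "P f"
proof -
  have "P (\<Sum>m\<in>A. Poly_Mapping.single m (Poly_Mapping.lookup f m))" if "finite A" "A \<subseteq> Poly_Mapping.keys f" for A
    using that
  proof (induction A)
    case (insert m A)
    obtain i j k where m: "m = (i, j, k)" by (cases m)
    with insert.prems \<open>homog d f\<close> have "i + j + k = d" by (auto simp: homog_def)
    then have "P (Poly_Mapping.single m (Poly_Mapping.lookup f m))"
      unfolding m by (rule assms(3))
    then show ?case using insert by (simp add: assms(4))
  qed (simp add: assms(2))
  then show ?thesis by (subst poly_mapping_sum_singles) auto
qed

lemma homog_mult: 
  assumes "homog d f" "homog d' g"
  shows "homog (d + d') (f * g)"
  using assms(1)
proof (induction rule: homog_induct)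
  case (single i j k c)
  from assms(2) show ?case
  proof (induction rule: homog_induct)
    case (single i' j' k' c')
    with \<open>i + j + k = d\<close> show ?case
      by (auto simp: mult_single intro: homog_single)
  qed (auto simp: distrib_left intro: homog_add)
qed (auto simp: distrib_right intro: homog_add)

lemma homog_const [simp]: "homog 0 (const3 c)"
  by (simp add: const3_def homog_single)

lemma homog_numeral [simp]: "homog 0 (numeral n)"
  using homog_const[of "numeral n"] by simp

lemma homog_1 [simp]: "homog 0 1"
  using homog_const[of 1] by simp

lemma homog_var [simp]: "homog 1 (var3 v)" "homog (Suc 0) (var3 v)"
  by (auto simp: var3_def homog_single)

lemma homog_const_mult: "homog d f \<Longrightarrow> homog d (const3 c * f)"
  using homog_mult[of 0 "const3 c" d f] by simp

lemma homog_uminus: "homog d f \<Longrightarrow> homog d (- f)"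
  by (simp add: homog_def in_keys_iff)

lemma homog_diff: "homog d f \<Longrightarrow> homog d g \<Longrightarrow> homog d (f - g)"
  using homog_add[of d f "- g"] homog_uminus by simp

lemma homog_power: "homog d f \<Longrightarrow> homog (n * d) (f ^ n)"
  by (induction n) (auto intro: homog_mult)

lemma homog_prod: "(\<And>i. i \<in> A \<Longrightarrow> homog (d i) (h i)) \<Longrightarrow> homog (sum d A) (prod h A)"
  by (induction A rule: infinite_finite_induct) (auto intro: homog_mult)

lemma homog_pd: "homog (Suc d) f \<Longrightarrow> homog d (pd v f)"
proof (induction rule: homog_induct)
  case (single i j k c)
  then show ?case
    by (cases i; cases j; cases k) (auto simp: pd_single pds_def intro!: homog_single)
qed (auto intro: homog_add)

lemma euler:
  assumes "homog d f"
  shows "var3 0 * pd 0 f + var3 1 * pd 1 f + var3 2 * pd 2 f = of_nat d * f"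
  using assms
proof (induction rule: homog_induct)
  case (single i j k c)
  have "(of_nat d :: poly3) = const3 (of_nat i + of_nat j + of_nat k)"
    by (simp add: const3_add flip: single)
  then have d: "of_nat d = Poly_Mapping.single (0 :: nat, 0 :: nat, 0 :: nat) (of_nat i + of_nat j + of_nat k :: complex)"
    by (simp add: const3_def)
  have "Poly_Mapping.single (1, 0, 0) 1 * pds 0 (i, j, k) c = Poly_Mapping.single (i, j, k) (of_nat i * c)"
    by (cases i) (auto simp: pds_def mult_single)
  moreover have "Poly_Mapping.single (0, 1, 0) 1 * pds 1 (i, j, k) c = Poly_Mapping.single (i, j, k) (of_nat j * c)"
    by (cases j) (auto simp: pds_def mult_single)
  moreover have "Poly_Mapping.single (0, 0, 1) 1 * pds 2 (i, j, k) c = Poly_Mapping.single (i, j, k) (of_nat k * c)"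
    by (cases k) (auto simp: pds_def mult_single)
  ultimately show ?case
    unfolding d pd_single by (simp add: var3_def mult_single distrib_right flip: single_add)
next
  case (add f g)
  have "var3 0 * pd 0 (f + g) + var3 1 * pd 1 (f + g) + var3 2 * pd 2 (f + g) =
    (var3 0 * pd 0 f + var3 1 * pd 1 f + var3 2 * pd 2 f) + (var3 0 * pd 0 g + var3 1 * pd 1 g + var3 2 * pd 2 g)"
    by (simp add: algebra_simps)
  then show ?case unfolding add by (simp add: distrib_left)
qed simp

lemma peval_scale:
  assumes "homog d f"
  shows "peval f (scale r p) = r ^ d * peval f p"
  using assms
proof (induction rule: homog_induct)
  case (single i j k c)
  then show ?case
    by (cases p) (auto simp: scale_def peval_eq_ev peval.ev_single power_add algebra_simps)
qed (auto simp: distrib_left)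

lemma homog_sub:
  assumes "homog d f" "homog k a" "homog k b" "homog k c"
  shows "homog (d * k) (sub (a, b, c) f)"
  using assms(1)
proof (induction rule: homog_induct)
  case (single i j l r)
  have "homog (0 + i * k + j * k + l * k) (const3 r * a ^ i * b ^ j * c ^ l)"
    by (intro homog_mult homog_power assms homog_const)
  with single show ?case by (simp add: const3.ev_single flip: distrib_right)
qed (auto intro: homog_add)

lemma homog_expand:
  assumes "homog d f"
  shows "f = (\<Sum>i\<le>d. \<Sum>j\<le>d - i. const3 (Poly_Mapping.lookup f (i, j, d - i - j)) *
    var3 0 ^ i * var3 1 ^ j * var3 2 ^ (d - i - j))"
proof (rule poly_mapping_eqI)
  fix m :: "nat \<times> nat \<times> nat"
  obtain a b c where m: "m = (a, b, c)" by (cases m)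
  have *: "(\<Sum>j\<le>d - i. if i = a \<and> j = b \<and> d - i - j = c then Poly_Mapping.lookup f (i, j, d - i - j) else 0)
     = (if i = a \<and> b \<le> d - i \<and> d - i - b = c then Poly_Mapping.lookup f (a, b, c) else 0)" for i
  proof -
    have "(\<Sum>j\<le>d - i. if i = a \<and> j = b \<and> d - i - j = c then Poly_Mapping.lookup f (i, j, d - i - j) else 0)
       = (\<Sum>j\<le>d - i. if j = b then if i = a \<and> d - i - b = c then Poly_Mapping.lookup f (a, b, c) else 0 else 0)"
      by (intro sum.cong) auto
    then show ?thesis by auto
  qed
  have **: "(\<Sum>i\<le>d. if i = a \<and> b \<le> d - i \<and> d - i - b = c then Poly_Mapping.lookup f (a, b, c) else 0)
     = (if a \<le> d \<and> b \<le> d - a \<and> d - a - b = c then Poly_Mapping.lookup f (a, b, c) else 0)"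
  proof -
    have "(\<Sum>i\<le>d. if i = a \<and> b \<le> d - i \<and> d - i - b = c then Poly_Mapping.lookup f (a, b, c) else 0)
      = (\<Sum>i\<le>d. if i = a then if b \<le> d - a \<and> d - a - b = c then Poly_Mapping.lookup f (a, b, c) else 0 else 0)"
      by (intro sum.cong) auto
    then show ?thesis by auto
  qed
  have "Poly_Mapping.lookup f (a, b, c) = 0" if "a + b + c \<noteq> d"
    using assms that unfolding homog_def by (force simp: in_keys_iff)
  then show "Poly_Mapping.lookup f m = Poly_Mapping.lookup (\<Sum>i\<le>d. \<Sum>j\<le>d - i. const3 (Poly_Mapping.lookup f (i, j, d - i - j)) *
    var3 0 ^ i * var3 1 ^ j * var3 2 ^ (d - i - j)) m"
    unfolding single_eq_monomial[symmetric] lookup_sum lookup_single when_def m prod.inject * **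
    by auto
qed

subsection \<open>Ideals and linear systems\<close>

lemma in_ideal_Nil: "in_ideal [] h \<longleftrightarrow> h = 0"
  by (auto simp: in_ideal_def)

lemma in_ideal_Cons: "in_ideal (g # gs) h \<longleftrightarrow> (\<exists>a h'. in_ideal gs h' \<and> h = a * g + h')"
proof
  assume "in_ideal (g # gs) h"
  then obtain as where as: "length as = Suc (length gs)" "h = (\<Sum>i<Suc (length gs). as ! i * (g # gs) ! i)"
    unfolding in_ideal_def by auto
  obtain a bs where "as = a # bs" using as(1) by (cases as) auto
  with as show "\<exists>a h'. in_ideal gs h' \<and> h = a * g + h'"
    unfolding in_ideal_def by (auto simp: sum.lessThan_Suc_shift simp del: sum.lessThan_Suc)
next
  assume "\<exists>a h'. in_ideal gs h' \<and> h = a * g + h'"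
  then obtain a bs where "length bs = length gs" "h = a * g + (\<Sum>i<length gs. bs ! i * gs ! i)"
    unfolding in_ideal_def by auto
  then show "in_ideal (g # gs) h"
    unfolding in_ideal_def
    by (intro exI[of _ "a # bs"]) (auto simp: sum.lessThan_Suc_shift simp del: sum.lessThan_Suc)
qed

lemma in_ideal_0 [simp]: "in_ideal gs 0"
proof (induction gs)
  case (Cons g gs)
  then show ?case unfolding in_ideal_Cons by (intro exI[of _ 0]) auto
qed (simp add: in_ideal_Nil)

lemma in_ideal_add: "in_ideal gs h \<Longrightarrow> in_ideal gs h' \<Longrightarrow> in_ideal gs (h + h')"
proof (induction gs arbitrary: h h')
  case (Cons g gs)
  obtain a k where 1: "in_ideal gs k" "h = a * g + k" using Cons.prems(1) unfolding in_ideal_Cons by blast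
  obtain b l where 2: "in_ideal gs l" "h' = b * g + l" using Cons.prems(2) unfolding in_ideal_Cons by blast
  show ?case unfolding in_ideal_Cons
    by (rule exI[of _ "a + b"], rule exI[of _ "k + l"]) (use Cons.IH 1 2 in \<open>simp add: algebra_simps\<close>)
qed (simp add: in_ideal_Nil)

lemma in_ideal_mult: "in_ideal gs h \<Longrightarrow> in_ideal gs (t * h)"
proof (induction gs arbitrary: h)
  case (Cons g gs)
  obtain a k where 1: "in_ideal gs k" "h = a * g + k" using Cons.prems(1) unfolding in_ideal_Cons by blast
  show ?case unfolding in_ideal_Cons
    by (rule exI[of _ "t * a"], rule exI[of _ "t * k"]) (use Cons.IH 1 in \<open>simp add: algebra_simps\<close>)
qed (simp add: in_ideal_Nil)

lemma in_ideal_uminus: "in_ideal gs h \<Longrightarrow> in_ideal gs (- h)"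
  using in_ideal_mult[of gs h "- 1"] by simp

lemma in_ideal_sum: "(\<And>i. i \<in> A \<Longrightarrow> in_ideal gs (h i)) \<Longrightarrow> in_ideal gs (sum h A)"
  by (induction A rule: infinite_finite_induct) (auto intro: in_ideal_add)

lemma in_ideal_mem: "g \<in> set gs \<Longrightarrow> in_ideal gs g"
proof (induction gs)
  case (Cons k gs)
  show ?case
  proof (cases "g = k")
    case True
    then show ?thesis unfolding in_ideal_Cons by (intro exI[of _ 1] exI[of _ 0]) auto
  next
    case False
    with Cons have "in_ideal gs g" by simp
    then show ?thesis unfolding in_ideal_Cons by (intro exI[of _ 0] exI[of _ g]) auto
  qed
qed simp

lemma in_ideal_induct [consumes 1, case_names zero add]:
  assumes "in_ideal gs h" "P 0" "\<And>a g h. g \<in> set gs \<Longrightarrow> P h \<Longrightarrow> P (a * g + h)"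
  shows "P h"
  using assms(1,3)
proof (induction gs arbitrary: h)
  case (Cons g gs)
  obtain a k where 1: "in_ideal gs k" "h = a * g + k" using Cons.prems(1) unfolding in_ideal_Cons by blast
  have "P k" by (rule Cons.IH[OF 1(1)], rule Cons.prems(2)) auto
  then show ?case unfolding 1(2) by (intro Cons.prems(2)) auto
qed (use assms(2) in \<open>simp add: in_ideal_Nil\<close>)

lemma in_ideal_mono:
  assumes "in_ideal gs h" "\<And>g. g \<in> set gs \<Longrightarrow> in_ideal gs' g"
  shows "in_ideal gs' h"
  using assms(1)
proof (induction rule: in_ideal_induct)
  case (add a g h)
  then show ?case using assms(2)[OF add(1)] by (blast intro: in_ideal_add in_ideal_mult)
qed simp

lemma (in coeff_hom) ev_in_ideal_dvd:
  assumes "in_ideal gs h" "\<And>g. g \<in> set gs \<Longrightarrow> D dvd ev \<kappa> p g"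
  shows "D dvd ev \<kappa> p h"
  using assms(1)
proof (induction rule: in_ideal_induct)
  case (add a g h)
  then show ?case using assms(2)[OF add(1)] unfolding ev_add ev_mult by (blast intro: dvd_add dvd_mult)
qed (simp add: ev_0)

lemma in_ideal_sub: "in_ideal gs h \<Longrightarrow> in_ideal (map (sub p) gs) (sub p h)"
proof (induction rule: in_ideal_induct)
  case (add a g h)
  then have "in_ideal (map (sub p) gs) (sub p g)" by (intro in_ideal_mem) auto
  with add show ?case by (auto intro: in_ideal_add in_ideal_mult)
qed simp

text \<open>Gaussian elimination: if an unknown \<open>j\<close> occurs in equation
  \<open>k\<close>, it is eliminated from the other equations, and its value is recovered from
  equation \<open>k\<close> at the end.\<close>

lemma ex_nontrivial_solution:
  fixes v :: "'i \<Rightarrow> 'k \<Rightarrow> 'a::field"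
  assumes "finite K" "finite I" "card K < card I"
  shows "\<exists>c. (\<exists>i\<in>I. c i \<noteq> 0) \<and> (\<forall>k\<in>K. (\<Sum>i\<in>I. c i * v i k) = 0)"
  using assms
proof (induction K arbitrary: I v)
  case empty
  then obtain i where "i \<in> I" by fastforce
  then show ?case by (intro exI[of _ "\<lambda>_. 1"]) auto
next
  case (insert k K)
  show ?case
  proof (cases "\<forall>i\<in>I. v i k = 0")
    case True
    have "card K < card I" using insert by simp
    from insert.IH[OF insert.prems(1) this] obtain c where
      "\<exists>i\<in>I. c i \<noteq> 0" "\<forall>k\<in>K. (\<Sum>i\<in>I. c i * v i k) = 0" by blast
    with True show ?thesis by (intro exI[of _ c]) auto
  next
    case False
    then obtain j where j: "j \<in> I" "v j k \<noteq> 0" by blast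
    define J where "J = I - {j}"
    have J: "finite J" "card K < card J" "j \<notin> J" "I = insert j J"
      using insert j by (auto simp: J_def)
    from insert.IH[OF J(1,2), of "\<lambda>i l. v i l - v i k / v j k * v j l"] obtain c where
      c: "\<exists>i\<in>J. c i \<noteq> 0" "\<And>l. l \<in> K \<Longrightarrow> (\<Sum>i\<in>J. c i * (v i l - v i k / v j k * v j l)) = 0" by blast
    define r where "r = - (\<Sum>i\<in>J. c i * v i k) / v j k"
    define c' where "c' = (\<lambda>i. if i = j then r else c i)"
    have sum: "(\<Sum>i\<in>I. c' i * v i l) = r * v j l + (\<Sum>i\<in>J. c i * v i l)" for l
      using J by (auto simp: c'_def intro!: sum.cong)
    have "(\<Sum>i\<in>I. c' i * v i l) = 0" if "l \<in> insert k K" for l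
    proof (cases "l = k")
      case True
      then show ?thesis using j(2) by (simp add: sum r_def)
    next
      case False
      have "(\<Sum>i\<in>J. c i * v i l) = (\<Sum>i\<in>J. c i * v i k) / v j k * v j l"
        using c(2)[of l] that False
        by (simp add: right_diff_distrib sum_subtractf sum_distrib_right sum_divide_distrib mult.assoc)
      then show ?thesis by (simp add: sum r_def)
    qed
    moreover have "\<exists>i\<in>I. c' i \<noteq> 0"
      using c(1) J by (auto simp: c'_def)
    ultimately show ?thesis by blast
  qed
qed

text \<open>Kronecker substitution \<open>(x, x^N, x^(N^2))\<close> separates the monomials.\<close>

lemma poly3_eq_0_if_peval:
  assumes "\<And>p. peval f p = 0"
  shows "f = 0"
proof (rule ccontr)
  assume "f \<noteq> 0"
  define N where "N = Suc (\<Sum>(i, j, k)\<in>Poly_Mapping.keys f. i + j + k)"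
  have less: "i < N" "j < N" "k < N" if "(i, j, k) \<in> Poly_Mapping.keys f" for i j k
    using member_le_sum[OF that, of "\<lambda>(i, j, k). i + j + k"] by (auto simp: N_def)
  define \<phi> where "\<phi> = (\<lambda>(i, j, k). i + N * (j + N * k) :: nat)"
  have inj: "m = m'" if "m \<in> Poly_Mapping.keys f" "m' \<in> Poly_Mapping.keys f" "\<phi> m = \<phi> m'" for m m'
  proof -
    obtain i j k i' j' k' where m: "m = (i, j, k)" "m' = (i', j', k')" by (cases m; cases m')
    note l = less[OF that(1)[unfolded m]] less[OF that(2)[unfolded m]]
    have *: "i + N * (j + N * k) = i' + N * (j' + N * k')" using that(3) by (simp add: \<phi>_def m)
    have "i = (i + N * (j + N * k)) mod N" using l by simp
    also have "\<dots> = i'" unfolding * using l by simp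
    finally have i: "i = i'" .
    have "j + N * k = (i + N * (j + N * k)) div N" using l by simp
    also have "\<dots> = j' + N * k'" unfolding * using l by simp
    finally have **: "j + N * k = j' + N * k'" .
    have "j = (j + N * k) mod N" using l by simp
    also have "\<dots> = j'" unfolding ** using l by simp
    finally have j: "j = j'" .
    have "k = (j + N * k) div N" using l by simp
    also have "\<dots> = k'" unfolding ** using l by simp
    finally show ?thesis using i j m by simp
  qed
  define P where "P = jet (monom 1 1, monom 1 N, monom 1 (N * N)) f"
  have "poly P x = 0" for x
    by (simp add: P_def poly_jet assms)
  then have "P = 0" using poly_all_0_iff_0[of P] by blast
  have P: "P = (\<Sum>m\<in>Poly_Mapping.keys f. monom (Poly_Mapping.lookup f m) (\<phi> m))"
    unfolding P_def ev_def
    by (auto intro!: sum.cong simp: \<phi>_def monom_power mult_monom algebra_simps simp flip: monom_0)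
  obtain m where m: "m \<in> Poly_Mapping.keys f" using \<open>f \<noteq> 0\<close> by (metis all_not_in_conv keys_eq_empty)
  have "coeff P (\<phi> m) = (\<Sum>m'\<in>Poly_Mapping.keys f. if m' = m then Poly_Mapping.lookup f m' else 0)"
    unfolding P coeff_sum using inj m by (intro sum.cong) (auto simp: coeff_monom)
  also have "\<dots> = Poly_Mapping.lookup f m" using m by simp
  finally show False using \<open>P = 0\<close> m by (simp add: in_keys_iff)
qed

subsection \<open>Codimension of an ideal in a fixed degree\<close>

text \<open>Bounds the dimension of the degree \<open>n\<close> part of the quotient by the ideal;
  speaking of dependent families avoids quotient spaces and fits the shape of
  \<open>lin_indep_mod\<close>.\<close>

definition codim_le :: "poly3 list \<Rightarrow> nat \<Rightarrow> nat \<Rightarrow> bool" where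
  "codim_le gs n N \<longleftrightarrow> (\<forall>h. (\<forall>i<Suc N. homog n (h i)) \<longrightarrow>
     (\<exists>c. (\<exists>i<Suc N. c i \<noteq> 0) \<and> in_ideal gs (\<Sum>i<Suc N. const3 (c i) * h i)))"

lemma codim_leD:
  assumes "codim_le gs n N" "finite S" "N < card S" "\<And>s. s \<in> S \<Longrightarrow> homog n (h s)"
  obtains c where "\<exists>s\<in>S. c s \<noteq> 0" "in_ideal gs (\<Sum>s\<in>S. const3 (c s) * h s)"
proof -
  obtain T where T: "T \<subseteq> S" "card T = Suc N" "finite T"
    using obtain_subset_with_card_n[of "Suc N" S] assms(3) by (metis Suc_leI)
  obtain b where b: "bij_betw b {0..<Suc N} T"
    using ex_bij_betw_nat_finite[OF T(3)] T(2) by auto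
  have bT: "b i \<in> T" if "i < Suc N" for i
    using b that by (auto simp: bij_betw_def)
  then have "\<forall>i<Suc N. homog n ((h \<circ> b) i)" using T(1) assms(4) by auto
  with assms(1) obtain c where c: "\<exists>i<Suc N. c i \<noteq> 0" "in_ideal gs (\<Sum>i<Suc N. const3 (c i) * (h \<circ> b) i)"
    unfolding codim_le_def by blast
  define a where "a = the_inv_into {0..<Suc N} b"
  have ab: "a (b i) = i" if "i < Suc N" for i
    unfolding a_def using b that by (intro the_inv_into_f_f) (auto simp: bij_betw_def)
  define c' where "c' = (\<lambda>s. if s \<in> T then c (a s) else 0)"
  have "(\<Sum>s\<in>S. const3 (c' s) * h s) = (\<Sum>s\<in>T. const3 (c' s) * h s)"
    by (rule sum.mono_neutral_right) (use T(1) assms(2) in \<open>auto simp: c'_def\<close>)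
  also have "\<dots> = (\<Sum>i\<in>{0..<Suc N}. const3 (c' (b i)) * h (b i))"
    by (rule sum.reindex_bij_betw[OF b, symmetric])
  also have "\<dots> = (\<Sum>i<Suc N. const3 (c i) * (h \<circ> b) i)"
    by (rule sum.cong) (auto simp: c'_def bT ab)
  finally have "in_ideal gs (\<Sum>s\<in>S. const3 (c' s) * h s)" using c(2) by simp
  moreover obtain i where "i < Suc N" "c i \<noteq> 0" using c(1) by blast
  then have "\<exists>s\<in>S. c' s \<noteq> 0"
    using bT[of i] ab[of i] T(1) by (intro bexI[of _ "b i"]) (auto simp: c'_def)
  ultimately show ?thesis using that by blast
qed

text \<open>By \<open>step\<close>, multiplication by \<open>\<mu>\<close> maps the quotient in
  degree \<open>n\<close> onto the quotient in degree \<open>n + 1\<close>, and a surjection cannot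
  raise the dimension.\<close>

lemma codim_le_Suc:
  assumes "codim_le gs n N"
    and step: "\<And>h. homog (Suc n) h \<Longrightarrow> \<exists>h'. homog n h' \<and> in_ideal gs (h - \<mu> * h')"
  shows "codim_le gs (Suc n) N"
  unfolding codim_le_def
proof (intro allI impI)
  fix h assume "\<forall>i<Suc N. homog (Suc n) (h i)"
  then have "\<forall>i<Suc N. \<exists>h'. homog n h' \<and> in_ideal gs (h i - \<mu> * h')" using step by blast
  then obtain k where k: "\<And>i. i < Suc N \<Longrightarrow> homog n (k i)" "\<And>i. i < Suc N \<Longrightarrow> in_ideal gs (h i - \<mu> * k i)"
    by metis
  with assms(1) obtain c where c: "\<exists>i<Suc N. c i \<noteq> 0" "in_ideal gs (\<Sum>i<Suc N. const3 (c i) * k i)"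
    unfolding codim_le_def by blast
  have "(\<Sum>i<Suc N. const3 (c i) * h i) =
    \<mu> * (\<Sum>i<Suc N. const3 (c i) * k i) + (\<Sum>i<Suc N. const3 (c i) * (h i - \<mu> * k i))"
    unfolding sum_distrib_left sum.distrib[symmetric] by (intro sum.cong) (simp_all add: algebra_simps)
  moreover have "in_ideal gs \<dots>"
    by (intro in_ideal_add in_ideal_mult c in_ideal_sum k) auto
  ultimately show "\<exists>c. (\<exists>i<Suc N. c i \<noteq> 0) \<and> in_ideal gs (\<Sum>i<Suc N. const3 (c i) * h i)"
    using c(1) by auto
qed

lemma codim_le_mono_ideal:
  assumes "codim_le gs n N" "set gs \<subseteq> set gs'"
  shows "codim_le gs' n N"
  unfolding codim_le_def
proof (intro allI impI)
  fix h assume "\<forall>i<Suc N. homog n (h i)"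
  with assms(1) obtain c where c: "\<exists>i<Suc N. c i \<noteq> 0" "in_ideal gs (\<Sum>i<Suc N. const3 (c i) * h i)"
    unfolding codim_le_def by blast
  have "in_ideal gs' (\<Sum>i<Suc N. const3 (c i) * h i)"
    using c(2) by (rule in_ideal_mono) (use assms(2) in \<open>auto intro: in_ideal_mem\<close>)
  with c(1) show "\<exists>c. (\<exists>i<Suc N. c i \<noteq> 0) \<and> in_ideal gs' (\<Sum>i<Suc N. const3 (c i) * h i)"
    by (intro exI[of _ c] conjI)
qed

section \<open>Counting monomials against syzygies\<close>

definition mons :: "nat \<Rightarrow> (nat \<times> nat \<times> nat) set" where
  "mons k = (\<lambda>(i, j). (i, j, k - i - j)) ` (SIGMA i:{..k}. {..k - i})"

lemma in_mons_iff: "(a, b, c) \<in> mons k \<longleftrightarrow> a + b + c = k"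
  unfolding mons_def by (auto simp: image_iff intro!: bexI[of _ "(a, b)"])

lemma finite_mons [simp]: "finite (mons k)"
  by (simp add: mons_def)

lemma card_mons: "card (mons k) = (\<Sum>i\<le>k. Suc (k - i))"
  unfolding mons_def by (subst card_image) (auto simp: inj_on_def)

lemma homog_iff_keys: "homog d f \<longleftrightarrow> Poly_Mapping.keys f \<subseteq> mons d"
  unfolding homog_def by (auto simp: in_mons_iff)

text \<open>The products of degree \<open>k\<close> monomials with the three partials, together with
  \<open>N + 1\<close> forms, outnumber the monomials of degree \<open>k + d\<close>, so they
  satisfy a linear relation. A relation in which none of the forms occurs would be a syzygy of
  degree \<open>k\<close>.\<close>

lemma codim_le_if_no_syzygy:
  assumes f: "homog (Suc d) f" and AR: "\<not> AR_nonzero f k"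
    and card: "card (mons (k + d)) \<le> N + 3 * card (mons k)"
  shows "codim_le [pd 0 f, pd 1 f, pd 2 f] (k + d) N"
  unfolding codim_le_def
proof (intro allI impI)
  fix h assume h: "\<forall>i<Suc N. homog (k + d) (h i)"
  define g where "g = (\<lambda>s. case s of Inl i \<Rightarrow> h i | Inr (m, v) \<Rightarrow> Poly_Mapping.single m 1 * pd v f)"
  define I where "I = Inl ` {..<Suc N} \<union> Inr ` (mons k \<times> {..<3::nat})"
  have finI: "finite I" by (simp add: I_def)
  have "card I = Suc N + card (mons k) * 3"
    unfolding I_def by (subst card_Un_disjoint) (auto simp: card_image)
  then have lt: "card (mons (k + d)) < card I" using card by simp
  obtain c where c: "\<exists>s\<in>I. c s \<noteq> 0"
    "\<forall>m\<in>mons (k + d). (\<Sum>s\<in>I. c s * Poly_Mapping.lookup (g s) m) = 0"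
    using ex_nontrivial_solution[OF finite_mons finI lt, of "\<lambda>s. Poly_Mapping.lookup (g s)"] by blast
  have hom: "homog (k + d) (g s)" if "s \<in> I" for s
    using that h f by (auto simp: I_def g_def in_mons_iff intro!: homog_mult homog_single homog_pd)
  have zero: "(\<Sum>s\<in>I. const3 (c s) * g s) = 0"
  proof (rule poly_mapping_eqI)
    fix m
    show "Poly_Mapping.lookup (\<Sum>s\<in>I. const3 (c s) * g s) m = Poly_Mapping.lookup 0 m"
    proof (cases "m \<in> mons (k + d)")
      case True
      then show ?thesis using c(2) by (simp add: lookup_sum)
    next
      case False
      then have "Poly_Mapping.lookup (g s) m = 0" if "s \<in> I" for s
        using hom[OF that] unfolding homog_iff_keys by (force simp: in_keys_iff)
      then show ?thesis by (simp add: lookup_sum)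
    qed
  qed
  \<comment> \<open>Collecting the coefficients that belong to one partial derivative turns the
    relation into a candidate syzygy \<open>(A 0, A 1, A 2)\<close>.\<close>
  define A where "A v = (\<Sum>m\<in>mons k. const3 (c (Inr (m, v))) * Poly_Mapping.single m 1)" for v
  have "(\<Sum>s\<in>I. const3 (c s) * g s) = (\<Sum>i<Suc N. const3 (c (Inl i)) * h i)
      + (\<Sum>(m, v)\<in>mons k \<times> {..<3}. const3 (c (Inr (m, v))) * (Poly_Mapping.single m 1 * pd v f))"
    unfolding I_def
    by (subst sum.union_disjoint) (auto simp: sum.reindex g_def simp del: sum.lessThan_Suc intro!: sum.cong)
  also have "(\<Sum>(m, v)\<in>mons k \<times> {..<3}. const3 (c (Inr (m, v))) * (Poly_Mapping.single m 1 * pd v f))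
     = (\<Sum>v<3. A v * pd v f)"
    unfolding sum.cartesian_product[symmetric] A_def sum_distrib_right
    by (subst sum.swap) (simp add: mult.assoc)
  also have "\<dots> = A 0 * pd 0 f + A 1 * pd 1 f + A 2 * pd 2 f"
    by (simp add: eval_nat_numeral)
  finally have eq: "(\<Sum>i<Suc N. const3 (c (Inl i)) * h i) + (A 0 * pd 0 f + A 1 * pd 1 f + A 2 * pd 2 f) = 0"
    using zero by simp
  have lookA: "Poly_Mapping.lookup (A v) m = c (Inr (m, v))" if "m \<in> mons k" for v m
    using that by (simp add: A_def lookup_sum lookup_single when_def if_distrib[of "(*) _"] cong: if_cong)
  have homA: "homog k (A v)" for v
    unfolding A_def
    by (intro homog_sum homog_const_mult) (auto simp: in_mons_iff intro: homog_single)
  have "\<exists>i<Suc N. c (Inl i) \<noteq> 0"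
  proof (rule ccontr)
    assume "\<not> (\<exists>i<Suc N. c (Inl i) \<noteq> 0)"
    then have 0: "c (Inl i) = 0" if "i < Suc N" for i using that by blast
    have "A 0 * pd 0 f + A 1 * pd 1 f + A 2 * pd 2 f = 0"
      using eq 0 by (simp del: sum.lessThan_Suc)
    moreover have "(A 0, A 1, A 2) \<noteq> (0, 0, 0)"
    proof
      assume A0: "(A 0, A 1, A 2) = (0, 0, 0)"
      obtain m v where "m \<in> mons k" "v < 3" "c (Inr (m, v)) \<noteq> 0"
        using c(1) 0 by (auto simp: I_def)
      moreover have "A v = 0" using A0 \<open>v < 3\<close> by (elim var3_cases) auto
      ultimately show False using lookA[of m v] by simp
    qed
    ultimately have "AR_nonzero f k"
      unfolding AR_nonzero_def using homA by blast
    with AR show False ..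
  qed
  moreover have "in_ideal [pd 0 f, pd 1 f, pd 2 f] (\<Sum>i<Suc N. const3 (c (Inl i)) * h i)"
  proof -
    have "(\<Sum>i<Suc N. const3 (c (Inl i)) * h i) = - (A 0 * pd 0 f + A 1 * pd 1 f + A 2 * pd 2 f)"
      using eq unfolding eq_neg_iff_add_eq_0 .
    also have "in_ideal [pd 0 f, pd 1 f, pd 2 f] \<dots>"
      by (intro in_ideal_uminus in_ideal_add in_ideal_mult in_ideal_mem) auto
    finally show ?thesis .
  qed
  ultimately show "\<exists>c. (\<exists>i<Suc N. c i \<noteq> 0) \<and> in_ideal [pd 0 f, pd 1 f, pd 2 f] (\<Sum>i<Suc N. const3 (c i) * h i)"
    by (intro exI[of _ "\<lambda>i. c (Inl i)"]) blast
qed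

section \<open>Jets along curves and Tjurina numbers\<close>

subsection \<open>Truncated power series\<close>

text \<open>A power series with nonzero constant term is a unit, so it can be cancelled modulo the
  \<open>m\<close>th power of the variable.\<close>

lemma monom_dvd_cancel:
  fixes p q :: "'a::field poly"
  assumes "monom 1 m dvd p * q" "coeff p 0 \<noteq> 0"
  shows "monom 1 m dvd q"
proof -
  have "coeff q k = 0" if "k < m" for k
    using that
  proof (induction k rule: less_induct)
    case (less k)
    have "0 = coeff (p * q) k"
      using assms(1) less.prems by (simp add: monom_1_dvd_iff')
    also have "\<dots> = (\<Sum>i\<le>k. coeff p i * coeff q (k - i))"
      by (rule coeff_mult)
    also have "\<dots> = (\<Sum>i\<le>k. if i = 0 then coeff p 0 * coeff q k else 0)"
      using less by (intro sum.cong) auto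
    also have "\<dots> = coeff p 0 * coeff q k"
      by simp
    finally show ?case using assms(2) by simp
  qed
  then show ?thesis by (simp add: monom_1_dvd_iff')
qed

text \<open>Comparing coefficients in increasing order gives a triangular system: at order
  \<open>k\<close> the earlier summands are already zero and the later ones start higher.\<close>

lemma monom_dvd_triangular:
  fixes W :: "nat \<Rightarrow> 'a::field poly"
  assumes "monom 1 m dvd (\<Sum>k<m. [:c k:] * (monom 1 k * W k))"
    and "\<And>k. k < m \<Longrightarrow> coeff (W k) 0 \<noteq> 0" and "k < m"
  shows "c k = 0"
  using assms(3)
proof (induction k rule: less_induct)
  case (less k)
  have "0 = coeff (\<Sum>k<m. [:c k:] * (monom 1 k * W k)) k"
    using assms(1) less.prems by (simp add: monom_1_dvd_iff')
  also have "\<dots> = (\<Sum>j<m. if j = k then c k * coeff (W k) 0 else 0)"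
    unfolding coeff_sum using less
    by (intro sum.cong) (auto simp: coeff_monom_mult)
  also have "\<dots> = c k * coeff (W k) 0"
    using less.prems by simp
  finally show ?case using assms(2)[OF less.prems] by simp
qed

subsection \<open>Points of the projective plane\<close>

lemma scale_1 [simp]: "scale 1 p = p" and scale_scale: "scale r (scale s p) = scale (r * s) p"
  by (cases p; simp add: scale_def mult.assoc)+

lemma scale_eq_0_iff: "scale r p = 0 \<longleftrightarrow> r = 0 \<or> p = 0"
  by (cases p) (auto simp: scale_def zero_prod_def)

lemma in_proj_self [simp]: "p \<in> proj p"
  unfolding proj_def by (auto intro!: exI[of _ 1])

lemma in_projE:
  assumes "p \<in> proj q"
  obtains r where "r \<noteq> 0" "p = scale r q"
  using assms by (auto simp: proj_def)

lemma proj_eqI: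
  assumes "p \<in> proj q"
  shows "proj p = proj q"
proof -
  obtain r where r: "r \<noteq> 0" "p = scale r q" using assms by (rule in_projE)
  have "scale s p \<in> proj q" if "s \<noteq> 0" for s
    unfolding proj_def r scale_scale using that r by (auto intro!: exI[of _ "s * r"])
  moreover have "scale s q \<in> proj p" if "s \<noteq> 0" for s
    unfolding proj_def using that r by (auto intro!: exI[of _ "s / r"] simp: scale_scale)
  ultimately show ?thesis by (auto simp: proj_def)
qed

lemma proj_eq_iff: "proj p = proj q \<longleftrightarrow> p \<in> proj q"
  using proj_eqI in_proj_self by metis

lemma ex_linear_nonzero:
  assumes "q \<noteq> 0"
  obtains l where "homog 1 l" "peval l q \<noteq> 0"
proof -
  obtain a b c where q: "q = (a, b, c)" by (cases q)
  consider "a \<noteq> 0" | "b \<noteq> 0" | "c \<noteq> 0" using assms q by (auto simp: zero_prod_def)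
  then show ?thesis
    by cases (use that[of "var3 0"] that[of "var3 1"] that[of "var3 2"] q in auto)
qed

lemma ex_linear_separating:
  assumes "p \<noteq> 0" "q \<noteq> 0" "q \<notin> proj p"
  obtains l where "homog 1 l" "peval l p = 0" "peval l q \<noteq> 0"
proof -
  obtain a b c d e f where pq: "p = (a, b, c)" "q = (d, e, f)" by (cases p; cases q)
  have hom: "homog 1 (const3 u * var3 v - const3 u' * var3 v')" for u u' v v'
    by (intro homog_diff homog_const_mult homog_var)
  consider "b * d - a * e \<noteq> 0" | "c * d - a * f \<noteq> 0" | "c * e - b * f \<noteq> 0"
    | "b * d = a * e" "c * d = a * f" "c * e = b * f"
    by force
  then show ?thesis
  proof cases
    case 1
    show ?thesis by (rule that[OF hom[of b 0 a 1]]) (use 1 in \<open>auto simp: pq\<close>)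
  next
    case 2
    show ?thesis by (rule that[OF hom[of c 0 a 2]]) (use 2 in \<open>auto simp: pq\<close>)
  next
    case 3
    show ?thesis by (rule that[OF hom[of c 1 b 2]]) (use 3 in \<open>auto simp: pq\<close>)
  next
    case 4
    consider "a \<noteq> 0" | "b \<noteq> 0" | "c \<noteq> 0" using assms(1) pq by (auto simp: zero_prod_def)
    then have "\<exists>r. q = scale r p"
    proof cases
      case 1
      then show ?thesis using 4 by (intro exI[of _ "d / a"]) (auto simp: pq scale_def field_simps)
    next
      case 2
      then show ?thesis using 4 by (intro exI[of _ "e / b"]) (auto simp: pq scale_def field_simps)
    next
      case 3
      then show ?thesis using 4 by (intro exI[of _ "f / c"]) (auto simp: pq scale_def field_simps)
    qed
    then obtain r where "q = scale r p" by blast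
    moreover have "r \<noteq> 0" using calculation assms(2) by (auto simp: scale_eq_0_iff)
    ultimately show ?thesis using assms(3) by (auto simp: proj_def)
  qed
qed

definition base :: "complex poly \<times> complex poly \<times> complex poly \<Rightarrow> pt" where
  "base \<psi> = (case \<psi> of (a, b, c) \<Rightarrow> (poly a 0, poly b 0, poly c 0))"

lemma coeff_jet_0: "coeff (jet \<psi> f) 0 = peval f (base \<psi>)"
  by (cases \<psi>) (simp add: base_def poly_jet flip: poly_0_coeff_0)

text \<open>The conditions imposed on forms by the germs \<open>\<psi> i\<close>, truncated at order
  \<open>m i\<close>. \<open>immersed\<close> provides a linear form of order exactly one along the
  germ, whose powers attain every order below \<open>m i\<close>. If \<open>m i = 1\<close>, only
  the value at the base point counts, and a constant germ is admissible.\<close>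

locale jet_system =
  fixes gs :: "poly3 list" and I :: "'i set"
    and \<psi> :: "'i \<Rightarrow> complex poly \<times> complex poly \<times> complex poly" and m :: "'i \<Rightarrow> nat"
  assumes fin: "finite I"
    and kills: "i \<in> I \<Longrightarrow> g \<in> set gs \<Longrightarrow> monom 1 (m i) dvd jet (\<psi> i) g"
    and pos: "i \<in> I \<Longrightarrow> 0 < m i"
    and base_neq_0: "i \<in> I \<Longrightarrow> base (\<psi> i) \<noteq> 0"
    and distinct: "i \<in> I \<Longrightarrow> j \<in> I \<Longrightarrow> i \<noteq> j \<Longrightarrow> base (\<psi> j) \<notin> proj (base (\<psi> i))"
    and immersed: "i \<in> I \<Longrightarrow> m i = 1 \<or>
      (\<exists>l. homog 1 l \<and> coeff (jet (\<psi> i) l) 0 = 0 \<and> coeff (jet (\<psi> i) l) 1 \<noteq> 0)"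
begin

definition killed :: "poly3 \<Rightarrow> bool" where
  "killed h \<longleftrightarrow> (\<forall>i\<in>I. monom 1 (m i) dvd jet (\<psi> i) h)"

lemma ideal_killed: "in_ideal gs h \<Longrightarrow> killed h"
  unfolding killed_def by (auto intro: const1.ev_in_ideal_dvd kills)

text \<open>A product of powers of linear forms, each vanishing at one other base point but not at
  that of \<open>i\<close>, padded to degree \<open>n\<close> by a linear form nonzero at the
  latter.\<close>

lemma ex_peak:
  assumes "i \<in> I" "(\<Sum>j\<in>I. m j) \<le> n"
  obtains t where "homog n t" "coeff (jet (\<psi> i) t) 0 \<noteq> 0"
    "\<And>j. j \<in> I \<Longrightarrow> j \<noteq> i \<Longrightarrow> monom 1 (m j) dvd jet (\<psi> j) t"
proof -
  have "\<exists>l. homog 1 l \<and> peval l (base (\<psi> j)) = 0 \<and> peval l (base (\<psi> i)) \<noteq> 0" if "j \<in> I - {i}" for j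
  proof -
    have "base (\<psi> i) \<notin> proj (base (\<psi> j))" using that assms(1) by (intro distinct) auto
    from ex_linear_separating[OF base_neq_0 base_neq_0 this] that assms(1) show ?thesis by blast
  qed
  then obtain l where l: "\<And>j. j \<in> I - {i} \<Longrightarrow> homog 1 (l j) \<and> peval (l j) (base (\<psi> j)) = 0 \<and> peval (l j) (base (\<psi> i)) \<noteq> 0"
    by metis
  obtain \<nu> where \<nu>: "homog 1 \<nu>" "peval \<nu> (base (\<psi> i)) \<noteq> 0"
    using ex_linear_nonzero[OF base_neq_0[OF assms(1)]] by blast
  define k where "k = (\<Sum>j\<in>I - {i}. m j * 1)"
  have k: "k \<le> n" using assms fin by (simp add: k_def sum.remove[of I i])
  define t where "t = (\<Prod>j\<in>I - {i}. l j ^ m j) * \<nu> ^ (n - k)"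
  show ?thesis
  proof
    have "homog (k + (n - k) * 1) t"
      unfolding t_def k_def by (intro homog_mult homog_prod homog_power \<nu>) (use l in auto)
    then show "homog n t" using k by simp
    show "coeff (jet (\<psi> i) t) 0 \<noteq> 0"
      unfolding coeff_jet_0 t_def using l \<nu> fin by simp
    fix j assume j: "j \<in> I" "j \<noteq> i"
    have "monom 1 1 dvd jet (\<psi> j) (l j)"
      using l[of j] j by (simp add: monom_1_dvd_iff' coeff_jet_0)
    then have "monom 1 1 ^ m j dvd jet (\<psi> j) (l j) ^ m j" by (rule dvd_power_same)
    moreover have "l j ^ m j dvd t"
      unfolding t_def using j fin by (intro dvd_mult2 dvd_prodI) auto
    then have "jet (\<psi> j) (l j) ^ m j dvd jet (\<psi> j) t"
      by (auto simp: dvd_def)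
    ultimately show "monom 1 (m j) dvd jet (\<psi> j) t"
      by (simp add: monom_power) (meson dvd_trans)
  qed
qed

text \<open>A peak form times the \<open>k\<close>th power of a linear form of order one along germ
  \<open>i\<close>.\<close>

lemma ex_order:
  assumes "i \<in> I" "k < m i" "2 * (\<Sum>j\<in>I. m j) \<le> n"
  obtains b W where "homog n b" "jet (\<psi> i) b = monom 1 k * W" "coeff W 0 \<noteq> 0"
    "\<And>j. j \<in> I \<Longrightarrow> j \<noteq> i \<Longrightarrow> monom 1 (m j) dvd jet (\<psi> j) b"
proof -
  let ?M = "\<Sum>j\<in>I. m j"
  have "k < ?M" using assms fin member_le_sum[of i I m] by simp
  then have le: "?M \<le> n - k" using assms(3) by simp
  \<comment> \<open>If \<open>m i = 1\<close>, the form 0 can stand in for \<open>l\<close>: then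
    \<open>k = 0\<close> and \<open>l ^ k = 1\<close>.\<close>
  obtain l where l: "homog 1 l" "m i = 1 \<or> coeff (jet (\<psi> i) l) 0 = 0 \<and> coeff (jet (\<psi> i) l) 1 \<noteq> 0"
    using immersed[OF assms(1)] homog_0[of 1] by blast
  obtain t where t: "homog (n - k) t" "coeff (jet (\<psi> i) t) 0 \<noteq> 0"
    "\<And>j. j \<in> I \<Longrightarrow> j \<noteq> i \<Longrightarrow> monom 1 (m j) dvd jet (\<psi> j) t"
    using ex_peak[OF assms(1) le] by blast
  have "\<exists>W. jet (\<psi> i) (l ^ k) = monom 1 k * W \<and> coeff W 0 \<noteq> 0"
  proof (cases "m i = 1")
    case True
    then show ?thesis using assms(2) by (intro exI[of _ 1]) auto
  next
    case False
    then have c: "coeff (jet (\<psi> i) l) 0 = 0" "coeff (jet (\<psi> i) l) 1 \<noteq> 0" using l by auto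
    then have "monom 1 1 dvd jet (\<psi> i) l" by (simp add: monom_1_dvd_iff')
    then obtain V where V: "jet (\<psi> i) l = monom 1 1 * V" by (auto simp: dvd_def)
    have "coeff V 0 \<noteq> 0" using c(2) by (simp add: V coeff_monom_mult)
    then have "coeff (V ^ k) 0 \<noteq> 0" by (simp add: coeff_0_power)
    then show ?thesis by (intro exI[of _ "V ^ k"]) (simp add: V power_mult_distrib monom_power)
  qed
  then obtain W where W: "jet (\<psi> i) (l ^ k) = monom 1 k * W" "coeff W 0 \<noteq> 0" by blast
  show ?thesis
  proof
    have "homog ((n - k) + k * 1) (t * l ^ k)" by (intro homog_mult homog_power t l)
    then show "homog n (t * l ^ k)" using \<open>k < ?M\<close> assms(3) by simp
    show "jet (\<psi> i) (t * l ^ k) = monom 1 k * (jet (\<psi> i) t * W)"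
      unfolding const1.ev_mult W by (simp add: mult_ac)
    show "coeff (jet (\<psi> i) t * W) 0 \<noteq> 0" using t W by (simp add: coeff_mult_0)
    show "monom 1 (m j) dvd jet (\<psi> j) (t * l ^ k)" if "j \<in> I" "j \<noteq> i" for j
      unfolding const1.ev_mult using t(3)[OF that] by (rule dvd_mult2)
  qed
qed

text \<open>The forms of \<open>ex_order\<close> have a jet matrix that is block diagonal over the
  germs, with triangular blocks. So the truncated jets are independent conditions in degree
  \<open>n\<close>.\<close>

lemma ex_dual_family:
  assumes "2 * (\<Sum>j\<in>I. m j) \<le> n"
  obtains b where "\<And>i k. i \<in> I \<Longrightarrow> k < m i \<Longrightarrow> homog n (b (i, k))"
    "\<And>c. killed (\<Sum>s\<in>Sigma I (\<lambda>i. {..<m i}). const3 (c s) * b s) \<Longrightarrow>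
       \<forall>s\<in>Sigma I (\<lambda>i. {..<m i}). c s = 0"
proof -
  have "\<exists>b W. homog n b \<and> jet (\<psi> i) b = monom 1 k * W \<and> coeff W 0 \<noteq> 0 \<and>
    (\<forall>j\<in>I. j \<noteq> i \<longrightarrow> monom 1 (m j) dvd jet (\<psi> j) b)" if "i \<in> I" "k < m i" for i k
    by (rule ex_order[OF that assms]) blast
  then obtain b W where bW: "\<And>i k. i \<in> I \<Longrightarrow> k < m i \<Longrightarrow> homog n (b i k) \<and> jet (\<psi> i) (b i k) = monom 1 k * W i k \<and>
    coeff (W i k) 0 \<noteq> 0 \<and> (\<forall>j\<in>I. j \<noteq> i \<longrightarrow> monom 1 (m j) dvd jet (\<psi> j) (b i k))"
    by metis
  show ?thesis
  proof (rule that[of "\<lambda>(i, k). b i k"])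
    show "homog n (case (i, k) of (i, k) \<Rightarrow> b i k)" if "i \<in> I" "k < m i" for i k
      using bW[OF that] by simp
    fix c
    assume kl: "killed (\<Sum>s\<in>Sigma I (\<lambda>i. {..<m i}). const3 (c s) * (case s of (i, k) \<Rightarrow> b i k))"
    have "c (i, k) = 0" if i: "i \<in> I" and k: "k < m i" for i k
    proof -
      let ?T = "\<lambda>j. \<Sum>k<m j. [:c (j, k):] * jet (\<psi> i) (b j k)"
      have "monom 1 (m i) dvd jet (\<psi> i) (\<Sum>s\<in>Sigma I (\<lambda>i. {..<m i}). const3 (c s) * (case s of (i, k) \<Rightarrow> b i k))"
        using kl i unfolding killed_def by blast
      also have "jet (\<psi> i) (\<Sum>s\<in>Sigma I (\<lambda>i. {..<m i}). const3 (c s) * (case s of (i, k) \<Rightarrow> b i k)) = (\<Sum>j\<in>I. ?T j)"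
        unfolding const1.ev_sum const1.ev_mult const1.ev_const using fin
        by (subst sum.Sigma) (auto intro!: sum.cong)
      also have "\<dots> = ?T i + (\<Sum>j\<in>I - {i}. ?T j)"
        using fin i by (rule sum.remove)
      finally have "monom 1 (m i) dvd ?T i + (\<Sum>j\<in>I - {i}. ?T j)" .
      moreover have "monom 1 (m i) dvd (\<Sum>j\<in>I - {i}. ?T j)"
        using bW i by (intro dvd_sum dvd_mult) auto
      ultimately have "monom 1 (m i) dvd ?T i"
        using dvd_add_left_iff by blast
      also have "?T i = (\<Sum>k<m i. [:c (i, k):] * (monom 1 k * W i k))"
        using bW[OF i] by (intro sum.cong) auto
      finally show ?thesis
        by (rule monom_dvd_triangular) (use bW[OF i] k in auto)
    qed
    then show "\<forall>s\<in>Sigma I (\<lambda>i. {..<m i}). c s = 0" by auto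
  qed
qed

lemma card_Sigma_m: "card (Sigma I (\<lambda>i. {..<m i})) = (\<Sum>i\<in>I. m i)"
  using fin by simp

text \<open>The dual family stays independent modulo the ideal, because the jets annihilate the
  ideal.\<close>

lemma sum_le_codim:
  assumes "codim_le gs n N" "2 * (\<Sum>j\<in>I. m j) \<le> n"
  shows "(\<Sum>j\<in>I. m j) \<le> N"
proof (rule ccontr)
  assume "\<not> ?thesis"
  then have N: "N < card (Sigma I (\<lambda>i. {..<m i}))" by (simp add: card_Sigma_m)
  obtain b where b: "\<And>i k. i \<in> I \<Longrightarrow> k < m i \<Longrightarrow> homog n (b (i, k))"
    "\<And>c. killed (\<Sum>s\<in>Sigma I (\<lambda>i. {..<m i}). const3 (c s) * b s) \<Longrightarrow>
       \<forall>s\<in>Sigma I (\<lambda>i. {..<m i}). c s = 0"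
    using ex_dual_family[OF assms(2)] by blast
  have "finite (Sigma I (\<lambda>i. {..<m i}))" "\<And>s. s \<in> Sigma I (\<lambda>i. {..<m i}) \<Longrightarrow> homog n (b s)"
    using fin b by auto
  then obtain c where c: "\<exists>s\<in>Sigma I (\<lambda>i. {..<m i}). c s \<noteq> 0"
    "in_ideal gs (\<Sum>s\<in>Sigma I (\<lambda>i. {..<m i}). const3 (c s) * b s)"
    by (rule codim_leD[OF assms(1) _ N])
  from b(2)[OF ideal_killed[OF c(2)]] c(1) show False by simp
qed

text \<open>Converse of \<open>ideal_killed\<close> when both counts agree: \<open>h\<close> and the
  dual family are one form too many, hence dependent modulo the ideal. The jets force the
  coefficients of the dual family to vanish, so a nonzero multiple of \<open>h\<close> lies in the
  ideal.\<close>

lemma in_ideal_if_killed: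
  assumes "codim_le gs n (\<Sum>j\<in>I. m j)" "2 * (\<Sum>j\<in>I. m j) \<le> n" "homog n h" "killed h"
  shows "in_ideal gs h"
proof -
  let ?S = "Sigma I (\<lambda>i. {..<m i})"
  obtain b where b: "\<And>i k. i \<in> I \<Longrightarrow> k < m i \<Longrightarrow> homog n (b (i, k))"
    "\<And>c. killed (\<Sum>s\<in>?S. const3 (c s) * b s) \<Longrightarrow> \<forall>s\<in>?S. c s = 0"
    using ex_dual_family[OF assms(2)] by blast
  define S where "S = insert None (Some ` ?S)"
  define b' where "b' = (\<lambda>s. case s of None \<Rightarrow> h | Some s \<Rightarrow> b s)"
  have finS: "finite ?S" using fin by auto
  have S: "finite S" "(\<Sum>j\<in>I. m j) < card S"
    using finS card_Sigma_m unfolding S_def by (auto simp: card_insert_if card_image)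
  have "homog n (b' s)" if "s \<in> S" for s
    using that b(1) assms(3) by (auto simp: S_def b'_def)
  then obtain c where c: "\<exists>s\<in>S. c s \<noteq> 0" "in_ideal gs (\<Sum>s\<in>S. const3 (c s) * b' s)"
    by (rule codim_leD[OF assms(1) S])
  have sum: "(\<Sum>s\<in>S. const3 (c s) * b' s) = const3 (c None) * h + (\<Sum>s\<in>?S. const3 (c (Some s)) * b s)"
    unfolding S_def using finS by (subst sum.insert) (auto simp: sum.reindex b'_def)
  have "killed (\<Sum>s\<in>?S. const3 (c (Some s)) * b s)"
    unfolding killed_def
  proof
    fix i assume i: "i \<in> I"
    have "monom 1 (m i) dvd jet (\<psi> i) (const3 (c None) * h + (\<Sum>s\<in>?S. const3 (c (Some s)) * b s))"
      using ideal_killed[OF c(2)] i unfolding sum killed_def by blast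
    moreover have "monom 1 (m i) dvd jet (\<psi> i) (const3 (c None) * h)"
      unfolding const1.ev_mult using assms(4) i by (auto simp: killed_def intro: dvd_smult)
    ultimately show "monom 1 (m i) dvd jet (\<psi> i) (\<Sum>s\<in>?S. const3 (c (Some s)) * b s)"
      unfolding const1.ev_add using dvd_add_right_iff by blast
  qed
  then have 0: "\<forall>s\<in>?S. c (Some s) = 0" by (rule b(2)[of "\<lambda>s. c (Some s)"])
  then have "c None \<noteq> 0" using c(1) by (auto simp: S_def)
  have "in_ideal gs (const3 (c None) * h)" using c(2) 0 by (simp add: sum)
  from in_ideal_mult[OF this, of "const3 (1 / c None)"] \<open>c None \<noteq> 0\<close>
  show ?thesis by (simp add: mult.assoc[symmetric] const3_mult[symmetric])
qed

text \<open>Upper bound: more than \<open>m i\<close> forms have a nontrivial combination of order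
  at least \<open>m i\<close> on germ \<open>i\<close>; multiplied by a peak form, nonzero at
  \<open>p\<close>, it is killed on all germs and hence in the ideal. Lower bound: forms of exact
  orders 0 to \<open>m i - 1\<close> remain independent, since a multiplier nonzero at
  \<open>p\<close> is a unit along the germ.\<close>

lemma loc_len_eq:
  assumes codim: "\<And>n. n0 \<le> n \<Longrightarrow> codim_le gs n (\<Sum>j\<in>I. m j)"
    and i: "i \<in> I" and p: "p \<in> proj (base (\<psi> i))"
  shows "loc_len gs p = enat (m i)"
proof -
  let ?M = "\<Sum>j\<in>I. m j"
  obtain r where r: "r \<noteq> 0" "p = scale r (base (\<psi> i))" using p by (rule in_projE)
  have peval_p: "peval t p \<noteq> 0 \<longleftrightarrow> coeff (jet (\<psi> i) t) 0 \<noteq> 0" if "homog e t" for t e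
    using r peval_scale[OF that] by (simp add: coeff_jet_0)
  show ?thesis
    unfolding loc_len_def
  proof (rule antisym)
    show "Sup {enat n |n. \<exists>e hs. length hs = n \<and> (\<forall>h\<in>set hs. homog e h) \<and> lin_indep_mod gs p hs} \<le> enat (m i)"
    proof (rule Sup_least, clarsimp)
      fix e hs assume hs: "\<forall>h\<in>set hs. homog e h" and ind: "lin_indep_mod gs p hs"
      show "length hs \<le> m i"
      proof (rule ccontr)
        assume "\<not> length hs \<le> m i"
        then have "card {..<m i} < card {..<length hs}" by simp
        from ex_nontrivial_solution[OF _ _ this, of "\<lambda>s k. coeff (jet (\<psi> i) (hs ! s)) k"]
        obtain c where c: "\<exists>s<length hs. c s \<noteq> 0"
          "\<And>k. k < m i \<Longrightarrow> (\<Sum>s<length hs. c s * coeff (jet (\<psi> i) (hs ! s)) k) = 0"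
          by auto
        define H where "H = (\<Sum>s<length hs. const3 (c s) * hs ! s)"
        have H: "homog e H"
          unfolding H_def using hs by (intro homog_sum homog_const_mult) auto
        have "jet (\<psi> i) H = (\<Sum>s<length hs. [:c s:] * jet (\<psi> i) (hs ! s))"
          by (simp add: H_def)
        then have Hi: "monom 1 (m i) dvd jet (\<psi> i) H"
          using c(2) by (simp add: monom_1_dvd_iff' coeff_sum)
        \<comment> \<open>A multiplier of this degree meets both the threshold \<open>n0\<close> of
          the codimension bound and the degree needed for a dual family.\<close>
        have "?M \<le> 2 * ?M + n0" by simp
        then obtain t where t: "homog (2 * ?M + n0) t" "coeff (jet (\<psi> i) t) 0 \<noteq> 0"
          "\<And>j. j \<in> I \<Longrightarrow> j \<noteq> i \<Longrightarrow> monom 1 (m j) dvd jet (\<psi> j) t"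
          using ex_peak[OF i] by blast
        have "killed (t * H)"
          unfolding killed_def
        proof
          fix j assume "j \<in> I"
          then show "monom 1 (m j) dvd jet (\<psi> j) (t * H)"
            using t(3)[of j] Hi by (cases "j = i") (auto intro: dvd_mult dvd_mult2)
        qed
        then have "in_ideal gs (t * H)"
          by (intro in_ideal_if_killed[of "2 * ?M + n0 + e"] codim homog_mult t H) auto
        with ind c(1) t(1) peval_p[OF t(1)] t(2) show False
          unfolding lin_indep_mod_def H_def by blast
      qed
    qed
  next
    have "\<exists>b W. homog (2 * ?M) b \<and> jet (\<psi> i) b = monom 1 k * W \<and> coeff W 0 \<noteq> 0" if "k < m i" for k
      using ex_order[OF i that, of "2 * ?M"] by (metis order_refl)
    then obtain b W where bW: "\<And>k. k < m i \<Longrightarrow> homog (2 * ?M) (b k) \<and> jet (\<psi> i) (b k) = monom 1 k * W k \<and> coeff (W k) 0 \<noteq> 0"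
      by metis
    define hs where "hs = map b [0..<m i]"
    have "lin_indep_mod gs p hs"
      unfolding lin_indep_mod_def
    proof (intro allI impI notI)
      fix c :: "nat \<Rightarrow> complex"
      assume c: "\<exists>s<length hs. c s \<noteq> 0"
        and "\<exists>t e. homog e t \<and> peval t p \<noteq> 0 \<and> in_ideal gs (t * (\<Sum>s<length hs. const3 (c s) * hs ! s))"
      then obtain t e where t: "homog e t" "peval t p \<noteq> 0"
        "in_ideal gs (t * (\<Sum>s<length hs. const3 (c s) * hs ! s))" by blast
      from ideal_killed[OF t(3)] i have "monom 1 (m i) dvd jet (\<psi> i) t * jet (\<psi> i) (\<Sum>s<length hs. const3 (c s) * hs ! s)"
        unfolding killed_def const1.ev_mult by blast
      then have "monom 1 (m i) dvd jet (\<psi> i) (\<Sum>s<length hs. const3 (c s) * hs ! s)"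
        by (rule monom_dvd_cancel) (use t peval_p in blast)
      also have "jet (\<psi> i) (\<Sum>s<length hs. const3 (c s) * hs ! s) = (\<Sum>k<m i. [:c k:] * (monom 1 k * W k))"
        unfolding const1.ev_sum const1.ev_mult const1.ev_const hs_def
        using bW by (intro sum.cong) auto
      finally have "c k = 0" if "k < m i" for k
        by (rule monom_dvd_triangular) (use bW that in auto)
      with c show False by (auto simp: hs_def)
    qed
    moreover have "\<forall>h\<in>set hs. homog (2 * ?M) h" using bW by (auto simp: hs_def)
    moreover have "length hs = m i" by (simp add: hs_def)
    ultimately show "enat (m i) \<le> Sup {enat n |n. \<exists>e hs. length hs = n \<and> (\<forall>h\<in>set hs. homog e h) \<and> lin_indep_mod gs p hs}"
      by (intro Sup_upper) blast
  qed
qed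

end

section \<open>A criterion for freeness\<close>

abbreviation jacobian :: "poly3 \<Rightarrow> poly3 list" where
  "jacobian f \<equiv> [pd 0 f, pd 1 f, pd 2 f]"

lemma proj_sym: "p \<in> proj q \<longleftrightarrow> q \<in> proj p"
  by (metis proj_eq_iff)

lemma singular_pt_iff: "singular_pt f p \<longleftrightarrow> p \<noteq> 0 \<and> (\<forall>g\<in>set (f # jacobian f). peval g p = 0)"
proof -
  have "(\<forall>v<3. peval (pd v f) p = 0) \<longleftrightarrow> peval (pd 0 f) p = 0 \<and> peval (pd 1 f) p = 0 \<and> peval (pd 2 f) p = 0"
    by (auto elim!: var3_cases)
  then show ?thesis by (auto simp: singular_pt_def on_curve_def)
qed

text \<open>A singular point outside the list would contribute one more independent condition,
  through its constant germ with order 1, and exceed the codimension.\<close>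

lemma total_tjurina_eq:
  assumes jets: "jet_system (f # jacobian f) (I :: nat set) \<psi> m"
    and codim: "\<And>n. n0 \<le> n \<Longrightarrow> codim_le (f # jacobian f) n (\<Sum>j\<in>I. m j)"
  shows "total_tjurina f = enat (\<Sum>j\<in>I. m j)"
proof -
  interpret jet_system "f # jacobian f" I \<psi> m by (rule jets)
  let ?M = "\<Sum>j\<in>I. m j"
  have sing: "singular_pt f (base (\<psi> i))" if i: "i \<in> I" for i
    unfolding singular_pt_iff
  proof (intro conjI ballI)
    show "base (\<psi> i) \<noteq> 0" using i by (rule base_neq_0)
    fix g assume "g \<in> set (f # jacobian f)"
    from kills[OF i this] pos[OF i] have "coeff (jet (\<psi> i) g) 0 = 0"
      by (simp add: monom_1_dvd_iff')
    then show "peval g (base (\<psi> i)) = 0" by (simp add: coeff_jet_0)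
  qed
  have ex: "\<exists>i\<in>I. p \<in> proj (base (\<psi> i))" if p: "singular_pt f p" for p
  proof (rule ccontr)
    assume no: "\<not> ?thesis"
    then have no1: "p \<notin> proj (base (\<psi> i))" and no2: "base (\<psi> i) \<notin> proj p" if "i \<in> I" for i
      using that proj_sym by blast+
    obtain k where k: "k \<notin> I" using ex_new_if_finite[OF infinite_UNIV_nat fin] by blast
    define \<psi>' where "\<psi>' = \<psi>(k := (case p of (a, b, c) \<Rightarrow> ([:a:], [:b:], [:c:])))"
    have base_k: "base (\<psi>' k) = p" by (cases p) (simp add: \<psi>'_def base_def)
    have \<psi>'_I: "\<psi>' i = \<psi> i" if "i \<in> I" for i using that k by (auto simp: \<psi>'_def)
    interpret J: jet_system "f # jacobian f" "insert k I" \<psi>' "m(k := 1)"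
    proof
      show "finite (insert k I)" using fin by simp
      show "monom 1 ((m(k := 1)) i) dvd jet (\<psi>' i) g" if "i \<in> insert k I" "g \<in> set (f # jacobian f)" for i g
      proof (cases "i = k")
        case True
        have "peval g p = 0" using p that(2) unfolding singular_pt_iff by blast
        then show ?thesis using True by (simp add: monom_1_dvd_iff' coeff_jet_0 base_k)
      next
        case False
        then show ?thesis using that kills[of i g] \<psi>'_I[of i] by auto
      qed
      show "0 < (m(k := 1)) i" if "i \<in> insert k I" for i using that pos by auto
      show "base (\<psi>' i) \<noteq> 0" if "i \<in> insert k I" for i
        using that base_neq_0 \<psi>'_I base_k p by (auto simp: singular_pt_iff)
      show "base (\<psi>' j) \<notin> proj (base (\<psi>' i))" if "i \<in> insert k I" "j \<in> insert k I" "i \<noteq> j" for i j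
        using that distinct[of i j] no1 no2 \<psi>'_I base_k by (cases "i = k"; cases "j = k") auto
      show "(m(k := 1)) i = 1 \<or> (\<exists>l. homog 1 l \<and> coeff (jet (\<psi>' i) l) 0 = 0 \<and> coeff (jet (\<psi>' i) l) 1 \<noteq> 0)"
        if "i \<in> insert k I" for i
        using that immersed[of i] \<psi>'_I[of i] by (cases "i = k") auto
    qed
    have sum: "(\<Sum>j\<in>insert k I. (m(k := 1)) j) = Suc ?M"
      using k fin by (simp add: sum.insert) (intro sum.cong, auto)
    have "codim_le (f # jacobian f) (n0 + 2 * Suc ?M) ?M" by (rule codim) simp
    from J.sum_le_codim[OF this] sum show False by simp
  qed
  have proj: "proj ` {p. singular_pt f p} = (\<lambda>i. proj (base (\<psi> i))) ` I"
  proof (intro equalityI subsetI)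
    fix P assume "P \<in> proj ` {p. singular_pt f p}"
    then obtain p where p: "singular_pt f p" "P = proj p" by blast
    from ex[OF p(1)] obtain i where "i \<in> I" "p \<in> proj (base (\<psi> i))" ..
    with p(2) proj_eqI show "P \<in> (\<lambda>i. proj (base (\<psi> i))) ` I" by blast
  qed (use sing in blast)
  have inj: "inj_on (\<lambda>i. proj (base (\<psi> i))) I"
    using distinct by (auto simp: inj_on_def proj_eq_iff)
  \<comment> \<open>Any representative chosen by \<open>SOME\<close> will do, as
    \<open>loc_len_eq\<close> holds for all points of the class.\<close>
  have "tjurina f (SOME p. p \<in> proj (base (\<psi> i))) = enat (m i)" if "i \<in> I" for i
    unfolding tjurina_def
    by (rule loc_len_eq[OF codim that]) (auto intro: someI[of _ "base (\<psi> i)"])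
  then have "total_tjurina f = (\<Sum>i\<in>I. enat (m i))"
    unfolding total_tjurina_def proj sum.reindex[OF inj] by simp
  also have "\<dots> = enat ?M"
    by (induction I rule: infinite_finite_induct) (auto simp: zero_enat_def)
  finally show ?thesis .
qed

section \<open>Reducedness from a plane missing the singular points\<close>

lemma no_root_imp_const:
  fixes P :: "complex poly"
  assumes "\<And>z. poly P z \<noteq> 0"
  shows "poly P x = poly P y"
  using fundamental_theorem_of_algebra[of P] assms unfolding constant_def by blast

text \<open>A zero of a square factor \<open>g\<close> is a singular point, so on the given plane \<open>g\<close> vanishes at most at the
  origin; as zeros of bivariate polynomials are not isolated, \<open>g\<close> does not vanish at the origin. On a
  line through the origin off the curve \<open>g\<close> divides a power of the parameter, hence is constant there.\<close>

lemma reduced3_if_plane_avoids_singularities: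
  assumes f: "homog d f" "f \<noteq> 0"
    and plane: "\<And>p. singular_pt f p \<Longrightarrow> peval (var3 2 - const3 \<alpha> * var3 0 - const3 \<beta> * var3 1) p \<noteq> 0"
  shows "reduced3 f"
  unfolding reduced3_def
proof (intro conjI allI impI)
  show "f \<noteq> 0" by (rule f)
  fix g h assume fgh: "f = g * g * h"
  have sing: "singular_pt f p" if "p \<noteq> 0" "peval g p = 0" for p
    using that unfolding singular_pt_iff by (auto simp: fgh)
  define G where "G r s = peval g (r, s, r * \<alpha> + s * \<beta>)" for r s
  have G0: "G r s \<noteq> 0" if "r \<noteq> 0 \<or> s \<noteq> 0" for r s
  proof
    assume "G r s = 0"
    with that have "singular_pt f (r, s, r * \<alpha> + s * \<beta>)"
      by (intro sing) (auto simp: G_def zero_prod_def)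
    from plane[OF this] show False by (simp add: mult.commute)
  qed
  \<comment> \<open>For fixed nonzero \<open>s\<close> the point never reaches the origin, so the
    polynomial in \<open>r\<close> has no zero and is constant.\<close>
  have G1: "G r s = G 0 s" if "s \<noteq> 0" for r s
  proof -
    have "poly (jet ([:0, 1:], [:s:], [:s * \<beta>, \<alpha>:]) g) r = G r s" for r
      by (simp add: poly_jet G_def add.commute)
    then show ?thesis using no_root_imp_const[of "jet ([:0, 1:], [:s:], [:s * \<beta>, \<alpha>:]) g" r 0] G0 that by auto
  qed
  have G2: "G r s = G r 0" if "r \<noteq> 0" for r s
  proof -
    have "poly (jet ([:r:], [:0, 1:], [:r * \<alpha>, \<beta>:]) g) s = G r s" for s
      by (simp add: poly_jet G_def)
    then show ?thesis using no_root_imp_const[of "jet ([:r:], [:0, 1:], [:r * \<alpha>, \<beta>:]) g" s 0] G0 that by auto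
  qed
  have G3: "G 0 s = G 0 1" if "s \<noteq> 0" for s
    using G1[OF that, of 1] G1[of 1 1] G2[of 1 s] G2[of 1 1] by simp
  have g0: "peval g (0, 0, 0) \<noteq> 0"
  proof
    assume g0: "peval g (0, 0, 0) = 0"
    define P where "P = jet (0, [:0, 1:], [:0, \<beta>:]) g"
    have P: "poly P s = G 0 s" for s
      by (simp add: P_def poly_jet G_def)
    \<comment> \<open>For nonzero \<open>s\<close> the last factor vanishes, for
      \<open>s = 0\<close> the other two do. So \<open>P\<close> would be constant, although its
      values at 0 and 1 differ.\<close>
    have "poly (P * ([:0, 1:] * (P - [:G 0 1:]))) s = 0" for s
      using G3[of s] g0 P[of s] by (cases "s = 0") (auto simp: G_def)
    then have "P * ([:0, 1:] * (P - [:G 0 1:])) = 0"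
      using poly_all_0_iff_0 by blast
    then have "P = 0 \<or> P = [:G 0 1:]" by (metis mult_eq_0_iff pCons_eq_0_iff right_minus_eq zero_neq_one)
    then show False using P[of 1] P[of 0] G0[of 0 1] g0 by (auto simp: G_def)
  qed
  have const: "peval g p = peval g (0, 0, 0)" if "peval f p \<noteq> 0" for p
  proof -
    obtain a b c where p: "p = (a, b, c)" by (cases p)
    let ?P = "jet ([:0, a:], [:0, b:], [:0, c:]) g"
    have P: "poly ?P s = peval g (scale s p)" for s
      by (simp add: p poly_jet scale_def)
    have "poly ?P s \<noteq> 0" for s
    proof (cases "s = 0")
      case True
      then show ?thesis using g0 by (simp add: P p scale_def)
    next
      case False
      then have "peval f (scale s p) \<noteq> 0" using that by (simp add: peval_scale[OF f(1)])
      then show ?thesis by (auto simp: P fgh)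
    qed
    then have "poly ?P 1 = poly ?P 0" by (rule no_root_imp_const)
    then show ?thesis unfolding P by (simp add: p scale_def)
  qed
  obtain B where B: "peval f B \<noteq> 0" using f(2) poly3_eq_0_if_peval by blast
  define k where "k = g - const3 (peval g (0, 0, 0))"
  have kf: "peval k p = 0 \<or> peval f p = 0" for p
    using const[of p] by (auto simp: k_def)
  \<comment> \<open>The product of \<open>k\<close> and \<open>f\<close> vanishes at every point. On
    the line joining \<open>B\<close> to \<open>q\<close> the form \<open>f\<close> is not
    identically zero, so \<open>k\<close> is.\<close>
  have "peval k q = 0" for q
  proof -
    obtain a b c where q: "q = (a, b, c)" by (cases q)
    obtain a' b' c' where B': "B = (a', b', c')" by (cases B)
    define line where "line = ([:a', a - a':], [:b', b - b':], [:c', c - c':])"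
    have "poly (jet line k * jet line f) T = 0" for T
      using kf by (simp add: line_def poly_jet)
    then have "jet line k * jet line f = 0" using poly_all_0_iff_0 by blast
    moreover have "poly (jet line f) 0 \<noteq> 0" using B by (simp add: line_def poly_jet B')
    then have "jet line f \<noteq> 0" by auto
    ultimately have "poly (jet line k) 1 = 0" by simp
    then show ?thesis by (simp add: line_def poly_jet q)
  qed
  then have "k = 0" by (rule poly3_eq_0_if_peval)
  then show "is_const g" unfolding is_const_def k_def by auto
qed

text \<open>Multiplication by a variable raises the degree of a syzygy, so excluding degree 1
  excludes degree 0 as well.\<close>

lemma AR_nonzero_0_imp_1:
  assumes "AR_nonzero f 0"
  shows "AR_nonzero f 1"
proof -
  obtain a b c where abc: "homog 0 a" "homog 0 b" "homog 0 c" "(a, b, c) \<noteq> (0, 0, 0)"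
    "a * pd 0 f + b * pd 1 f + c * pd 2 f = 0"
    using assms unfolding AR_nonzero_def by blast
  have nz: "var3 0 * h \<noteq> 0" if "homog 0 h" "h \<noteq> 0" for h
  proof
    assume 0: "var3 0 * h = 0"
    have "h = const3 (Poly_Mapping.lookup h (0, 0, 0))"
      using homog_expand[OF that(1)] by simp
    then obtain r where r: "h = const3 r" ..
    have "peval (var3 0 * h) (1, 0, 0) = r" by (simp add: r)
    with 0 that r show False by simp
  qed
  have "homog 1 (var3 0 * a)" "homog 1 (var3 0 * b)" "homog 1 (var3 0 * c)"
    using abc homog_mult[OF homog_var(1)] by fastforce+
  moreover have "(var3 0 * a, var3 0 * b, var3 0 * c) \<noteq> (0, 0, 0)"
    using abc nz by auto
  moreover have "var3 0 * a * pd 0 f + var3 0 * b * pd 1 f + var3 0 * c * pd 2 f = 0"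
    using abc(5) by (simp only: mult.assoc distrib_left[symmetric] mult_zero_right)
  ultimately show ?thesis unfolding AR_nonzero_def by blast
qed

theorem free_2_3_criterion:
  assumes f: "homog 6 f"
    and jets: "jet_system (f # jacobian f) (I :: nat set) \<psi> m" and M: "(\<Sum>j\<in>I. m j) = 19"
    and AR: "\<not> AR_nonzero f 1"
    and step: "\<And>n h. 6 \<le> n \<Longrightarrow> homog (Suc n) h \<Longrightarrow>
      \<exists>h'. homog n h' \<and> in_ideal (jacobian f) (h - (var3 2 - const3 \<alpha> * var3 0 - const3 \<beta> * var3 1) * h')"
  shows "free_with_exponents f 6 2 3 \<and> mdr f = 2 \<and> total_tjurina f = 19"
proof -
  interpret jet_system "f # jacobian f" I \<psi> m by (rule jets)
  have f6: "homog (Suc 5) f" using f by simp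
  have codim: "codim_le (jacobian f) n N" if "codim_le (jacobian f) k N" "6 \<le> k" "k \<le> n" for k n N
    using that(3,1)
  proof (induction n rule: dec_induct)
    case (step n)
    then show ?case using that(2) by (intro codim_le_Suc[OF _ assms(5)]) auto
  qed
  have "codim_le (jacobian f) (1 + 5) 19"
    by (rule codim_le_if_no_syzygy[OF f6 AR]) (simp add: card_mons eval_nat_numeral)
  then have "codim_le (jacobian f) 6 19" by simp
  then have c19: "codim_le (jacobian f) n 19" if "6 \<le> n" for n
    using that by (rule codim[OF _ order_refl])
  have cod: "codim_le (f # jacobian f) n (\<Sum>j\<in>I. m j)" if "6 \<le> n" for n
    unfolding M by (rule codim_le_mono_ideal[OF c19[OF that]]) auto
  have tj: "total_tjurina f = enat 19"
    using total_tjurina_eq[OF jets cod] M by simp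
  have AR2: "AR_nonzero f 2"
  proof (rule ccontr)
    assume "\<not> ?thesis"
    then have "codim_le (jacobian f) (2 + 5) 18"
      by (rule codim_le_if_no_syzygy[OF f6]) (simp add: card_mons eval_nat_numeral)
    \<comment> \<open>38 = 2 * 19 is the least degree in which \<open>sum_le_codim\<close>
      applies.\<close>
    then have "codim_le (jacobian f) 38 18"
      by (rule codim) auto
    then have "codim_le (f # jacobian f) 38 18"
      by (rule codim_le_mono_ideal) auto
    from sum_le_codim[OF this] M show False by simp
  qed
  have "\<not> AR_nonzero f 0" using AR AR_nonzero_0_imp_1 by blast
  then have ge: "2 \<le> k" if "AR_nonzero f k" for k
    using that AR by (metis One_nat_def Suc_1 less_2_cases not_less)
  have mdr: "mdr f = 2"
    unfolding mdr_def using AR2 ge by (intro Least_equality) auto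
  have "f \<noteq> 0"
  proof
    assume "f = 0"
    have "peval (var3 0) (1, 0, 0) \<noteq> peval 0 (1, 0, 0)" by simp
    then have "var3 0 \<noteq> 0" by metis
    then have "AR_nonzero f 1" unfolding AR_nonzero_def
      by (intro exI[of _ "var3 0"] exI[of _ 0]) (auto simp: \<open>f = 0\<close>)
    with AR show False ..
  qed
  have "reduced3 f"
  proof (rule reduced3_if_plane_avoids_singularities[OF f \<open>f \<noteq> 0\<close>])
    fix p assume p: "singular_pt f p"
    then have "p \<noteq> 0" by (simp add: singular_pt_iff)
    then obtain \<nu> where \<nu>: "homog 1 \<nu>" "peval \<nu> p \<noteq> 0" by (rule ex_linear_nonzero)
    let ?\<mu> = "var3 2 - const3 \<alpha> * var3 0 - const3 \<beta> * var3 1"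
    \<comment> \<open>Degree 7 is the lowest one covered by \<open>step\<close>. At a singular point
      the Jacobian ideal vanishes, so there \<open>\<nu> ^ 7\<close> equals
      \<open>?\<mu> * h'\<close>; as it is nonzero, so is \<open>?\<mu>\<close>.\<close>
    have "homog (Suc 6) (\<nu> ^ 7)" using homog_power[OF \<nu>(1), of 7] by simp
    then obtain h' where "in_ideal (jacobian f) (\<nu> ^ 7 - ?\<mu> * h')"
      using step[of 6] by blast
    then have "0 dvd peval (\<nu> ^ 7 - ?\<mu> * h') p"
      unfolding peval_eq_ev
      by (rule peval.ev_in_ideal_dvd) (use p in \<open>auto simp: singular_pt_iff simp flip: peval_eq_ev\<close>)
    then show "peval ?\<mu> p \<noteq> 0" using \<nu>(2) by auto
  qed
  with f mdr tj show ?thesis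
    unfolding free_with_exponents_def free_curve_def by (simp add: numeral_eq_enat)
qed

section \<open>Linear changes of coordinates\<close>

definition act :: "poly3 \<times> poly3 \<times> poly3 \<Rightarrow> pt \<Rightarrow> pt" where
  "act S p = (case S of (a, b, c) \<Rightarrow> (peval a p, peval b p, peval c p))"

lemma peval_sub: "peval (sub S f) p = peval f (act S p)"
  by (cases S) (simp add: act_def peval_eq_ev peval.ev_sub)

lemma loc_len_cong:
  assumes "\<And>h. in_ideal gs h \<longleftrightarrow> in_ideal gs' h"
  shows "loc_len gs p = loc_len gs' p"
  by (simp add: loc_len_def lin_indep_mod_def assms)

lemma in_ideal_eqI:
  assumes "\<And>g. g \<in> set gs \<Longrightarrow> in_ideal gs' g" "\<And>g. g \<in> set gs' \<Longrightarrow> in_ideal gs g"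
  shows "in_ideal gs h \<longleftrightarrow> in_ideal gs' h"
  using in_ideal_mono[of gs h gs'] in_ideal_mono[of gs' h gs] assms by blast

lemma loc_len_scale:
  assumes "r \<noteq> 0"
  shows "loc_len gs (scale r p) = loc_len gs p"
proof -
  have "(homog e t \<and> peval t (scale r p) \<noteq> 0 \<and> P) \<longleftrightarrow> (homog e t \<and> peval t p \<noteq> 0 \<and> P)" for e t P
    using assms peval_scale[of e t r p] by auto
  then have "lin_indep_mod gs (scale r p) = lin_indep_mod gs p"
    unfolding lin_indep_mod_def fun_eq_iff by simp
  then show ?thesis by (simp add: loc_len_def)
qed

lemma homog_0_eq_const: "homog 0 h \<Longrightarrow> h = const3 (peval h p)"
proof -
  assume "homog 0 h"
  then have "h = const3 (Poly_Mapping.lookup h (0, 0, 0))" using homog_expand[of 0 h] by simp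
  then obtain r where "h = const3 r" ..
  then show ?thesis by simp
qed

text \<open>A linear change of coordinates with its inverse, both as substitutions. The inverse laws
  are stated on polynomials, where they serve as rewrite rules. Points move oppositely:
  \<open>sub S f\<close> vanishes at \<open>p\<close> iff \<open>f\<close> vanishes at
  \<open>act S p\<close>.\<close>

locale coord_change =
  fixes S T :: "poly3 \<times> poly3 \<times> poly3"
  assumes lin_S: "homog 1 (fst S)" "homog 1 (fst (snd S))" "homog 1 (snd (snd S))"
    and lin_T: "homog 1 (fst T)" "homog 1 (fst (snd T))" "homog 1 (snd (snd T))"
    and ST: "sub S (sub T f) = f" and TS: "sub T (sub S f) = f"

lemma coord_change_sym: "coord_change S T \<Longrightarrow> coord_change T S"
  unfolding coord_change_def by blast

lemma homog_sub_linear: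
  assumes "homog 1 (fst S)" "homog 1 (fst (snd S))" "homog 1 (snd (snd S))" "homog d f"
  shows "homog d (sub S f)"
  using homog_sub[OF assms(4,1,2,3)] by simp

lemma coord_change_comp:
  assumes "coord_change S T" "coord_change S' T'"
  shows "\<exists>U V. coord_change U V \<and> (\<forall>f. sub U f = sub S (sub S' f))"
proof -
  interpret A: coord_change S T by fact
  interpret B: coord_change S' T' by fact
  obtain a b c where S': "S' = (a, b, c)" by (cases S')
  obtain a' b' c' where T: "T' = (a', b', c')" by (cases T')
  let ?U = "(sub S a, sub S b, sub S c)" and ?V = "(sub T' (fst T), sub T' (fst (snd T)), sub T' (snd (snd T)))"
  have U: "sub ?U f = sub S (sub S' f)" for f by (simp add: S' const3.ev_sub)
  have V: "sub ?V f = sub T' (sub T f)" for f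
    using const3.ev_sub[of T' "fst T" "fst (snd T)" "snd (snd T)" f] by simp
  have "coord_change ?U ?V"
  proof
    show "sub ?U (sub ?V f) = f" "sub ?V (sub ?U f) = f" for f
      by (simp_all add: U V A.ST A.TS B.ST B.TS del: ev_def)
  qed (use A.lin_S A.lin_T B.lin_S B.lin_T S' in \<open>auto intro!: homog_sub_linear\<close>)
  then show ?thesis using U by blast
qed

context coord_change
begin

lemma homog_S: "homog d f \<Longrightarrow> homog d (sub S f)"
  using lin_S by (rule homog_sub_linear)

lemma homog_T: "homog d f \<Longrightarrow> homog d (sub T f)"
  using lin_T by (rule homog_sub_linear)

lemma act_S: "act S (act T p) = p" and act_T: "act T (act S p) = p"
proof -
  have "peval (var3 v) (act S (act T p)) = peval (var3 v) p" "peval (var3 v) (act T (act S p)) = peval (var3 v) p" for v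
    by (metis ST TS peval_sub)+
  from this[of 0] this[of 1] this[of 2] show "act S (act T p) = p" "act T (act S p) = p"
    by (cases p; cases "act S (act T p)"; cases "act T (act S p)"; simp)+
qed

lemma act_scale: "act S (scale r p) = scale r (act S p)"
  using peval_scale[OF lin_S(1)] peval_scale[OF lin_S(2)] peval_scale[OF lin_S(3)]
  by (cases S) (auto simp: act_def scale_def[of r "(_, _)"])

lemma act_eq_0_iff: "act S p = 0 \<longleftrightarrow> p = 0"
proof
  assume *: "act S p = 0"
  have "act S (scale 0 p) = scale 0 (act S p)" by (rule act_scale)
  also have "\<dots> = act S p" unfolding * by (simp add: scale_def zero_prod_def)
  finally have "scale 0 p = p" using act_T by metis
  then show "p = 0" by (metis scale_eq_0_iff)
next
  assume "p = 0"
  have "act S (scale 0 p) = scale 0 (act S p)" by (rule act_scale)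
  then show "act S p = 0" using \<open>p = 0\<close> scale_eq_0_iff by metis
qed

lemma act_in_proj: "p \<in> proj q \<Longrightarrow> act S p \<in> proj (act S q)"
  by (auto simp: proj_def act_scale)

lemma pd_sub_S: "pd v (sub S f) = pd v (fst S) * sub S (pd 0 f) + pd v (fst (snd S)) * sub S (pd 1 f)
     + pd v (snd (snd S)) * sub S (pd 2 f)"
  by (cases S) (simp add: pd_sub)

text \<open>Chain rule for \<open>f = sub T (sub S f)\<close>, followed by \<open>sub S\<close>. It
  is the inverse of the relation in \<open>pd_sub_S\<close>, and together they identify the two
  Jacobian ideals.\<close>

lemma sub_S_pd: "sub S (pd v f) = sub S (pd v (fst T)) * pd 0 (sub S f)
  + sub S (pd v (fst (snd T))) * pd 1 (sub S f) + sub S (pd v (snd (snd T))) * pd 2 (sub S f)"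
proof -
  obtain a b c where T: "T = (a, b, c)" by (cases T)
  have "pd v f = pd v (sub T (sub S f))" by (simp add: TS)
  also have "\<dots> = pd v a * sub T (pd 0 (sub S f)) + pd v b * sub T (pd 1 (sub S f)) + pd v c * sub T (pd 2 (sub S f))"
    unfolding T by (rule pd_sub)
  finally have "sub S (pd v f) = sub S (pd v a * sub T (pd 0 (sub S f)) + pd v b * sub T (pd 1 (sub S f)) + pd v c * sub T (pd 2 (sub S f)))"
    by simp
  then show ?thesis using ST[unfolded T] by (simp add: T)
qed

lemma singular_pt_act:
  assumes "singular_pt f (act S p)"
  shows "singular_pt (sub S f) p"
proof -
  have "peval (pd v (sub S f)) p = 0" for v
    unfolding pd_sub_S using assms by (simp add: peval_sub singular_pt_def)
  then show ?thesis using assms by (simp add: singular_pt_def on_curve_def peval_sub act_eq_0_iff)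
qed

lemma in_ideal_jacobian_sub:
  "in_ideal (map (sub S) [f, pd 0 f, pd 1 f, pd 2 f]) h \<longleftrightarrow>
   in_ideal [sub S f, pd 0 (sub S f), pd 1 (sub S f), pd 2 (sub S f)] h"
proof (rule in_ideal_eqI)
  let ?J = "[sub S f, pd 0 (sub S f), pd 1 (sub S f), pd 2 (sub S f)]"
  have "in_ideal ?J (sub S f)" by (rule in_ideal_mem) simp
  moreover have "in_ideal ?J (sub S (pd v f))" for v
    unfolding sub_S_pd[of _ f] by (intro in_ideal_add in_ideal_mult in_ideal_mem) auto
  ultimately show "in_ideal ?J g" if "g \<in> set (map (sub S) [f, pd 0 f, pd 1 f, pd 2 f])" for g
    using that by auto
  let ?K = "map (sub S) [f, pd 0 f, pd 1 f, pd 2 f]"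
  have "in_ideal ?K (sub S f)" by (rule in_ideal_mem) simp
  moreover have "in_ideal ?K (pd v (sub S f))" for v
    unfolding pd_sub_S by (intro in_ideal_add in_ideal_mult in_ideal_mem) auto
  ultimately show "in_ideal ?K g" if "g \<in> set ?J" for g
    using that by auto
qed

text \<open>A relation between the pulled back forms is carried back by \<open>sub T\<close>, so
  independent families stay independent. For the inverse change this is the opposite
  inequality.\<close>

lemma loc_len_act_le: "loc_len gs (act S p) \<le> loc_len (map (sub S) gs) p"
  unfolding loc_len_def
proof (rule Sup_subset_mono, rule subsetI)
  fix x assume "x \<in> {enat n |n. \<exists>e hs. length hs = n \<and> (\<forall>h\<in>set hs. homog e h) \<and> lin_indep_mod gs (act S p) hs}"
  then obtain e hs where x: "x = enat (length hs)" and hs: "\<forall>h\<in>set hs. homog e h" "lin_indep_mod gs (act S p) hs"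
    by blast
  have "lin_indep_mod (map (sub S) gs) p (map (sub S) hs)"
    unfolding lin_indep_mod_def
  proof (intro allI impI notI)
    fix c :: "nat \<Rightarrow> complex"
    assume c: "\<exists>i<length (map (sub S) hs). c i \<noteq> 0"
      and "\<exists>t e. homog e t \<and> peval t p \<noteq> 0 \<and>
        in_ideal (map (sub S) gs) (t * (\<Sum>i<length (map (sub S) hs). const3 (c i) * map (sub S) hs ! i))"
    then obtain t k where t: "homog k t" "peval t p \<noteq> 0"
      "in_ideal (map (sub S) gs) (t * (\<Sum>i<length hs. const3 (c i) * map (sub S) hs ! i))" by auto
    have "map (sub T) (map (sub S) gs) = gs" by (simp add: TS comp_def)
    moreover have "sub T (t * (\<Sum>i<length hs. const3 (c i) * map (sub S) hs ! i)) =
      sub T t * (\<Sum>i<length hs. const3 (c i) * hs ! i)"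
      by (simp add: TS)
    ultimately have "in_ideal gs (sub T t * (\<Sum>i<length hs. const3 (c i) * hs ! i))"
      using in_ideal_sub[OF t(3), of T] by simp
    moreover have "homog k (sub T t)" using t(1) by (rule homog_T)
    moreover have "peval (sub T t) (act S p) \<noteq> 0" using t(2) by (simp add: peval_sub act_T)
    moreover have "\<exists>i<length hs. c i \<noteq> 0" using c by simp
    ultimately show False using hs(2) unfolding lin_indep_mod_def by blast
  qed
  moreover have "\<forall>h\<in>set (map (sub S) hs). homog e h" using hs(1) homog_S by auto
  ultimately show "x \<in> {enat n |n. \<exists>e hs. length hs = n \<and> (\<forall>h\<in>set hs. homog e h) \<and> lin_indep_mod (map (sub S) gs) p hs}"
    unfolding x mem_Collect_eq
    by - (rule exI[of _ "length hs"], rule conjI, rule refl, rule exI[of _ e], rule exI[of _ "map (sub S) hs"], simp)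
qed

lemma loc_len_act: "loc_len (map (sub S) gs) p = loc_len gs (act S p)"
proof (rule antisym[OF _ loc_len_act_le])
  interpret T: coord_change T S by (rule coord_change_sym) (rule coord_change_axioms)
  have "loc_len (map (sub S) gs) (act T (act S p)) \<le> loc_len (map (sub T) (map (sub S) gs)) (act S p)"
    by (rule T.loc_len_act_le)
  then show "loc_len (map (sub S) gs) p \<le> loc_len gs (act S p)"
    by (simp add: act_T TS comp_def)
qed

lemma singular_pt_sub: "singular_pt (sub S f) p \<longleftrightarrow> singular_pt f (act S p)"
proof
  interpret T: coord_change T S by (rule coord_change_sym) (rule coord_change_axioms)
  assume "singular_pt (sub S f) p"
  then have "singular_pt (sub S f) (act T (act S p))" by (simp add: act_T)
  from T.singular_pt_act[OF this] show "singular_pt f (act S p)" by (simp add: TS)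
qed (rule singular_pt_act)

lemma smooth_pt_sub: "smooth_pt (sub S f) p \<longleftrightarrow> smooth_pt f (act S p)"
  by (simp add: smooth_pt_def singular_pt_sub on_curve_def peval_sub act_eq_0_iff)

lemma int_mult_sub: "int_mult (sub S f) (sub S g) p = int_mult f g (act S p)"
  unfolding int_mult_def using loc_len_act[of "[f, g]" p] by simp

lemma tjurina_sub: "tjurina (sub S f) p = tjurina f (act S p)"
  unfolding tjurina_def loc_len_act[symmetric]
  by (rule loc_len_cong) (rule in_ideal_jacobian_sub[symmetric])

lemma total_tjurina_sub: "total_tjurina (sub S f) = total_tjurina f"
proof -
  interpret T: coord_change T S by (rule coord_change_sym) (rule coord_change_axioms)
  have tj: "tjurina f (SOME q. q \<in> proj p) = tjurina f p" for f p
  proof -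
    have "(SOME q. q \<in> proj p) \<in> proj p" by (rule someI) (rule in_proj_self)
    then show ?thesis by (elim in_projE) (simp add: tjurina_def loc_len_scale)
  qed
  have img: "act S ` proj p = proj (act S p)" for p
  proof
    show "act S ` proj p \<subseteq> proj (act S p)" using act_in_proj by blast
    show "proj (act S p) \<subseteq> act S ` proj p"
      by (metis T.act_in_proj act_S act_T imageI subsetI)
  qed
  have inj: "inj (act S)" by (metis act_T injI)
  have "(\<Sum>P\<in>proj ` {p. singular_pt f p}. tjurina f (SOME p. p \<in> P)) =
    (\<Sum>P\<in>(`) (act S) ` proj ` {p. singular_pt (sub S f) p}. tjurina f (SOME p. p \<in> P))"
  proof (rule sum.cong)
    have "{p. singular_pt f p} = act S ` {p. singular_pt (sub S f) p}"
    proof -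
      have "q \<in> act S ` {p. singular_pt f (act S p)}" if "singular_pt f q" for q
        using that by (intro image_eqI[of _ _ "act T q"]) (simp_all add: act_S)
      then show ?thesis unfolding singular_pt_sub by blast
    qed
    then show "proj ` {p. singular_pt f p} = (`) (act S) ` proj ` {p. singular_pt (sub S f) p}"
      by (simp add: image_image img)
  qed simp
  also have "\<dots> = (\<Sum>P\<in>proj ` {p. singular_pt (sub S f) p}. tjurina f (SOME p. p \<in> act S ` P))"
    using inj by (subst sum.reindex) (auto simp: inj_on_def inj_image_eq_iff)
  also have "\<dots> = (\<Sum>P\<in>proj ` {p. singular_pt (sub S f) p}. tjurina (sub S f) (SOME p. p \<in> P))"
    by (intro sum.cong) (auto simp: img tj simp flip: tjurina_sub)
  finally show ?thesis unfolding total_tjurina_def by simp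
qed

text \<open>A syzygy is a derivation killing \<open>f\<close>. Its new components are its values on
  the coordinate functions, the entries of \<open>T\<close>; by \<open>rec\<close> the derivation is
  recovered from them, so they are not all zero.\<close>

lemma AR_nonzero_sub:
  assumes "AR_nonzero f k"
  shows "AR_nonzero (sub S f) k"
proof -
  obtain a b c where abc: "homog k a" "homog k b" "homog k c" "(a, b, c) \<noteq> (0, 0, 0)"
    "a * pd 0 f + b * pd 1 f + c * pd 2 f = 0"
    using assms unfolding AR_nonzero_def by blast
  obtain x y z where S: "S = (x, y, z)" by (cases S)
  obtain x' y' z' where T: "T = (x', y', z')" by (cases T)
  define A where "A t = sub S a * sub S (pd 0 t) + sub S b * sub S (pd 1 t) + sub S c * sub S (pd 2 t)" for t
  have pdT: "homog 0 (pd v t)" if "homog 1 t" for v t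
    using homog_pd[of 0 t v] that by simp
  have hom: "homog k (A t)" if "homog 1 t" for t
    unfolding A_def
    using homog_mult[OF homog_S[OF abc(1)] homog_S[OF pdT[OF that, of 0]]]
      homog_mult[OF homog_S[OF abc(2)] homog_S[OF pdT[OF that, of 1]]]
      homog_mult[OF homog_S[OF abc(3)] homog_S[OF pdT[OF that, of 2]]]
    by (auto intro!: homog_add)
  have "0 = sub S (a * pd 0 f + b * pd 1 f + c * pd 2 f)" unfolding abc(5) by simp
  also have "\<dots> = sub S a * sub S (pd 0 f) + sub S b * sub S (pd 1 f) + sub S c * sub S (pd 2 f)"
    by simp
  also have "\<dots> = A x' * pd 0 (sub S f) + A y' * pd 1 (sub S f) + A z' * pd 2 (sub S f)"
    unfolding sub_S_pd[of _ f] A_def T by (simp add: algebra_simps)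
  finally have syz: "A x' * pd 0 (sub S f) + A y' * pd 1 (sub S f) + A z' * pd 2 (sub S f) = 0" ..
  have rec: "A x' * pd 0 (sub S g) + A y' * pd 1 (sub S g) + A z' * pd 2 (sub S g) = A g" for g
    unfolding A_def sub_S_pd[of _ g] T by (simp add: algebra_simps)
  have "(A x', A y', A z') \<noteq> (0, 0, 0)"
  proof
    assume "(A x', A y', A z') = (0, 0, 0)"
    then have A0: "A g = 0" for g using rec[of g] by simp
    have "sub S a = 0" "sub S b = 0" "sub S c = 0"
      using A0[of "var3 0"] A0[of "var3 1"] A0[of "var3 2"] by (simp_all add: A_def)
    then have "sub T (sub S a) = 0" "sub T (sub S b) = 0" "sub T (sub S c) = 0" by simp_all
    with abc(4) show False unfolding TS by simp
  qed
  moreover have "homog k (A x')" "homog k (A y')" "homog k (A z')"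
    using lin_T by (auto simp: T intro: hom)
  ultimately show ?thesis using syz unfolding AR_nonzero_def by blast
qed

section \<open>Invariance of reducedness, irreducibility, nodes and hyperosculation\<close>

lemma is_const_sub: "is_const (sub S f) \<Longrightarrow> is_const f"
  unfolding is_const_def by (metis TS const3.ev_const)

lemma is_const_sub_T: "is_const (sub T f) \<Longrightarrow> is_const f"
  unfolding is_const_def by (metis ST const3.ev_const)

lemma reduced3_sub:
  assumes "reduced3 f"
  shows "reduced3 (sub S f)"
  unfolding reduced3_def
proof (intro conjI allI impI)
  show "sub S f \<noteq> 0"
    using assms TS[of f] unfolding reduced3_def by auto
  fix g h assume "sub S f = g * g * h"
  then have "sub T (sub S f) = sub T (g * g * h)" by simp
  then have "f = sub T g * sub T g * sub T h" by (simp add: TS)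
  with assms have "is_const (sub T g)" unfolding reduced3_def by blast
  then show "is_const g" by (rule is_const_sub_T)
qed

lemma irreducible3_sub:
  assumes "irreducible3 f"
  shows "irreducible3 (sub S f)"
  unfolding irreducible3_def
proof (intro conjI allI impI)
  show "\<not> is_const (sub S f)"
    using assms is_const_sub unfolding irreducible3_def by blast
  fix g h assume "sub S f = g * h"
  then have "sub T (sub S f) = sub T (g * h)" by simp
  then have "f = sub T g * sub T h" by (simp add: TS)
  with assms have "is_const (sub T g) \<or> is_const (sub T h)" unfolding irreducible3_def by blast
  then show "is_const g \<or> is_const h" using is_const_sub_T by blast
qed

lemma mdr_sub: "mdr (sub S f) = mdr f"
proof -
  interpret T: coord_change T S by (rule coord_change_sym) (rule coord_change_axioms)
  have "AR_nonzero (sub S f) k \<longleftrightarrow> AR_nonzero f k" for k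
    using AR_nonzero_sub[of f k] T.AR_nonzero_sub[of "sub S f" k] by (auto simp: TS)
  then show ?thesis by (simp add: mdr_def)
qed

lemma free_with_exponents_sub:
  "free_with_exponents f d r r' \<Longrightarrow> free_with_exponents (sub S f) d r r'"
  unfolding free_with_exponents_def free_curve_def
  by (auto simp: mdr_sub total_tjurina_sub reduced3_sub homog_S)

text \<open>Second derivatives of linear forms vanish, so the Hessian of \<open>f\<close> is
  \<open>t H t^T\<close>, with \<open>H\<close> that of \<open>sub S f\<close>. Rank at most one is
  therefore inherited; contraposed, this transports ordinary nodes.\<close>

lemma hessian_minors_sub:
  assumes "\<And>i j k l. i < 3 \<Longrightarrow> j < 3 \<Longrightarrow> k < 3 \<Longrightarrow> l < 3 \<Longrightarrow>
     peval (pd i (pd k (sub S f))) p * peval (pd j (pd l (sub S f))) p =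
     peval (pd i (pd l (sub S f))) p * peval (pd j (pd k (sub S f))) p"
    and "i < 3" "j < 3" "k < 3" "l < 3"
  shows "peval (pd i (pd k f)) (act S p) * peval (pd j (pd l f)) (act S p) =
     peval (pd i (pd l f)) (act S p) * peval (pd j (pd k f)) (act S p)"
proof -
  define t where "t i u = peval (sub S (pd i ((if u = 0 then fst T else if u = 1 then fst (snd T) else snd (snd T))))) p"
    for i and u :: nat
  define H where "H u w = peval (pd u (pd w (sub S f))) p" for u w
  have lin: "pd i (pd j t) = 0" if "homog 1 t" for i j t
  proof -
    have "homog 0 (pd j t)" using homog_pd[of 0 t j] that by simp
    from homog_0_eq_const[OF this] show ?thesis by (metis pd_const)
  qed
  have D1: "pd k f = pd k (fst T) * sub T (pd 0 (sub S f)) + pd k (fst (snd T)) * sub T (pd 1 (sub S f))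
      + pd k (snd (snd T)) * sub T (pd 2 (sub S f))" for k
    using pd_sub[of k "fst T" "fst (snd T)" "snd (snd T)" "sub S f"] by (simp add: TS)
  have D2: "pd i (sub T g) = pd i (fst T) * sub T (pd 0 g) + pd i (fst (snd T)) * sub T (pd 1 g)
      + pd i (snd (snd T)) * sub T (pd 2 g)" for i g
    using pd_sub[of i "fst T" "fst (snd T)" "snd (snd T)" g] by simp
  have D: "peval (pd i (pd k f)) (act S p) = (\<Sum>u<3. \<Sum>w<3. t i u * t k w * H u w)" for i k
    unfolding D1[of k] pd_add pd_mult D2 lin[OF lin_T(1)] lin[OF lin_T(2)] lin[OF lin_T(3)]
    by (simp add: eval_nat_numeral t_def H_def algebra_simps peval_sub act_T)
  have HH: "H u w * H u' w' = H u w' * H u' w" if "u < 3" "w < 3" "u' < 3" "w' < 3" for u w u' w'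
    unfolding H_def using assms(1)[OF that(1,3,2,4)] .
  have prod: "(\<Sum>u<3. \<Sum>w<3. t i u * t k w * H u w) * (\<Sum>u<3. \<Sum>w<3. t j u * t l w * H u w)
     = (\<Sum>u<3. \<Sum>w<3. \<Sum>u'<3. \<Sum>w'<3. t i u * t k w * t j u' * t l w' * (H u w * H u' w'))" for i j k l
    unfolding sum_distrib_right unfolding sum_distrib_left by (simp only: mult_ac)
  have "(\<Sum>u<3. \<Sum>w<3. \<Sum>u'<3. \<Sum>w'<3. t i u * t k w * t j u' * t l w' * (H u w * H u' w'))
    = (\<Sum>u<3. \<Sum>w<3. \<Sum>u'<3. \<Sum>w'<3. t i u * t k w * t j u' * t l w' * (H u w' * H u' w))"
    by (intro sum.cong refl) (use HH in simp)
  \<comment> \<open>Exchanging \<open>w\<close> and \<open>w'\<close> as summation variables turns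
    the minor identity for \<open>H\<close> into the one for the transformed Hessian.\<close>
  also have "\<dots> = (\<Sum>u<3. \<Sum>w'<3. \<Sum>u'<3. \<Sum>w<3. t i u * t k w * t j u' * t l w' * (H u w' * H u' w))"
    by (rule sum.cong[OF refl]) (simp add: eval_nat_numeral algebra_simps)
  also have "\<dots> = (\<Sum>u<3. \<Sum>w<3. \<Sum>u'<3. \<Sum>w'<3. t i u * t l w * t j u' * t k w' * (H u w * H u' w'))"
    by (intro sum.cong refl) (simp add: mult_ac)
  finally show ?thesis unfolding D prod .
qed

lemma ordinary_node_sub:
  assumes "ordinary_node f (act S p)"
  shows "ordinary_node (sub S f) p"
proof -
  have "singular_pt (sub S f) p" using assms by (simp add: ordinary_node_def singular_pt_sub)
  moreover have "\<exists>i<3. \<exists>j<3. \<exists>k<3. \<exists>l<3. peval (pd i (pd k (sub S f))) p * peval (pd j (pd l (sub S f))) p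
        - peval (pd i (pd l (sub S f))) p * peval (pd j (pd k (sub S f))) p \<noteq> 0"
  proof (rule ccontr)
    assume "\<not> ?thesis"
    then have "peval (pd i (pd k (sub S f))) p * peval (pd j (pd l (sub S f))) p =
     peval (pd i (pd l (sub S f))) p * peval (pd j (pd k (sub S f))) p"
      if "i < 3" "j < 3" "k < 3" "l < 3" for i j k l using that by auto
    from hessian_minors_sub[OF this] assms show False
      unfolding ordinary_node_def by force
  qed
  ultimately show ?thesis by (simp add: ordinary_node_def)
qed

lemma nodal_cubic_sub:
  assumes "nodal_cubic e"
  shows "nodal_cubic (sub S e)"
proof -
  interpret T: coord_change T S by (rule coord_change_sym) (rule coord_change_axioms)
  obtain p where p: "ordinary_node e p" "\<And>q. singular_pt e q \<Longrightarrow> q \<in> proj p"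
    using assms unfolding nodal_cubic_def by blast
  have "ordinary_node (sub S e) (act T p)"
    by (rule ordinary_node_sub) (simp add: act_S p)
  moreover have "q \<in> proj (act T p)" if "singular_pt (sub S e) q" for q
  proof -
    have "act S q \<in> proj p" using that p(2) by (simp add: singular_pt_sub)
    from T.act_in_proj[OF this] show ?thesis by (simp add: act_T)
  qed
  ultimately show ?thesis
    using assms unfolding nodal_cubic_def by (blast intro: homog_S irreducible3_sub)
qed

lemma hyperosculating_conic_sub:
  assumes "hyperosculating_conic e q"
  shows "hyperosculating_conic (sub S e) (sub S q)"
proof -
  obtain p where "smooth_pt e p" "6 \<le> int_mult e q p"
    using assms unfolding hyperosculating_conic_def by blast
  then have "smooth_pt (sub S e) (act T p)" "6 \<le> int_mult (sub S e) (sub S q) (act T p)"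
    by (simp_all add: smooth_pt_sub int_mult_sub act_S)
  with assms show ?thesis
    unfolding hyperosculating_conic_def by (blast intro: homog_S irreducible3_sub)
qed

end

section \<open>Nodal cubics and their inflectional lines and hyperosculating conics\<close>

subsection \<open>Normal form\<close>

abbreviation X :: poly3 where "X \<equiv> var3 0"
abbreviation Y :: poly3 where "Y \<equiv> var3 1"
abbreviation Z :: poly3 where "Z \<equiv> var3 2"

text \<open>The node is \<open>(0, 0, 1)\<close> with tangents \<open>X = 0\<close> and
  \<open>Y = 0\<close>; the smooth points are \<open>(t, t^2, 1 + t^3)\<close> with nonzero
  \<open>t\<close>.\<close>

definition nodal :: poly3 where
  "nodal = X * Y * Z - X ^ 3 - Y ^ 3"

lemma poly3_eqI:
  assumes "\<And>x y z. peval f (x, y, z) = peval g (x, y, z)"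
  shows "f = g"
  using poly3_eq_0_if_peval[of "f - g"] assms by auto

lemma coord_changeI:
  assumes "homog 1 a" "homog 1 b" "homog 1 c" "homog 1 a'" "homog 1 b'" "homog 1 c'"
    and "\<And>x y z. act (a, b, c) (act (a', b', c') (x, y, z)) = (x, y, z)"
    and "\<And>x y z. act (a', b', c') (act (a, b, c) (x, y, z)) = (x, y, z)"
  shows "coord_change (a, b, c) (a', b', c')"
proof
  show "sub (a, b, c) (sub (a', b', c') f) = f" for f
    by (rule poly3_eqI) (simp only: peval_sub assms)
  show "sub (a', b', c') (sub (a, b, c) f) = f" for f
    by (rule poly3_eqI) (simp only: peval_sub assms)
qed (use assms in auto)

lemma homog_mult_const: "homog d f \<Longrightarrow> homog d (f * const3 c)"
  using homog_const_mult[of d f c] by (simp add: mult.commute)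

lemma homog_linear: "homog 1 (const3 a * X + const3 b * Y + const3 c * Z)"
  by (intro homog_add homog_const_mult homog_var)

lemma homog_1_expand:
  assumes "homog 1 f"
  obtains a b c where "f = const3 a * X + const3 b * Y + const3 c * Z"
proof -
  have "f = const3 (Poly_Mapping.lookup f (1, 0, 0)) * X + const3 (Poly_Mapping.lookup f (0, 1, 0)) * Y
     + const3 (Poly_Mapping.lookup f (0, 0, 1)) * Z"
    by (subst homog_expand[OF assms]) simp
  then show ?thesis by (rule that)
qed

lemma homog_2_expand:
  assumes "homog 2 f"
  obtains a b c d e g where
    "f = const3 a * X ^ 2 + const3 b * (X * Y) + const3 c * Y ^ 2 + const3 d * (X * Z) + const3 e * (Y * Z) + const3 g * Z ^ 2"
proof -
  let ?l = "\<lambda>i j k. const3 (Poly_Mapping.lookup f (i, j, k))"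
  have "f = ?l 2 0 0 * X ^ 2 + ?l 1 1 0 * (X * Y) + ?l 0 2 0 * Y ^ 2 + ?l 1 0 1 * (X * Z) + ?l 0 1 1 * (Y * Z) + ?l 0 0 2 * Z ^ 2"
    by (subst homog_expand[OF assms]) (simp add: eval_nat_numeral algebra_simps)
  then show ?thesis by (rule that)
qed

lemma homog_3_expand:
  assumes "homog 3 f"
  obtains a b c d e g h i j k where
    "f = const3 a * X ^ 3 + const3 b * (X ^ 2 * Y) + const3 c * (X * Y ^ 2) + const3 d * Y ^ 3
      + const3 e * (X ^ 2 * Z) + const3 g * (X * Y * Z) + const3 h * (Y ^ 2 * Z)
      + const3 i * (X * Z ^ 2) + const3 j * (Y * Z ^ 2) + const3 k * Z ^ 3"
proof -
  let ?l = "\<lambda>i j k. const3 (Poly_Mapping.lookup f (i, j, k))"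
  have "f = ?l 3 0 0 * X ^ 3 + ?l 2 1 0 * (X ^ 2 * Y) + ?l 1 2 0 * (X * Y ^ 2) + ?l 0 3 0 * Y ^ 3
      + ?l 2 0 1 * (X ^ 2 * Z) + ?l 1 1 1 * (X * Y * Z) + ?l 0 2 1 * (Y ^ 2 * Z)
      + ?l 1 0 2 * (X * Z ^ 2) + ?l 0 1 2 * (Y * Z ^ 2) + ?l 0 0 3 * Z ^ 3"
    by (subst homog_expand[OF assms]) (simp add: eval_nat_numeral algebra_simps)
  then show ?thesis by (rule that)
qed

lemma ex_coord_change_origin:
  assumes "p \<noteq> 0"
  obtains S T where "coord_change S T" "act S (0, 0, 1) = p"
proof -
  obtain a b c where p: "p = (a, b, c)" by (cases p)
  consider "c \<noteq> 0" | "b \<noteq> 0" | "a \<noteq> 0" using assms p by (auto simp: zero_prod_def)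
  then show ?thesis
  proof cases
    case 1
    have "coord_change (X + const3 a * Z, Y + const3 b * Z, const3 c * Z)
      (X - const3 (a / c) * Z, Y - const3 (b / c) * Z, const3 (1 / c) * Z)"
      by (rule coord_changeI) (use 1 in \<open>auto simp: act_def field_simps intro!: homog_add homog_diff homog_const_mult homog_mult_const\<close>)
    then show ?thesis by (rule that) (simp add: act_def p)
  next
    case 2
    have "coord_change (X + const3 a * Z, const3 b * Z, Y + const3 c * Z)
      (X - const3 (a / b) * Y, Z - const3 (c / b) * Y, const3 (1 / b) * Y)"
      by (rule coord_changeI) (use 2 in \<open>auto simp: act_def field_simps intro!: homog_add homog_diff homog_const_mult homog_mult_const\<close>)
    then show ?thesis by (rule that) (simp add: act_def p)
  next
    case 3
    have "coord_change (const3 a * Z, X + const3 b * Z, Y + const3 c * Z)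
      (Y - const3 (b / a) * X, Z - const3 (c / a) * X, const3 (1 / a) * X)"
      by (rule coord_changeI) (use 3 in \<open>auto simp: act_def field_simps intro!: homog_add homog_diff homog_const_mult homog_mult_const\<close>)
    then show ?thesis by (rule that) (simp add: act_def p)
  qed
qed

text \<open>A square root of the discriminant yields the linear factors, and they are independent as
  it is nonzero. Used for the two tangents of the node and for the two points common to the conic
  and a flex line.\<close>

lemma binary_quadratic_split:
  fixes b0 b1 b2 :: complex
  assumes "b1\<^sup>2 \<noteq> 4 * b0 * b2"
  obtains \<alpha> \<beta> \<gamma> \<delta> where "\<alpha> * \<delta> - \<beta> * \<gamma> \<noteq> 0" "b0 = \<alpha> * \<gamma>" "b1 = \<alpha> * \<delta> + \<beta> * \<gamma>" "b2 = \<beta> * \<delta>"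
proof (cases "b0 = 0")
  case True
  \<comment> \<open>The factors are \<open>y\<close> and \<open>b1 * x + b2 * y\<close>.\<close>
  then show ?thesis using assms by (intro that[of 0 b2 1 b1]) auto
next
  case False
  define s where "s = csqrt (b1\<^sup>2 - 4 * b0 * b2)"
  have s2: "s\<^sup>2 = b1\<^sup>2 - 4 * b0 * b2" by (simp add: s_def)
  then have "s \<noteq> 0" using assms by auto
  define u v where "u = (b1 - s) / (2 * b0)" and "v = (b1 + s) / (2 * b0)"
  have u: "b0 * u = (b1 - s) / 2" and v: "b0 * v = (b1 + s) / 2"
    using False by (simp_all add: u_def v_def)
  have "b0 * (b0 * u * v) = (b0 * u) * (b0 * v)" by simp
  also have "\<dots> = (b1\<^sup>2 - s\<^sup>2) / 4" unfolding u v by (simp add: power2_eq_square field_simps)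
  also have "\<dots> = b0 * b2" by (simp add: s2)
  finally have "b2 = b0 * u * v" using False by simp
  moreover have "b0 * v - b0 * u = s" "b1 = b0 * v + b0 * u"
    unfolding u v by (simp_all add: field_simps)
  \<comment> \<open>The factors are \<open>b0 * x + b0 * u * y\<close> and \<open>x + v * y\<close>,
    with determinant \<open>s\<close>.\<close>
  ultimately show ?thesis using \<open>s \<noteq> 0\<close> by (intro that[of b0 v "b0 * u" 1]) auto
qed

lemma nodal_cubic_coord_change:
  assumes "coord_change S T" "\<exists>U V. coord_change U V \<and> sub U (sub S e) = nodal"
  shows "\<exists>U V. coord_change U V \<and> sub U e = nodal"
proof -
  obtain U V where UV: "coord_change U V" "sub U (sub S e) = nodal" using assms(2) by blast
  from coord_change_comp[OF UV(1) assms(1)] UV(2) show ?thesis by metis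
qed

lemma nonconst3I: "peval f p \<noteq> peval f q \<Longrightarrow> \<not> is_const f"
  by (auto simp: is_const_def)

text \<open>The node is moved to \<open>(0, 0, 1)\<close> and its tangents to the lines
  \<open>X = 0\<close> and \<open>Y = 0\<close>. After that \<open>Z\<close> occurs only in
  \<open>X Y Z\<close>, so a shift of \<open>Z\<close> absorbs \<open>X^2 Y\<close> and
  \<open>X Y^2\<close>, and scalings normalise the rest.\<close>

lemma nodal_cubic_normal_form:
  assumes "nodal_cubic e"
  shows "\<exists>U V. coord_change U V \<and> sub U e = nodal"
proof -
  obtain p where p: "ordinary_node e p" using assms unfolding nodal_cubic_def by blast
  then have "p \<noteq> 0" by (simp add: ordinary_node_def singular_pt_iff)
  then obtain S T where ST: "coord_change S T" "act S (0, 0, 1) = p" by (rule ex_coord_change_origin)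
  interpret ST: coord_change S T by fact
  let ?o = "(0, 0, 1) :: pt"
  have node: "ordinary_node (sub S e) ?o"
    by (rule ST.ordinary_node_sub) (simp add: ST p)
  have nc: "nodal_cubic (sub S e)" by (rule ST.nodal_cubic_sub) fact
  then have "homog 3 (sub S e)" by (simp add: nodal_cubic_def)
  then obtain c0 c1 c2 c3 b0 b1 b2 a0 a1 a2 where e1: "sub S e = const3 c0 * X ^ 3 + const3 c1 * (X ^ 2 * Y) + const3 c2 * (X * Y ^ 2) + const3 c3 * Y ^ 3
      + const3 b0 * (X ^ 2 * Z) + const3 b1 * (X * Y * Z) + const3 b2 * (Y ^ 2 * Z)
      + const3 a0 * (X * Z ^ 2) + const3 a1 * (Y * Z ^ 2) + const3 a2 * Z ^ 3"
    by (rule homog_3_expand)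
  have "singular_pt (sub S e) ?o" using node by (simp add: ordinary_node_def)
  then have a: "a0 = 0" "a1 = 0" "a2 = 0"
    by (auto simp: singular_pt_iff e1)
  \<comment> \<open>The Hessian at the node is that of \<open>b0 x^2 + b1 x y + b2 y^2\<close>,
    bordered by zeros; discriminant zero would make its rank at most one.\<close>
  have disc: "b1\<^sup>2 \<noteq> 4 * b0 * b2"
  proof
    assume disc: "b1\<^sup>2 = 4 * b0 * b2"
    define H where "H i k = peval (pd i (pd k (sub S e))) ?o" for i k
    have H: "H 0 0 = 2 * b0" "H 0 1 = b1" "H 1 0 = b1" "H 1 1 = 2 * b2" "H 0 2 = 0" "H 2 0 = 0"
      "H 1 2 = 0" "H 2 1 = 0" "H 2 2 = 0"
      by (simp_all add: H_def e1 a)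
    have "H i k * H j l = H i l * H j k" if "i < 3" "j < 3" "k < 3" "l < 3" for i j k l
      using that disc
      by (elim var3_cases) (simp_all add: H[unfolded One_nat_def] power2_eq_square)
    with node show False unfolding ordinary_node_def H_def by auto
  qed
  then obtain \<alpha> \<beta> \<gamma> \<delta> where D: "\<alpha> * \<delta> - \<beta> * \<gamma> \<noteq> 0" and b: "b0 = \<alpha> * \<gamma>" "b1 = \<alpha> * \<delta> + \<beta> * \<gamma>" "b2 = \<beta> * \<delta>"
    by (rule binary_quadratic_split)
  define D where "D = \<alpha> * \<delta> - \<beta> * \<gamma>"
  have D0: "D \<noteq> 0" using D by (simp add: D_def)
  define p1 p2 p3 p4 where "p1 = \<delta> / D" and "p2 = - \<beta> / D" and "p3 = - \<gamma> / D" and "p4 = \<alpha> / D"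
  have inv: "\<alpha> * p1 + \<beta> * p3 = 1" "\<alpha> * p2 + \<beta> * p4 = 0" "\<gamma> * p1 + \<delta> * p3 = 0" "\<gamma> * p2 + \<delta> * p4 = 1"
    using D0 by (simp_all add: p1_def p2_def p3_def p4_def field_simps) (simp_all add: D_def)
  have inv': "p1 * \<alpha> + p2 * \<gamma> = 1" "p1 * \<beta> + p2 * \<delta> = 0" "p3 * \<alpha> + p4 * \<gamma> = 0" "p3 * \<beta> + p4 * \<delta> = 1"
    using D0 by (simp_all add: p1_def p2_def p3_def p4_def field_simps) (simp_all add: D_def)
  have lin: "u * (v * x + w * y) + u' * (v' * x + w' * y) = (u * v + u' * v') * x + (u * w + u' * w') * y"
    for u u' v v' w w' x y :: complex by (simp add: algebra_simps)
  let ?S2 = "(const3 p1 * X + const3 p2 * Y, const3 p3 * X + const3 p4 * Y, Z)"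
  let ?T2 = "(const3 \<alpha> * X + const3 \<beta> * Y, const3 \<gamma> * X + const3 \<delta> * Y, Z)"
  have S2: "coord_change ?S2 ?T2"
    by (rule coord_changeI)
      (auto simp: act_def lin inv inv' intro!: homog_add homog_const_mult)
  interpret S2: coord_change ?S2 ?T2 by fact
  define k0 where "k0 = c0 * p1^3 + c1 * p1^2 * p3 + c2 * p1 * p3^2 + c3 * p3^3"
  define k1 where "k1 = 3 * c0 * p1^2 * p2 + c1 * (p1^2 * p4 + 2 * p1 * p2 * p3) + c2 * (p2 * p3^2 + 2 * p1 * p3 * p4) + 3 * c3 * p3^2 * p4"
  define k2 where "k2 = 3 * c0 * p1 * p2^2 + c1 * (p2^2 * p3 + 2 * p1 * p2 * p4) + c2 * (p1 * p4^2 + 2 * p2 * p3 * p4) + 3 * c3 * p3 * p4^2"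
  define k3 where "k3 = c0 * p2^3 + c1 * p2^2 * p4 + c2 * p2 * p4^2 + c3 * p4^3"
  have cubic: "c0 * (p1 * x + p2 * y)^3 + c1 * ((p1 * x + p2 * y)^2 * (p3 * x + p4 * y))
      + c2 * ((p1 * x + p2 * y) * (p3 * x + p4 * y)^2) + c3 * (p3 * x + p4 * y)^3
      = k0 * x^3 + k1 * (x^2 * y) + k2 * (x * y^2) + k3 * y^3" for x y
    unfolding k0_def k1_def k2_def k3_def by algebra
  have quad: "b0 * ((p1 * x + p2 * y)^2 * z) + b1 * ((p1 * x + p2 * y) * (p3 * x + p4 * y) * z) + b2 * ((p3 * x + p4 * y)^2 * z)
      = x * y * z" for x y z
  proof -
    have "b0 * (u^2 * z) + b1 * (u * w * z) + b2 * (w^2 * z) = (\<alpha> * u + \<beta> * w) * (\<gamma> * u + \<delta> * w) * z" for u w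
      unfolding b by algebra
    then show ?thesis by (simp only: lin inv) simp
  qed
  let ?e2 = "X * Y * Z + const3 k0 * X ^ 3 + const3 k1 * (X ^ 2 * Y) + const3 k2 * (X * Y ^ 2) + const3 k3 * Y ^ 3"
  have e2: "sub ?S2 (sub S e) = ?e2"
  proof (rule poly3_eqI)
    fix x y z
    have "peval (sub ?S2 (sub S e)) (x, y, z) =
      (c0 * (p1 * x + p2 * y)^3 + c1 * ((p1 * x + p2 * y)^2 * (p3 * x + p4 * y))
      + c2 * ((p1 * x + p2 * y) * (p3 * x + p4 * y)^2) + c3 * (p3 * x + p4 * y)^3) +
      (b0 * ((p1 * x + p2 * y)^2 * z) + b1 * ((p1 * x + p2 * y) * (p3 * x + p4 * y) * z) + b2 * ((p3 * x + p4 * y)^2 * z))"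
      by (simp add: peval_sub act_def e1 a)
    then show "peval (sub ?S2 (sub S e)) (x, y, z) = peval ?e2 (x, y, z)"
      unfolding cubic quad by simp
  qed
  have irr: "irreducible3 ?e2"
    using S2.nodal_cubic_sub[OF nc] unfolding e2 nodal_cubic_def by blast
  \<comment> \<open>Without the term \<open>X^3\<close> the cubic would be divisible by
    \<open>Y\<close>, against irreducibility; \<open>k3\<close> is symmetric.\<close>
  have "k0 \<noteq> 0"
  proof
    assume "k0 = 0"
    let ?m = "X * Z + const3 k1 * X ^ 2 + const3 k2 * (X * Y) + const3 k3 * Y ^ 2"
    have "?e2 = Y * ?m" by (simp add: \<open>k0 = 0\<close> algebra_simps power2_eq_square power3_eq_cube)
    with irr have "is_const Y \<or> is_const ?m" unfolding irreducible3_def by blast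
    moreover have "\<not> is_const Y" by (rule nonconst3I[of _ "(0, 1, 0)" "(0, 0, 0)"]) simp
    moreover have "\<not> is_const ?m" by (rule nonconst3I[of _ "(1, 0, 1)" "(1, 0, 0)"]) simp
    ultimately show False by blast
  qed
  have "k3 \<noteq> 0"
  proof
    assume "k3 = 0"
    let ?m = "Y * Z + const3 k0 * X ^ 2 + const3 k1 * (X * Y) + const3 k2 * Y ^ 2"
    have "?e2 = X * ?m" by (simp add: \<open>k3 = 0\<close> algebra_simps power2_eq_square power3_eq_cube)
    with irr have "is_const X \<or> is_const ?m" unfolding irreducible3_def by blast
    moreover have "\<not> is_const X" by (rule nonconst3I[of _ "(1, 0, 0)" "(0, 0, 0)"]) simp
    moreover have "\<not> is_const ?m" by (rule nonconst3I[of _ "(0, 1, 1)" "(0, 1, 0)"]) simp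
    ultimately show False by blast
  qed
  \<comment> \<open>The cube roots make the coefficients of \<open>X^3\<close> and
    \<open>Y^3\<close> equal to - 1; \<open>s3\<close> then keeps that of \<open>X Y Z\<close> equal
    to 1.\<close>
  obtain s1 where s1: "s1 ^ 3 = - 1 / k0" using nth_root_exists[of 3 "- 1 / k0"] by auto
  obtain s2 where s2: "s2 ^ 3 = - 1 / k3" using nth_root_exists[of 3 "- 1 / k3"] by auto
  have s0: "s1 \<noteq> 0" "s2 \<noteq> 0" using s1 s2 \<open>k0 \<noteq> 0\<close> \<open>k3 \<noteq> 0\<close> by auto
  define s3 where "s3 = 1 / (s1 * s2)"
  have s3: "s3 \<noteq> 0" "s1 * s2 * s3 = 1" using s0 by (simp_all add: s3_def)
  let ?S3 = "(const3 s1 * X, const3 s2 * Y, const3 s3 * Z - const3 (k1 * s1) * X - const3 (k2 * s2) * Y)"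
  let ?T3 = "(const3 (1 / s1) * X, const3 (1 / s2) * Y, const3 (1 / s3) * Z + const3 (k1 / s3) * X + const3 (k2 / s3) * Y)"
  have S3: "coord_change ?S3 ?T3"
    by (rule coord_changeI)
      (use s0 s3(1) in \<open>auto simp: act_def field_simps intro!: homog_add homog_diff homog_const_mult homog_mult_const\<close>)
  have "sub ?S3 ?e2 = nodal"
  proof (rule poly3_eqI)
    fix x y z
    have "peval (sub ?S3 ?e2) (x, y, z) = (s1 * x) * (s2 * y) * (s3 * z - k1 * s1 * x - k2 * s2 * y) + k0 * (s1 * x)^3
       + k1 * ((s1 * x)^2 * (s2 * y)) + k2 * ((s1 * x) * (s2 * y)^2) + k3 * (s2 * y)^3"
      by (simp add: peval_sub act_def)
    also have "\<dots> = (s1 * s2 * s3) * (x * y * z) + (k0 * s1^3) * x^3 + (k3 * s2^3) * y^3"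
      by algebra
    also have "\<dots> = peval nodal (x, y, z)"
      using \<open>k0 \<noteq> 0\<close> \<open>k3 \<noteq> 0\<close> by (simp add: s1 s2 s3 nodal_def)
    finally show "peval (sub ?S3 ?e2) (x, y, z) = peval nodal (x, y, z)" .
  qed
  then have "\<exists>U V. coord_change U V \<and> sub U (sub ?S2 (sub S e)) = nodal"
    unfolding e2 using S3 by blast
  from nodal_cubic_coord_change[OF ST(1) nodal_cubic_coord_change[OF S2 this]] show ?thesis .
qed

subsection \<open>Intersection multiplicities on the nodal cubic\<close>

lemma in_ideal_sub_diff:
  "in_ideal [c - c'] (sub (a, b, c) f - sub (a, b, c') f)"
proof (induction f rule: poly3_ring_induct)
  case (var v)
  then show ?case by (elim var3_cases) (simp_all add: in_ideal_mem)
next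
  case (add f g)
  from in_ideal_add[OF add] show ?case by (simp add: algebra_simps)
next
  case (mult f g)
  have "in_ideal [c - c'] (sub (a, b, c') g * (sub (a, b, c) f - sub (a, b, c') f) +
    sub (a, b, c) f * (sub (a, b, c) g - sub (a, b, c') g))"
    by (intro in_ideal_add in_ideal_mult mult)
  then show ?case by (simp add: algebra_simps)
qed simp

lemma sub_scaled:
  assumes "homog n f"
  shows "sub (r * X, r * Y, r * Z) f = r ^ n * f"
  using assms
proof (induction rule: homog_induct)
  case (single i j k c)
  then show ?case
    unfolding const3.ev_single single_eq_monomial by (simp add: power_mult_distrib power_add mult_ac flip: single)
qed (simp_all add: distrib_left)

text \<open>Multiplication by \<open>(XY)^n\<close> allows to replace \<open>XYZ\<close> by \<open>X^3 + Y^3\<close> throughout, which leaves a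
  binary form.\<close>

lemma vanishing_on_nodal:
  assumes R: "homog n R" and van: "\<And>t. peval R (t, t\<^sup>2, 1 + t ^ 3) = 0"
  shows "in_ideal [nodal] ((X * Y) ^ n * R)"
proof -
  have "sub (X * Y * X, X * Y * Y, X ^ 3 + Y ^ 3) R = 0"
  proof (rule poly3_eqI)
    fix x y z
    have "peval R (x * y * x, x * y * y, x ^ 3 + y ^ 3) = 0"
    proof (cases "x = 0")
      case True
      have eq: "(x * y * x, x * y * y, x ^ 3 + y ^ 3) = scale (y ^ 3) (0, 0\<^sup>2, 1 + 0 ^ 3)"
        by (simp add: scale_def True)
      show ?thesis unfolding eq peval_scale[OF R] van by simp
    next
      case False
      then have "(x * y * x, x * y * y, x ^ 3 + y ^ 3) = scale (x ^ 3) (y / x, (y / x)\<^sup>2, 1 + (y / x) ^ 3)"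
        by (simp add: scale_def field_simps power2_eq_square power3_eq_cube)
      then show ?thesis using van[of "y / x"] peval_scale[OF R] by simp
    qed
    then show "peval (sub (X * Y * X, X * Y * Y, X ^ 3 + Y ^ 3) R) (x, y, z) = peval 0 (x, y, z)"
      by (simp add: peval_sub act_def)
  qed
  moreover have "in_ideal [X * Y * Z - (X ^ 3 + Y ^ 3)]
    (sub (X * Y * X, X * Y * Y, X * Y * Z) R - sub (X * Y * X, X * Y * Y, X ^ 3 + Y ^ 3) R)"
    by (rule in_ideal_sub_diff)
  ultimately show ?thesis
    by (simp only: sub_scaled[OF R] diff_zero nodal_def diff_diff_eq)
qed

text \<open>On the cubic \<open>X ^ (N - j) * Y ^ j\<close> restricts to \<open>t ^ (N + j)\<close>.
  So forms free of \<open>Z\<close> produce every polynomial in \<open>t\<close> of degree at most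
  \<open>N\<close>, up to the factor \<open>t ^ N\<close>, which is a unit away from the
  node.\<close>

lemma ex_binary_form:
  fixes w :: "complex poly"
  assumes "degree w \<le> N"
  obtains B where "homog N B" "\<And>t c. peval B (t, t\<^sup>2, c) = t ^ N * poly w (t - t0)"
proof -
  define w' where "w' = pcompose w [:- t0, 1:]"
  have deg: "degree w' \<le> N" using assms by (simp add: w'_def degree_pcompose)
  define B where "B = (\<Sum>j\<le>N. const3 (coeff w' j) * (X ^ (N - j) * Y ^ j))"
  have "homog N B"
    unfolding B_def
  proof (intro homog_sum homog_const_mult)
    fix j assume "j \<in> {..N}"
    then show "homog N (X ^ (N - j) * Y ^ j)"
      using homog_mult[OF homog_power[OF homog_var(1), of "N - j" 0] homog_power[OF homog_var(1), of j 1]] by simp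
  qed
  moreover have "peval B (t, t\<^sup>2, c) = t ^ N * poly w (t - t0)" for t c
  proof -
    have "peval B (t, t\<^sup>2, c) = (\<Sum>j\<le>N. coeff w' j * (t ^ (N - j) * (t\<^sup>2) ^ j))"
      by (simp add: B_def)
    also have "\<dots> = (\<Sum>j\<le>N. t ^ N * (coeff w' j * t ^ j))"
    proof (rule sum.cong)
      fix j assume "j \<in> {..N}"
      then have "t ^ N = t ^ (N - j) * t ^ j" by (simp flip: power_add)
      then show "coeff w' j * (t ^ (N - j) * (t\<^sup>2) ^ j) = t ^ N * (coeff w' j * t ^ j)"
        by (simp add: power2_eq_square power_mult_distrib)
    qed simp
    also have "\<dots> = t ^ N * (\<Sum>j\<le>degree w'. coeff w' j * t ^ j)"
      unfolding sum_distrib_left[symmetric]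
      by (subst sum.mono_neutral_right[of "{..N}" "{..degree w'}"]) (use deg in \<open>auto simp: coeff_eq_0\<close>)
    also have "(\<Sum>j\<le>degree w'. coeff w' j * t ^ j) = poly w (t - t0)"
      unfolding poly_altdef[symmetric] by (simp add: w'_def poly_pcompose)
    finally show ?thesis .
  qed
  ultimately show ?thesis by (rule that)
qed

text \<open>The cubic near parameter \<open>t0\<close> in the local parameter \<open>t - t0\<close>,
  so that vanishing order becomes divisibility by a power of the variable.\<close>

definition branch :: "complex \<Rightarrow> complex poly \<times> complex poly \<times> complex poly" where
  "branch t0 = ([:t0, 1:], [:t0, 1:]\<^sup>2, 1 + [:t0, 1:] ^ 3)"

lemma poly_jet_branch: "poly (jet (branch t0) f) x = peval f (t0 + x, (t0 + x)\<^sup>2, 1 + (t0 + x) ^ 3)"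
  by (simp add: branch_def poly_jet)

lemma monom_1_eq: "monom 1 n = [:0, 1:] ^ n"
  by (simp add: monom_altdef)

text \<open>If \<open>g\<close> vanished only to order \<open>m < k\<close> on the branch, some combination \<open>H\<close> of more than \<open>m\<close> forms
  would vanish to order \<open>m\<close> as well, so \<open>H = t^m v\<close> and \<open>g = t^m w\<close> with \<open>w\<close> a unit. Up to a common
  power of \<open>t\<close>, both \<open>v\<close> and \<open>w\<close> are restrictions of forms, whence \<open>w H - v g\<close> lies locally in the
  ideal of the cubic.\<close>

lemma int_mult_nodal_branch:
  assumes g: "homog d g" and t0: "t0 \<noteq> 0" and r: "r \<noteq> 0"
    and ge: "enat k \<le> int_mult nodal g (scale r (t0, t0\<^sup>2, 1 + t0 ^ 3))"
  shows "monom 1 k dvd jet (branch t0) g"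
proof (rule ccontr)
  let ?p = "scale r (t0, t0\<^sup>2, 1 + t0 ^ 3)"
  assume nd: "\<not> monom 1 k dvd jet (branch t0) g"
  then have "jet (branch t0) g \<noteq> 0" by auto
  define m where "m = order 0 (jet (branch t0) g)"
  from order_decomp[OF \<open>jet (branch t0) g \<noteq> 0\<close>, of 0] obtain w where
    w: "jet (branch t0) g = monom 1 m * w" "\<not> [:0, 1:] dvd w" by (auto simp: m_def monom_1_eq)
  have w0: "poly w 0 \<noteq> 0" using w(2) by (simp add: dvd_iff_poly_eq_0)
  have "m < k"
  proof (rule ccontr)
    assume "\<not> m < k"
    then have "monom 1 k dvd (monom 1 m :: complex poly)" by (simp add: monom_1_eq le_imp_power_dvd)
    with nd w(1) show False by (simp add: dvd_mult2)
  qed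
  have "\<exists>hs e. m < length hs \<and> (\<forall>h\<in>set hs. homog e h) \<and> lin_indep_mod [nodal, g] ?p hs"
  proof (rule ccontr)
    assume "\<not> ?thesis"
    then have "int_mult nodal g ?p \<le> enat m"
      unfolding int_mult_def loc_len_def by (intro Sup_least) (force simp: not_less)
    with ge have "enat k \<le> enat m" by (rule order_trans)
    with \<open>m < k\<close> show False by simp
  qed
  then obtain hs e where hs: "m < length hs" "\<forall>h\<in>set hs. homog e h" "lin_indep_mod [nodal, g] ?p hs"
    by blast
  have "card {..<m} < card {..<length hs}" using hs(1) by simp
  from ex_nontrivial_solution[OF _ _ this, of "\<lambda>s l. coeff (jet (branch t0) (hs ! s)) l"]
  obtain c where c: "\<exists>s<length hs. c s \<noteq> 0"
    "\<And>l. l < m \<Longrightarrow> (\<Sum>s<length hs. c s * coeff (jet (branch t0) (hs ! s)) l) = 0"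
    by auto
  define H where "H = (\<Sum>s<length hs. const3 (c s) * hs ! s)"
  have H: "homog e H"
    unfolding H_def using hs by (intro homog_sum homog_const_mult) auto
  have "jet (branch t0) H = (\<Sum>s<length hs. [:c s:] * jet (branch t0) (hs ! s))"
    by (simp add: H_def)
  then have "monom 1 m dvd jet (branch t0) H"
    using c(2) by (simp add: monom_1_dvd_iff' coeff_sum)
  then obtain v where v: "jet (branch t0) H = monom 1 m * v" by (auto simp: dvd_def)
  define N where "N = degree v + degree w"
  obtain Bw where Bw: "homog N Bw" "\<And>t c. peval Bw (t, t\<^sup>2, c) = t ^ N * poly w (t - t0)"
    by (rule ex_binary_form[of w N t0]) (auto simp: N_def)
  obtain Bv where Bv: "homog N Bv" "\<And>t c. peval Bv (t, t\<^sup>2, c) = t ^ N * poly v (t - t0)"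
    by (rule ex_binary_form[of v N t0]) (auto simp: N_def)
  \<comment> \<open>The exponents are balanced twice: \<open>s * H\<close> and \<open>G * g\<close>
    have the same degree, and \<open>s\<close> and \<open>G\<close> carry the same power of
    \<open>t\<close>, since \<open>X\<close> restricts to \<open>t\<close> and \<open>Y\<close> to
    \<open>t^2\<close>.\<close>
  define s where "s = X ^ (2 * d) * Y ^ e * Bw"
  define G where "G = X ^ (2 * e) * Y ^ d * Bv"
  have s: "homog (2 * d + e + N) s"
    unfolding s_def by (intro homog_mult Bw) (use homog_power[OF homog_var(1)] in \<open>metis mult.right_neutral\<close>)+
  have G: "homog (2 * e + d + N) G"
    unfolding G_def by (intro homog_mult Bv) (use homog_power[OF homog_var(1)] in \<open>metis mult.right_neutral\<close>)+
  define n where "n = 2 * d + 2 * e + N"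
  define R where "R = s * H - G * g"
  have "homog n R"
    unfolding R_def n_def
    using homog_mult[OF s H] homog_mult[OF G g] by (intro homog_diff) (simp_all add: algebra_simps)
  moreover have "peval R (t, t\<^sup>2, 1 + t ^ 3) = 0" for t
  proof -
    have "peval H (t, t\<^sup>2, 1 + t ^ 3) = (t - t0) ^ m * poly v (t - t0)"
      using poly_jet_branch[of t0 H "t - t0"] by (simp add: v poly_monom)
    moreover have "peval g (t, t\<^sup>2, 1 + t ^ 3) = (t - t0) ^ m * poly w (t - t0)"
      using poly_jet_branch[of t0 g "t - t0"] by (simp add: w poly_monom)
    moreover have "peval s (t, t\<^sup>2, 1 + t ^ 3) = t ^ (2 * d + 2 * e + N) * poly w (t - t0)"
      by (simp add: s_def Bw power_add power_mult)
    moreover have "peval G (t, t\<^sup>2, 1 + t ^ 3) = t ^ (2 * d + 2 * e + N) * poly v (t - t0)"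
      by (simp add: G_def Bv power_add power_mult)
    ultimately show ?thesis by (simp add: R_def)
  qed
  ultimately have "in_ideal [nodal] ((X * Y) ^ n * R)" by (rule vanishing_on_nodal)
  then have "in_ideal [nodal, g] ((X * Y) ^ n * R)"
    by (rule in_ideal_mono) (auto intro: in_ideal_mem)
  moreover have "in_ideal [nodal, g] ((X * Y) ^ n * G * g)"
    by (intro in_ideal_mult in_ideal_mem) simp
  ultimately have "in_ideal [nodal, g] ((X * Y) ^ n * R + (X * Y) ^ n * G * g)" by (rule in_ideal_add)
  then have "in_ideal [nodal, g] ((X * Y) ^ n * s * H)" by (simp add: R_def algebra_simps)
  moreover have hom: "homog (n * (1 + 1) + (2 * d + e + N)) ((X * Y) ^ n * s)"
    by (intro homog_mult homog_power s homog_var)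
  \<comment> \<open>The multiplier is nonzero at the point because \<open>t0\<close> and the
    constant term of \<open>w\<close> are; so \<open>H\<close> is zero in the local quotient,
    against independence.\<close>
  moreover have "peval ((X * Y) ^ n * s) ?p \<noteq> 0"
    unfolding peval_scale[OF hom]
    using r t0 w0 by (simp add: s_def Bw)
  ultimately show False
    using hs(3) c(1) unfolding lin_indep_mod_def H_def by blast
qed

lemma smooth_pt_nodal:
  assumes "smooth_pt nodal p"
  obtains r t where "r \<noteq> 0" "t \<noteq> 0" "p = scale r (t, t\<^sup>2, 1 + t ^ 3)"
proof -
  obtain x y z where p: "p = (x, y, z)" by (cases p)
  have eq: "x * y * z = x ^ 3 + y ^ 3" and sm: "\<not> singular_pt nodal p" and "p \<noteq> 0"
    using assms by (auto simp: smooth_pt_def on_curve_def p nodal_def algebra_simps)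
  have "x \<noteq> 0 \<and> y \<noteq> 0"
  proof (rule ccontr)
    assume "\<not> ?thesis"
    then have "x = 0" "y = 0" using eq by auto
    with \<open>p \<noteq> 0\<close> have "singular_pt nodal p"
      by (simp add: p singular_pt_iff nodal_def)
    with sm show False ..
  qed
  \<comment> \<open>The parameter is the slope \<open>y / x\<close>; the first two coordinates
    determine \<open>r\<close>, and the equation of the cubic yields the third.\<close>
  then show ?thesis
    by (intro that[of "x\<^sup>2 / y" "y / x"])
      (use eq in \<open>auto simp: p scale_def field_simps power2_eq_square power3_eq_cube\<close>)
qed

lemma monom_dvd_shifted:
  fixes P :: "complex poly"
  assumes "monom 1 n dvd pcompose P [:t0, 1:]" "degree P \<le> n"
  obtains \<kappa> where "P = smult \<kappa> ([:- t0, 1:] ^ n)"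
proof -
  obtain V where V: "pcompose P [:t0, 1:] = monom 1 n * V" using assms(1) by (auto simp: dvd_def)
  have "degree V = 0"
  proof (cases "V = 0")
    case False
    have "degree (pcompose P [:t0, 1:]) = n + degree V"
      unfolding V using False by (simp add: degree_mult_eq degree_monom_eq monom_eq_0_iff)
    with assms(2) show ?thesis by (simp add: degree_pcompose)
  qed simp
  then obtain \<kappa> where \<kappa>: "V = [:\<kappa>:]" by (rule degree_eq_zeroE)
  have "poly P x = poly (smult \<kappa> ([:- t0, 1:] ^ n)) x" for x
  proof -
    have "poly P x = poly (pcompose P [:t0, 1:]) (x - t0)" by (simp add: poly_pcompose)
    also have "\<dots> = \<kappa> * (x - t0) ^ n" unfolding V \<kappa> by (simp add: poly_monom)
    finally show ?thesis by simp
  qed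
  then have "P = smult \<kappa> ([:- t0, 1:] ^ n)" by (simp add: poly_eq_poly_eq_iff[symmetric] fun_eq_iff)
  then show ?thesis by (rule that)
qed

lemma jet_branch_pcompose:
  "jet (branch t0) f = pcompose (jet ([:0, 1:], [:0, 0, 1:], [:1, 0, 0, 1:]) f) [:t0, 1:]"
proof -
  have "poly (jet (branch t0) f) x = poly (pcompose (jet ([:0, 1:], [:0, 0, 1:], [:1, 0, 0, 1:]) f) [:t0, 1:]) x" for x
    unfolding poly_jet_branch poly_pcompose poly_jet by (simp add: power2_eq_square power3_eq_cube mult.assoc)
  then show ?thesis by (simp add: poly_eq_poly_eq_iff[symmetric] fun_eq_iff)
qed

subsection \<open>Classification of the conics and lines\<close>

text \<open>The hyperosculating conic at \<open>t = 1\<close>: its restriction to the cubic is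
  \<open>(t - 1)^6\<close>.\<close>

definition conic :: poly3 where
  "conic = Z ^ 2 - 6 * (X * Z) - 6 * (Y * Z) + 21 * X ^ 2 - 22 * (X * Y) + 21 * Y ^ 2"

text \<open>If \<open>a^3 = 1\<close>, the restriction to the cubic is \<open>(t + a)^3\<close>;
  this is the tangent at the flex \<open>t = - a\<close>.\<close>

definition flex_line :: "complex \<Rightarrow> poly3" where
  "flex_line a = Z + const3 (3 * a\<^sup>2) * X + const3 (3 * a) * Y"

lemma hyperosculating_conic_nodal:
  assumes "hyperosculating_conic nodal q"
  obtains \<kappa> \<alpha> where "\<kappa> \<noteq> 0" "\<alpha> ^ 3 = 1" "q = const3 \<kappa> * sub (const3 \<alpha> * X, const3 (\<alpha>\<^sup>2) * Y, Z) conic"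
proof -
  have q: "homog 2 q" "irreducible3 q" using assms by (auto simp: hyperosculating_conic_def)
  obtain p where p: "smooth_pt nodal p" "6 \<le> int_mult nodal q p"
    using assms unfolding hyperosculating_conic_def by blast
  obtain r t where rt: "r \<noteq> 0" "t \<noteq> 0" "p = scale r (t, t\<^sup>2, 1 + t ^ 3)"
    using p(1) by (rule smooth_pt_nodal)
  have "monom 1 6 dvd jet (branch t) q"
    by (rule int_mult_nodal_branch[OF q(1) rt(2,1)]) (use p(2) rt in \<open>simp add: numeral_eq_enat\<close>)
  moreover obtain a b c d e g where qe: "q = const3 a * X ^ 2 + const3 b * (X * Y) + const3 c * Y ^ 2 + const3 d * (X * Z) + const3 e * (Y * Z) + const3 g * Z ^ 2"
    using q(1) by (rule homog_2_expand)
  have P: "jet ([:0, 1:], [:0, 0, 1:], [:1, 0, 0, 1:]) q = [:g, d, a + e, b + 2 * g, c + d, e, g:]"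
    by (simp add: qe power2_eq_square algebra_simps)
  have "degree [:g, d, a + e, b + 2 * g, c + d, e, g:] \<le> 6" by simp
  ultimately obtain \<kappa> where "[:g, d, a + e, b + 2 * g, c + d, e, g:] = smult \<kappa> ([:- t, 1:] ^ 6)"
    unfolding jet_branch_pcompose P by (rule monom_dvd_shifted)
  also have "\<dots> = [:\<kappa> * t^6, - 6 * \<kappa> * t^5, 15 * \<kappa> * t^4, - 20 * \<kappa> * t^3, 15 * \<kappa> * t^2, - 6 * \<kappa> * t, \<kappa>:]"
    by (simp add: eval_nat_numeral algebra_simps)
  finally have eqs: "g = \<kappa> * t^6" "d = - 6 * \<kappa> * t^5" "a + e = 15 * \<kappa> * t^4" "b + 2 * g = - 20 * \<kappa> * t^3"
    "c + d = 15 * \<kappa> * t^2" "e = - 6 * \<kappa> * t" "g = \<kappa>"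
    by auto
  have "\<kappa> \<noteq> 0"
  proof
    assume "\<kappa> = 0"
    then have "q = const3 0" using eqs by (simp add: qe)
    with q(2) show False unfolding irreducible3_def is_const_def by blast
  qed
  then have "t ^ 6 = 1" using eqs by simp
  then have "(t ^ 3 - 1) * (t ^ 3 + 1) = 0" by (simp add: algebra_simps flip: power_add)
  then consider "t ^ 3 = 1" | "t ^ 3 = - 1" by (auto simp: eq_neg_iff_add_eq_0)
  then show ?thesis
  proof cases
    case 1
    have pw: "t ^ 4 = t" "t ^ 5 = t\<^sup>2"
      using 1 by (simp_all add: eval_nat_numeral)
    \<comment> \<open>The substitution multiplies the parameter by \<open>t^2 = 1 / t\<close>, which
      moves the contact parameter \<open>t\<close> to 1.\<close>
    have "q = const3 \<kappa> * sub (const3 (t\<^sup>2) * X, const3 ((t\<^sup>2)\<^sup>2) * Y, Z) conic"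
    proof (rule poly3_eqI)
      fix x y z
      have co: "g = \<kappa>" "d = - 6 * \<kappa> * t\<^sup>2" "e = - 6 * \<kappa> * t" "a = 21 * \<kappa> * t" "b = - 22 * \<kappa>" "c = 21 * \<kappa> * t\<^sup>2"
      proof -
        have "a = 15 * \<kappa> * t ^ 4 - e" "b = - 20 * \<kappa> * t ^ 3 - 2 * g" "c = 15 * \<kappa> * t\<^sup>2 - d"
          using eqs(3-5) by (simp_all add: eq_diff_eq)
        then show "g = \<kappa>" "d = - 6 * \<kappa> * t\<^sup>2" "e = - 6 * \<kappa> * t" "a = 21 * \<kappa> * t" "b = - 22 * \<kappa>" "c = 21 * \<kappa> * t\<^sup>2"
          unfolding eqs(2,6,7) using 1 by (simp_all add: pw)
      qed
      have t4: "(t\<^sup>2)\<^sup>2 = t" using pw by (simp flip: power_mult)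
      show "peval q (x, y, z) = peval (const3 \<kappa> * sub (const3 (t\<^sup>2) * X, const3 ((t\<^sup>2)\<^sup>2) * Y, Z) conic) (x, y, z)"
        using 1 t4
        by (simp add: peval_sub act_def conic_def qe co power_mult_distrib) (simp add: algebra_simps power2_eq_square power3_eq_cube)
    qed
    moreover have "(t\<^sup>2) ^ 3 = 1" using \<open>t ^ 6 = 1\<close> by (simp flip: power_mult)
    ultimately show ?thesis using \<open>\<kappa> \<noteq> 0\<close> by (intro that)
  next
    case 2
    have pw: "t ^ 4 = - t" "t ^ 5 = - t\<^sup>2"
      using 2 by (simp_all add: eval_nat_numeral)
    \<comment> \<open>Here \<open>t\<close> is the parameter of a flex, and the conic with sixfold
      contact is the doubled flex tangent, which irreducibility excludes.\<close>
    let ?m = "Z + const3 (3 * t\<^sup>2) * X - const3 (3 * t) * Y"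
    have "q = const3 \<kappa> * ?m * ?m"
    proof (rule poly3_eqI)
      fix x y z
      have co: "g = \<kappa>" "d = 6 * \<kappa> * t\<^sup>2" "e = - 6 * \<kappa> * t" "a = - 9 * \<kappa> * t" "b = 18 * \<kappa>" "c = 9 * \<kappa> * t\<^sup>2"
        using eqs 2 by (auto simp: pw algebra_simps)
      have "peval (const3 \<kappa> * ?m * ?m) (x, y, z) = \<kappa> * (z\<^sup>2 + 6 * t\<^sup>2 * (x * z) - 6 * t * (y * z) + 9 * t ^ 4 * x\<^sup>2 - 18 * t ^ 3 * (x * y) + 9 * t\<^sup>2 * y\<^sup>2)"
        by simp algebra
      then show "peval q (x, y, z) = peval (const3 \<kappa> * ?m * ?m) (x, y, z)"
        by (simp add: qe co 2 pw) algebra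
    qed
    with q(2) have "is_const (const3 \<kappa> * ?m) \<or> is_const ?m" unfolding irreducible3_def by blast
    moreover have "\<not> is_const (const3 \<kappa> * ?m)" "\<not> is_const ?m"
      by (rule nonconst3I[of _ "(0, 0, 1)" "(0, 0, 0)"]; use \<open>\<kappa> \<noteq> 0\<close> in simp)+
    ultimately show ?thesis by blast
  qed
qed

section \<open>Inflectional lines and the common normal form\<close>

lemma int_mult_const_mult:
  assumes "c \<noteq> 0"
  shows "int_mult f (const3 c * g) p = int_mult f g p"
  unfolding int_mult_def
proof (rule loc_len_cong, rule in_ideal_eqI)
  have "in_ideal [f, g] (const3 c * g)" by (intro in_ideal_mult in_ideal_mem) simp
  then show "in_ideal [f, g] h" if "h \<in> set [f, const3 c * g]" for h
    using that in_ideal_mem[of f "[f, g]"] by auto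
  have "in_ideal [f, const3 c * g] (const3 (1 / c) * (const3 c * g))"
    by (intro in_ideal_mult in_ideal_mem) simp
  then have "in_ideal [f, const3 c * g] g" using assms by (simp add: mult.assoc[symmetric] const3_mult[symmetric])
  then show "in_ideal [f, const3 c * g] h" if "h \<in> set [f, g]" for h
    using that in_ideal_mem[of f "[f, const3 c * g]"] by auto
qed

lemma inflectional_line_linear:
  assumes "inflectional_line e l"
  obtains p where "smooth_pt e p" "homog 1 l" "l \<noteq> 0" "3 \<le> int_mult e l p"
proof -
  obtain p c where p: "smooth_pt e p" "c \<noteq> 0" "l = const3 c * tangent_line e p" "3 \<le> int_mult e (tangent_line e p) p"
    using assms unfolding inflectional_line_def by blast
  have tl: "tangent_line e p = const3 (peval (pd 0 e) p) * X + const3 (peval (pd 1 e) p) * Y + const3 (peval (pd 2 e) p) * Z"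
    by (simp add: tangent_line_def eval_nat_numeral)
  have "homog 1 (tangent_line e p)" unfolding tl by (rule homog_linear)
  then have "homog 1 l" unfolding p(3) by (rule homog_const_mult)
  moreover have "l \<noteq> 0"
  proof
    assume "l = 0"
    have "\<forall>v<3. peval (pd v e) p = 0"
      using \<open>l = 0\<close> p(2) arg_cong[OF p(3), of "\<lambda>f. peval f (1, 0, 0)"] arg_cong[OF p(3), of "\<lambda>f. peval f (0, 1, 0)"]
        arg_cong[OF p(3), of "\<lambda>f. peval f (0, 0, 1)"]
      by (auto simp: tl elim!: var3_cases)
    with p(1) show False by (auto simp: smooth_pt_def singular_pt_def)
  qed
  ultimately show ?thesis using p that by (simp add: int_mult_const_mult)
qed

lemma flex_line_nodal:
  assumes "smooth_pt nodal p" "homog 1 l" "l \<noteq> 0" "3 \<le> int_mult nodal l p"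
  obtains \<kappa> b where "\<kappa> \<noteq> 0" "b ^ 3 = 1" "l = const3 \<kappa> * flex_line b"
proof -
  obtain r t where rt: "r \<noteq> 0" "t \<noteq> 0" "p = scale r (t, t\<^sup>2, 1 + t ^ 3)"
    using assms(1) by (rule smooth_pt_nodal)
  have "monom 1 3 dvd jet (branch t) l"
    by (rule int_mult_nodal_branch[OF assms(2) rt(2,1)]) (use assms(4) rt in \<open>simp add: numeral_eq_enat\<close>)
  moreover obtain a b c where l: "l = const3 a * X + const3 b * Y + const3 c * Z"
    using assms(2) by (rule homog_1_expand)
  have P: "jet ([:0, 1:], [:0, 0, 1:], [:1, 0, 0, 1:]) l = [:c, a, b, c:]"
    by (simp add: l)
  have "degree [:c, a, b, c:] \<le> 3" by simp
  ultimately obtain \<kappa> where "[:c, a, b, c:] = smult \<kappa> ([:- t, 1:] ^ 3)"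
    unfolding jet_branch_pcompose P by (rule monom_dvd_shifted)
  also have "\<dots> = [:- \<kappa> * t^3, 3 * \<kappa> * t^2, - 3 * \<kappa> * t, \<kappa>:]"
    by (simp add: eval_nat_numeral algebra_simps)
  finally have eqs: "c = - \<kappa> * t^3" "a = 3 * \<kappa> * t^2" "b = - 3 * \<kappa> * t" "c = \<kappa>" by auto
  have "\<kappa> \<noteq> 0" using eqs assms(3) by (auto simp: l)
  have "\<kappa> = - \<kappa> * t ^ 3" using eqs by simp
  then have "\<kappa> * (t ^ 3 + 1) = 0" by algebra
  then have "t ^ 3 = - 1" using \<open>\<kappa> \<noteq> 0\<close> by (simp add: eq_neg_iff_add_eq_0)
  then have "(- t) ^ 3 = 1" by (simp add: power3_eq_cube)
  moreover have "l = const3 \<kappa> * flex_line (- t)"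
    by (rule poly3_eqI) (simp add: l flex_line_def eqs(2,3) \<open>c = \<kappa>\<close>, simp add: algebra_simps)
  ultimately show ?thesis using \<open>\<kappa> \<noteq> 0\<close> by (intro that)
qed

text \<open>The diagonal symmetry of the cubic that makes the conic standard changes the flex
  parameter from \<open>b\<close> to \<open>b * \<alpha>\<close>, again a cube root of unity; no
  freedom is left to normalise it.\<close>

theorem sextic_normal_form:
  assumes "nodal_cubic e" "hyperosculating_conic e q" "inflectional_line e l"
  obtains S T a where "coord_change S T" "a ^ 3 = 1" "e * q * l = sub S (nodal * conic * flex_line a)"
proof -
  obtain U V where UV: "coord_change U V" "sub U e = nodal" using nodal_cubic_normal_form[OF assms(1)] by blast
  interpret UV: coord_change U V by fact
  interpret VU: coord_change V U by (rule coord_change_sym) fact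
  have "hyperosculating_conic nodal (sub U q)"
    using UV.hyperosculating_conic_sub[OF assms(2)] by (simp add: UV(2))
  then obtain \<kappa> \<alpha> where q: "\<kappa> \<noteq> 0" "\<alpha> ^ 3 = 1" "sub U q = const3 \<kappa> * sub (const3 \<alpha> * X, const3 (\<alpha>\<^sup>2) * Y, Z) conic"
    by (rule hyperosculating_conic_nodal)
  obtain p where p: "smooth_pt e p" "homog 1 l" "l \<noteq> 0" "3 \<le> int_mult e l p"
    using assms(3) by (rule inflectional_line_linear)
  have "smooth_pt nodal (act V p)" "3 \<le> int_mult nodal (sub U l) (act V p)"
    using p UV.smooth_pt_sub[of e "act V p"] UV.int_mult_sub[of e l "act V p"] by (simp_all add: UV(2) UV.act_S)
  moreover have "homog 1 (sub U l)" using p(2) by (rule UV.homog_S)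
  moreover have "sub U l \<noteq> 0" using p(3) UV.TS[of l] by auto
  ultimately obtain \<kappa>' b where l: "\<kappa>' \<noteq> 0" "b ^ 3 = 1" "sub U l = const3 \<kappa>' * flex_line b"
    using flex_line_nodal by blast
  \<comment> \<open>Scaling all coordinates by \<open>r\<close> multiplies a sextic by
    \<open>r ^ 6\<close>, which absorbs the constant factors of conic and line.\<close>
  obtain r where r: "r ^ 6 = \<kappa> * \<kappa>'" using nth_root_exists[of 6 "\<kappa> * \<kappa>'"] by auto
  have nz: "r \<noteq> 0" "\<alpha> \<noteq> 0" using r q l by auto
  let ?D = "(const3 (r * \<alpha>) * X, const3 (r * \<alpha>\<^sup>2) * Y, const3 r * Z)"
  let ?D' = "(const3 (1 / (r * \<alpha>)) * X, const3 (1 / (r * \<alpha>\<^sup>2)) * Y, const3 (1 / r) * Z)"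
  have D: "coord_change ?D ?D'"
    by (rule coord_changeI) (use nz in \<open>auto simp: act_def intro!: homog_const_mult\<close>)
  obtain S T where ST: "coord_change S T" "\<And>f. sub S f = sub V (sub ?D f)"
    using coord_change_comp[OF coord_change_sym[OF UV(1)] D] by blast
  have "sub ?D (nodal * conic * flex_line (b * \<alpha>)) = sub U (e * q * l)"
  proof (rule poly3_eqI)
    fix x y z
    have nod: "peval nodal (r * \<alpha> * x, r * \<alpha>\<^sup>2 * y, r * z) = r ^ 3 * peval nodal (x, y, z)"
    proof -
      have "peval nodal (r * \<alpha> * x, r * \<alpha>\<^sup>2 * y, r * z) = r ^ 3 * (\<alpha> ^ 3 * (x * y * z) - \<alpha> ^ 3 * x ^ 3 - (\<alpha> ^ 3) ^ 2 * y ^ 3)"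
        by (simp add: nodal_def) algebra
      then show ?thesis by (simp add: q(2) nodal_def)
    qed
    have con: "peval conic (r * \<alpha> * x, r * \<alpha>\<^sup>2 * y, r * z) = r ^ 2 * peval conic (\<alpha> * x, \<alpha>\<^sup>2 * y, z)"
      by (simp add: conic_def) algebra
    have fle: "peval (flex_line (b * \<alpha>)) (r * \<alpha> * x, r * \<alpha>\<^sup>2 * y, r * z) = r * peval (flex_line b) (x, y, z)"
    proof -
      have "peval (flex_line (b * \<alpha>)) (r * \<alpha> * x, r * \<alpha>\<^sup>2 * y, r * z) = r * (z + 3 * b\<^sup>2 * \<alpha> ^ 3 * x + 3 * b * \<alpha> ^ 3 * y)"
        by (simp add: flex_line_def) algebra
      then show ?thesis by (simp add: q(2) flex_line_def)
    qed
    have "peval (sub ?D (nodal * conic * flex_line (b * \<alpha>))) (x, y, z) =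
      r ^ 6 * (peval nodal (x, y, z) * peval conic (\<alpha> * x, \<alpha>\<^sup>2 * y, z) * peval (flex_line b) (x, y, z))"
    proof -
      have r6: "r ^ 6 = r ^ 3 * r ^ 2 * r" by (simp add: eval_nat_numeral)
      show ?thesis unfolding r6 by (simp add: peval_sub act_def nod con fle)
    qed
    also have "\<dots> = peval (sub U (e * q * l)) (x, y, z)"
      by (simp add: r UV(2) q(3) l(3)) (simp add: peval_sub act_def)
    finally show "peval (sub ?D (nodal * conic * flex_line (b * \<alpha>))) (x, y, z) = peval (sub U (e * q * l)) (x, y, z)" .
  qed
  then have "sub S (nodal * conic * flex_line (b * \<alpha>)) = e * q * l"
    by (simp only: ST UV.TS)
  moreover have "(b * \<alpha>) ^ 3 = 1" by (simp add: power_mult_distrib q l)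
  ultimately show ?thesis using ST(1) that by metis
qed

section \<open>The sextic in normal form\<close>

subsection \<open>Reduction to binary forms of degree seven\<close>

text \<open>Membership in the sum of the ideal and the multiples of \<open>\<mu>\<close>, the
  premise \<open>step\<close> of \<open>codim_le_Suc\<close>.\<close>

definition liftable :: "poly3 list \<Rightarrow> poly3 \<Rightarrow> nat \<Rightarrow> poly3 \<Rightarrow> bool" where
  "liftable gs \<mu> n b \<longleftrightarrow> (\<exists>h. homog n h \<and> in_ideal gs (b - \<mu> * h))"

lemma liftable_add:
  assumes "liftable gs \<mu> n b" "liftable gs \<mu> n b'"
  shows "liftable gs \<mu> n (b + b')"
proof -
  obtain h h' where "homog n h" "in_ideal gs (b - \<mu> * h)" "homog n h'" "in_ideal gs (b' - \<mu> * h')"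
    using assms unfolding liftable_def by blast
  then have "homog n (h + h')" "in_ideal gs ((b - \<mu> * h) + (b' - \<mu> * h'))"
    by (auto intro: homog_add in_ideal_add)
  then show ?thesis unfolding liftable_def by (intro exI[of _ "h + h'"]) (simp add: algebra_simps)
qed

lemma liftable_mult:
  assumes "liftable gs \<mu> n b" "homog k c"
  shows "liftable gs \<mu> (k + n) (c * b)"
proof -
  obtain h where "homog n h" "in_ideal gs (b - \<mu> * h)"
    using assms(1) unfolding liftable_def by blast
  then have "homog (k + n) (c * h)" "in_ideal gs (c * (b - \<mu> * h))"
    using assms(2) by (auto intro: homog_mult in_ideal_mult)
  then show ?thesis unfolding liftable_def by (intro exI[of _ "c * h"]) (simp add: algebra_simps)
qed

lemma liftable_const_mult: "liftable gs \<mu> n b \<Longrightarrow> liftable gs \<mu> n (const3 c * b)"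
  using liftable_mult[of gs \<mu> n b 0 "const3 c"] by simp

lemma liftable_multiple: "homog n h \<Longrightarrow> liftable gs \<mu> n (\<mu> * h)"
  unfolding liftable_def by (intro exI[of _ h]) simp

text \<open>Monomial by monomial: \<open>Z ^ k - \<zeta> ^ k\<close> is \<open>Z - \<zeta>\<close>
  times the homogeneous sum \<open>s\<close>.\<close>

lemma restriction_diff:
  assumes "homog (Suc d) f" "homog 1 \<zeta>"
  shows "\<exists>g. homog d g \<and> f - sub (X, Y, \<zeta>) f = (Z - \<zeta>) * g"
  using assms(1)
proof (induction rule: homog_induct)
  case (single i j k c)
  define s where "s = (\<Sum>l<k. \<zeta> ^ (k - Suc l) * Z ^ l)"
  have s: "homog (k - 1) s"
    unfolding s_def
  proof (rule homog_sum)
    fix l assume "l \<in> {..<k}"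
    then show "homog (k - 1) (\<zeta> ^ (k - Suc l) * Z ^ l)"
      using homog_mult[OF homog_power[OF assms(2), of "k - Suc l"] homog_power[OF homog_var(1), of l 2]] by simp
  qed
  have eq: "Poly_Mapping.single (i, j, k) c - sub (X, Y, \<zeta>) (Poly_Mapping.single (i, j, k) c)
    = (Z - \<zeta>) * (const3 c * X ^ i * Y ^ j * s)"
  proof -
    have "Poly_Mapping.single (i, j, k) c - sub (X, Y, \<zeta>) (Poly_Mapping.single (i, j, k) c)
      = const3 c * X ^ i * Y ^ j * (Z ^ k - \<zeta> ^ k)"
      unfolding const3.ev_single unfolding single_eq_monomial by (simp only: right_diff_distrib)
    then show ?thesis unfolding power_diff_sumr2[of Z k \<zeta>] s_def by (simp only: mult_ac)
  qed
  show ?case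
  proof (cases "k = 0")
    case True
    then have "s = 0" by (simp add: s_def)
    then show ?thesis unfolding eq by (intro exI[of _ 0]) simp
  next
    case False
    have "homog (0 + i * 1 + j * 1 + (k - 1)) (const3 c * X ^ i * Y ^ j * s)"
      by (intro homog_mult homog_power s homog_const homog_var)
    moreover have "0 + i * 1 + j * 1 + (k - 1) = d" using single False by simp
    ultimately show ?thesis unfolding eq by (metis (no_types, lifting))
  qed
next
  case (add f g)
  then obtain u v where "homog d u" "f - sub (X, Y, \<zeta>) f = (Z - \<zeta>) * u" "homog d v" "g - sub (X, Y, \<zeta>) g = (Z - \<zeta>) * v"
    by blast
  moreover have "f + g - sub (X, Y, \<zeta>) (f + g) = (f - sub (X, Y, \<zeta>) f) + (g - sub (X, Y, \<zeta>) g)"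
    by simp
  ultimately show ?case by (intro exI[of _ "u + v"]) (simp add: homog_add distrib_left)
qed (auto intro: exI[of _ 0])

lemma liftable_restriction:
  assumes "in_ideal gs f" "homog (Suc d) f" "homog 1 \<zeta>"
  shows "liftable gs (Z - \<zeta>) d (sub (X, Y, \<zeta>) f)"
proof -
  obtain g where g: "homog d g" "f - sub (X, Y, \<zeta>) f = (Z - \<zeta>) * g"
    using restriction_diff[OF assms(2,3)] by blast
  have "sub (X, Y, \<zeta>) f - (Z - \<zeta>) * (- g) = f"
    using g(2) by (simp add: algebra_simps)
  then show ?thesis
    unfolding liftable_def using assms(1) g(1) by (intro exI[of _ "- g"]) (auto intro: homog_uminus)
qed

text \<open>Modulo the linear form, \<open>Z\<close> becomes \<open>\<alpha> X + \<beta> Y\<close>,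
  so binary monomials suffice; from degree 7 on each of these is a multiple of one of degree
  7.\<close>

lemma liftable_if_binary:
  assumes "\<And>i j. i + j = 7 \<Longrightarrow> liftable gs (Z - const3 \<alpha> * X - const3 \<beta> * Y) 6 (X ^ i * Y ^ j)"
    and "6 \<le> n" "homog (Suc n) h"
  shows "liftable gs (Z - const3 \<alpha> * X - const3 \<beta> * Y) n h"
proof -
  let ?\<mu> = "Z - const3 \<alpha> * X - const3 \<beta> * Y"
  have mon: "liftable gs ?\<mu> n (X ^ i * Y ^ j * Z ^ k)" if "i + j + k = Suc n" for i j k
    using that
  proof (induction k arbitrary: i j)
    case 0
    define i0 where "i0 = min i 7"
    have "homog ((i - i0) * 1 + (j - (7 - i0)) * 1) (X ^ (i - i0) * Y ^ (j - (7 - i0)))"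
      by (intro homog_mult homog_power homog_var)
    from liftable_mult[OF assms(1)[of i0 "7 - i0"] this] have
      "liftable gs ?\<mu> ((i - i0) * 1 + (j - (7 - i0)) * 1 + 6) (X ^ (i - i0) * Y ^ (j - (7 - i0)) * (X ^ i0 * Y ^ (7 - i0)))"
      by (simp add: i0_def)
    moreover have "(i - i0) * 1 + (j - (7 - i0)) * 1 + 6 = n"
      using 0 assms(2) by (auto simp: i0_def min_def)
    moreover have "X ^ (i - i0) * Y ^ (j - (7 - i0)) * (X ^ i0 * Y ^ (7 - i0)) = X ^ i * Y ^ j"
    proof -
      have "i = (i - i0) + i0" "j = (j - (7 - i0)) + (7 - i0)" using 0 assms(2) by (auto simp: i0_def min_def)
      then have "X ^ i = X ^ (i - i0) * X ^ i0" "Y ^ j = Y ^ (j - (7 - i0)) * Y ^ (7 - i0)" by (metis power_add)+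
      then show ?thesis by (simp only: mult_ac)
    qed
    ultimately show ?case by simp
  next
    case (Suc k)
    have "homog (i * 1 + j * 1 + k * 1) (X ^ i * Y ^ j * Z ^ k)"
      by (intro homog_mult homog_power homog_var)
    moreover have "i * 1 + j * 1 + k * 1 = n" using Suc.prems by simp
    ultimately have "homog n (X ^ i * Y ^ j * Z ^ k)" by simp
    then have "liftable gs ?\<mu> n (const3 \<alpha> * (X ^ Suc i * Y ^ j * Z ^ k) + const3 \<beta> * (X ^ i * Y ^ Suc j * Z ^ k) + ?\<mu> * (X ^ i * Y ^ j * Z ^ k))"
      using Suc.prems by (intro liftable_add liftable_const_mult Suc.IH liftable_multiple) auto
    also have "const3 \<alpha> * (X ^ Suc i * Y ^ j * Z ^ k) + const3 \<beta> * (X ^ i * Y ^ Suc j * Z ^ k) + ?\<mu> * (X ^ i * Y ^ j * Z ^ k)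
      = X ^ i * Y ^ j * Z ^ Suc k" by (simp add: algebra_simps)
    finally show ?case .
  qed
  from assms(3) show ?thesis
  proof (induction rule: homog_induct)
    case zero
    then show ?case unfolding liftable_def by (intro exI[of _ 0]) auto
  next
    case (single i j k c)
    from liftable_const_mult[OF mon[OF single], of c] show ?case
      by (simp add: single_eq_monomial mult.assoc)
  qed (rule liftable_add)
qed

text \<open>On the plane the partials become binary quintics. Three quadratic multipliers have nine
  coefficients, against eight of a binary septic; \<open>D\<close> clears the denominators of a
  solution.\<close>

lemma liftable_combination:
  assumes f: "homog 6 f" and "D \<noteq> 0"
    and eq: "\<And>x y. D * (x ^ i * y ^ j) =
      (p0 * x\<^sup>2 + q0 * (x * y) + r0 * y\<^sup>2) * peval (pd 0 f) (x, y, \<alpha> * x + \<beta> * y) +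
      (p1 * x\<^sup>2 + q1 * (x * y) + r1 * y\<^sup>2) * peval (pd 1 f) (x, y, \<alpha> * x + \<beta> * y) +
      (p2 * x\<^sup>2 + q2 * (x * y) + r2 * y\<^sup>2) * peval (pd 2 f) (x, y, \<alpha> * x + \<beta> * y)"
  shows "liftable (jacobian f) (Z - const3 \<alpha> * X - const3 \<beta> * Y) 6 (X ^ i * Y ^ j)"
proof -
  let ?\<zeta> = "const3 \<alpha> * X + const3 \<beta> * Y"
  let ?q = "\<lambda>p q r. const3 p * X\<^sup>2 + const3 q * (X * Y) + const3 r * Y\<^sup>2"
  have \<zeta>: "homog 1 ?\<zeta>" by (intro homog_add homog_const_mult homog_var)
  have q: "homog 2 (?q p q r)" for p q r
    using homog_power[OF homog_var(1), of 2] homog_mult[OF homog_var(1) homog_var(1)]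
    by (intro homog_add homog_const_mult) (simp_all add: numeral_2_eq_2)
  have "liftable (jacobian f) (Z - ?\<zeta>) 4 (sub (X, Y, ?\<zeta>) (pd v f))" if "v < 3" for v
  proof (rule liftable_restriction[OF _ _ \<zeta>])
    show "in_ideal (jacobian f) (pd v f)"
      using that by (intro in_ideal_mem) (auto elim!: var3_cases)
    show "homog (Suc 4) (pd v f)" using homog_pd[of 5 f v] f by simp
  qed
  then have l: "liftable (jacobian f) (Z - ?\<zeta>) (2 + 4) (?q p q r * sub (X, Y, ?\<zeta>) (pd v f))" if "v < 3" for v p q r
    using that q by (intro liftable_mult)
  have "liftable (jacobian f) (Z - ?\<zeta>) (2 + 4) (const3 (1 / D) * (?q p0 q0 r0 * sub (X, Y, ?\<zeta>) (pd 0 f)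
    + ?q p1 q1 r1 * sub (X, Y, ?\<zeta>) (pd 1 f) + ?q p2 q2 r2 * sub (X, Y, ?\<zeta>) (pd 2 f)))"
    by (intro liftable_const_mult liftable_add l) auto
  also have "const3 (1 / D) * (?q p0 q0 r0 * sub (X, Y, ?\<zeta>) (pd 0 f)
    + ?q p1 q1 r1 * sub (X, Y, ?\<zeta>) (pd 1 f) + ?q p2 q2 r2 * sub (X, Y, ?\<zeta>) (pd 2 f)) = X ^ i * Y ^ j"
    (is "_ * ?c = _")
  proof (rule poly3_eqI)
    fix x y z
    have "peval ?c (x, y, z) = D * (x ^ i * y ^ j)"
      unfolding eq by (simp add: peval_sub act_def)
    then show "peval (const3 (1 / D) * ?c) (x, y, z) = peval (X ^ i * Y ^ j) (x, y, z)"
      using \<open>D \<noteq> 0\<close> unfolding peval.ev_mult[folded peval_eq_ev] by simp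
  qed
  finally show ?thesis by (simp add: diff_diff_eq)
qed

text \<open>The quintics are the restrictions of the partial derivatives of the sextics to \<open>z = x - 3 y\<close> resp.
  \<open>z = x\<close>; the coefficients solve an 8 by 9 linear system over \<open>\<rat>\<close> resp. \<open>\<rat>(a)\<close>.\<close>

lemma quintic_combinations_one:
  fixes x y :: complex
  defines "g0 \<equiv> (- 384) * x^5 + 512 * x^4 * y + (- 1616) * x^3 * y^2 + 528 * x^2 * y^3 + (- 944) * x * y^4 + (- 144) * y^5"
    and "g1 \<equiv> 128 * x^5 + (- 512) * x^4 * y + 432 * x^3 * y^2 + (- 752) * x^2 * y^3 + (- 1200) * x * y^4 + (- 144) * y^5"
    and "g2 \<equiv> 128 * x^4 * y + (- 176) * x^3 * y^2 + 432 * x^2 * y^3 + (- 80) * x * y^4 + (- 48) * y^5"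
  shows
    "3072 * (x^7 * y^0) =
      ((- 187) * x^2 + (- 303) * (x * y) + 198 * y^2) * g0 +
      ((- 537) * x^2 + 655 * (x * y) + (- 198) * y^2) * g1 +
      ((- 2964) * x^2 + 0 * (x * y) + 0 * y^2) * g2"
    "3072 * (x^6 * y^1) =
      ((- 675) * x^2 + 1229 * (x * y) + 1590 * y^2) * g0 +
      ((- 2025) * x^2 + 1011 * (x * y) + (- 1502) * y^2) * g1 +
      ((- 2700) * x^2 + 0 * (x * y) + (- 264) * y^2) * g2"
    "3072 * (x^5 * y^2) =
      ((- 189) * x^2 + 541 * (x * y) + 516 * y^2) * g0 +
      ((- 567) * x^2 + 163 * (x * y) + (- 484) * y^2) * g1 +
      ((- 52) * x^2 + 0 * (x * y) + (- 96) * y^2) * g2"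
    "3072 * (x^4 * y^3) =
      (143 * x^2 + (- 191) * (x * y) + (- 312) * y^2) * g0 +
      (429 * x^2 + (- 257) * (x * y) + 296 * y^2) * g1 +
      (828 * x^2 + 0 * (x * y) + 48 * y^2) * g2"
    "3072 * (x^3 * y^4) =
      (111 * x^2 + (- 239) * (x * y) + (- 276) * y^2) * g0 +
      (333 * x^2 + (- 145) * (x * y) + 260 * y^2) * g1 +
      (316 * x^2 + 0 * (x * y) + 48 * y^2) * g2"
    "3072 * (x^2 * y^5) =
      ((- 5) * x^2 + (- 27) * (x * y) + 0 * y^2) * g0 +
      ((- 15) * x^2 + 27 * (x * y) + 0 * y^2) * g1 +
      ((- 148) * x^2 + 0 * (x * y) + 0 * y^2) * g2"
    "3072 * (x^1 * y^6) =
      ((- 37) * x^2 + 69 * (x * y) + 84 * y^2) * g0 +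
      ((- 111) * x^2 + 59 * (x * y) + (- 84) * y^2) * g1 +
      ((- 148) * x^2 + 0 * (x * y) + 0 * y^2) * g2"
    "3072 * (x^0 * y^7) =
      ((- 9) * x^2 + 9 * (x * y) + 40 * y^2) * g0 +
      ((- 27) * x^2 + (- 9) * (x * y) + (- 24) * y^2) * g1 +
      ((- 36) * x^2 + 0 * (x * y) + (- 112) * y^2) * g2"
  unfolding assms by algebra+

lemma quintic_combinations_omega:
  fixes a x y :: complex
  defines "g0 \<equiv> (216 + 300 * a) * x^5 + (- 448 - 858 * a) * x^4 * y + (373 + 960 * a) * x^3 * y^2 + (15 - 309 * a) * x^2 * y^3 + (- 128 - 195 * a) * x * y^4 + (63 + 129 * a) * y^5"
    and "g1 \<equiv> (- 88 - 180 * a) * x^5 + (196 + 558 * a) * x^4 * y + (- 30 - 486 * a) * x^3 * y^2 + (- 224 - 276 * a) * x^2 * y^3 + (210 + 735 * a) * x * y^4 + (- 378 * a) * y^5"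
    and "g2 \<equiv> (- 24 - 12 * a) * x^5 + (8 - 42 * a) * x^4 * y + (19 + 156 * a) * x^3 * y^2 + (- 45 - 177 * a) * x^2 * y^3 + (16 + 57 * a) * x * y^4 + (- 21 + 18 * a) * y^5"
  assumes a: "a^2 + a + 1 = 0"
  shows
    "6672 * (x^7 * y^0) =
      ((1146202 - 47906825 * a) * x^2 + (14830391 + 327298 * a) * (x * y) + (- 22963626 + 72326646 * a) * y^2) * g0 +
      ((- 8575314 - 73581030 * a) * x^2 + (- 3396366 + 835819 * a) * (x * y) + (8044919 + 28510174 * a) * y^2) * g1 +
      ((35327732 - 106816427 * a) * x^2 + (- 93831085 + 53110042 * a) * (x * y) + 0 * y^2) * g2"
    "3336 * (x^6 * y^1) =
      ((- 15428078 - 24189279 * a) * x^2 + (2574011 - 4823400 * a) * (x * y) + (19427562 + 43366806 * a) * y^2) * g0 +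
      ((- 25395018 - 33716286 * a) * x^2 + (- 408266 + 1475061 * a) * (x * y) + (10619915 + 11561856 * a) * y^2) * g1 +
      ((- 28810280 - 65132973 * a) * x^2 + (736763 + 57138864 * a) * (x * y) + 0 * y^2) * g2"
    "834 * (x^5 * y^2) =
      ((- 5235683 - 3492245 * a) * x^2 + (- 551451 - 1631237 * a) * (x * y) + (8632764 + 7547274 * a) * y^2) * g0 +
      ((- 7626360 - 4222296 * a) * x^2 + (186249 + 410929 * a) * (x * y) + (2765187 + 1136863 * a) * y^2) * g1 +
      ((- 12921955 - 11499941 * a) * x^2 + (9136899 + 13942447 * a) * (x * y) + 0 * y^2) * g2"
    "834 * (x^4 * y^3) =
      ((- 4031384 - 51148 * a) * x^2 + (- 1219600 - 1250551 * a) * (x * y) + (7786674 + 1802556 * a) * y^2) * g0 +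
      ((- 5318208 + 786816 * a) * x^2 + (324956 + 266582 * a) * (x * y) + (1660004 - 682621 * a) * y^2) * g1 +
      ((- 11701656 - 2919532 * a) * x^2 + (11997548 + 7690955 * a) * (x * y) + 0 * y^2) * g2"
    "834 * (x^3 * y^4) =
      ((- 1383924 + 2583188 * a) * x^2 + (- 1200307 - 422881 * a) * (x * y) + (3796884 - 3331818 * a) * y^2) * g0 +
      ((- 1279560 + 4251960 * a) * x^2 + (290710 + 42752 * a) * (x * y) + (107645 - 1769863 * a) * y^2) * g1 +
      ((- 5738716 + 4850060 * a) * x^2 + (9010103 - 353917 * a) * (x * y) + 0 * y^2) * g2"
    "834 * (x^2 * y^5) =
      ((1220940 + 3472481 * a) * x^2 + (- 668183 + 386840 * a) * (x * y) + (- 863226 - 5795622 * a) * y^2) * g0 +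
      ((2337018 + 5055246 * a) * x^2 + (140014 - 145309 * a) * (x * y) + (- 1116659 - 1834000 * a) * y^2) * g1 +
      ((1257734 + 8660015 * a) * x^2 + (2872921 - 6300988 * a) * (x * y) + 0 * y^2) * g2"
    "417 * (x^1 * y^6) =
      ((1336776 + 1327321 * a) * x^2 + (11641 + 416941 * a) * (x * y) + (- 2014236 - 2586780 * a) * y^2) * g0 +
      ((2039238 + 1746030 * a) * x^2 + (- 17162 - 112779 * a) * (x * y) + (- 782822 - 547084 * a) * y^2) * g1 +
      ((3013598 + 3912215 * a) * x^2 + (- 1507283 - 4050873 * a) * (x * y) + 0 * y^2) * g2"
    "2502 * (x^0 * y^7) =
      ((7880580 + 2677217 * a) * x^2 + (1612200 + 2439788 * a) * (x * y) + (- 14095320 - 7431558 * a) * y^2) * g0 +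
      ((10942578 + 2411862 * a) * x^2 + (- 455378 - 568895 * a) * (x * y) + (- 3699674 - 186940 * a) * y^2) * g1 +
      ((21159542 + 11466711 * a) * x^2 + (- 18547336 - 17955322 * a) * (x * y) + 0 * y^2) * g2"
proof -
  \<comment> \<open>The last summand is the explicit multiple of \<open>a^2 + a + 1\<close> by which
    the two sides differ, so what is checked is an identity in independent \<open>a\<close>,
    \<open>x\<close>, \<open>y\<close>.\<close>
  have "((1146202 - 47906825 * a) * x^2 + (14830391 + 327298 * a) * (x * y) + (- 22963626 + 72326646 * a) * y^2) * g0 +
      ((- 8575314 - 73581030 * a) * x^2 + (- 3396366 + 835819 * a) * (x * y) + (8044919 + 28510174 * a) * y^2) * g1 +
      ((35327732 - 106816427 * a) * x^2 + (- 93831085 + 53110042 * a) * (x * y) + 0 * y^2) * g2 = 6672 * (x^7 * y^0) + (a^2 + a + 1) * (154335024 * x^7 + 3842552520 * x^6 * y + (- 12372427998) * x^5 * y^2 + 16063660206 * x^4 * y^3 + (- 4983425478) * x^3 * y^4 + (- 6929012160) * x^2 * y^5 + 7533544536 * x * y^6 + (- 1446708438) * y^7)"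
    unfolding assms(1-3) by algebra
  then show "6672 * (x^7 * y^0) =
      ((1146202 - 47906825 * a) * x^2 + (14830391 + 327298 * a) * (x * y) + (- 22963626 + 72326646 * a) * y^2) * g0 +
      ((- 8575314 - 73581030 * a) * x^2 + (- 3396366 + 835819 * a) * (x * y) + (8044919 + 28510174 * a) * y^2) * g1 +
      ((35327732 - 106816427 * a) * x^2 + (- 93831085 + 53110042 * a) * (x * y) + 0 * y^2) * g2"
    unfolding a by simp
  have "((- 15428078 - 24189279 * a) * x^2 + (2574011 - 4823400 * a) * (x * y) + (19427562 + 43366806 * a) * y^2) * g0 +
      ((- 25395018 - 33716286 * a) * x^2 + (- 408266 + 1475061 * a) * (x * y) + (10619915 + 11561856 * a) * y^2) * g1 +
      ((- 28810280 - 65132973 * a) * x^2 + (736763 + 57138864 * a) * (x * y) + 0 * y^2) * g2 = 3336 * (x^6 * y^1) + (a^2 + a + 1) * ((- 406256544) * x^7 + 2278101312 * x^6 * y + (- 3505699962) * x^5 * y^2 + 1117833606 * x^4 * y^3 + 3205666314 * x^3 * y^4 + (- 2857821624) * x^2 * y^5 + (- 109855116) * x * y^6 + 1223936406 * y^7)"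
    unfolding assms(1-3) by algebra
  then show "3336 * (x^6 * y^1) =
      ((- 15428078 - 24189279 * a) * x^2 + (2574011 - 4823400 * a) * (x * y) + (19427562 + 43366806 * a) * y^2) * g0 +
      ((- 25395018 - 33716286 * a) * x^2 + (- 408266 + 1475061 * a) * (x * y) + (10619915 + 11561856 * a) * y^2) * g1 +
      ((- 28810280 - 65132973 * a) * x^2 + (736763 + 57138864 * a) * (x * y) + 0 * y^2) * g2"
    unfolding a by simp
  have "((- 5235683 - 3492245 * a) * x^2 + (- 551451 - 1631237 * a) * (x * y) + (8632764 + 7547274 * a) * y^2) * g0 +
      ((- 7626360 - 4222296 * a) * x^2 + (186249 + 410929 * a) * (x * y) + (2765187 + 1136863 * a) * y^2) * g1 +
      ((- 12921955 - 11499941 * a) * x^2 + (9136899 + 13942447 * a) * (x * y) + 0 * y^2) * g2 = 834 * (x^5 * y^2) + (a^2 + a + 1) * ((- 149660928) * x^7 + 392654880 * x^6 * y + 8353674 * x^5 * y^2 + (- 1151921862) * x^4 * y^3 + 1537793910 * x^3 * y^4 + (- 292509000) * x^2 * y^5 + (- 750920814) * x * y^6 + 543864132 * y^7)"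
    unfolding assms(1-3) by algebra
  then show "834 * (x^5 * y^2) =
      ((- 5235683 - 3492245 * a) * x^2 + (- 551451 - 1631237 * a) * (x * y) + (8632764 + 7547274 * a) * y^2) * g0 +
      ((- 7626360 - 4222296 * a) * x^2 + (186249 + 410929 * a) * (x * y) + (2765187 + 1136863 * a) * y^2) * g1 +
      ((- 12921955 - 11499941 * a) * x^2 + (9136899 + 13942447 * a) * (x * y) + 0 * y^2) * g2"
    unfolding a by simp
  have "((- 4031384 - 51148 * a) * x^2 + (- 1219600 - 1250551 * a) * (x * y) + (7786674 + 1802556 * a) * y^2) * g0 +
      ((- 5318208 + 786816 * a) * x^2 + (324956 + 266582 * a) * (x * y) + (1660004 - 682621 * a) * y^2) * g1 +
      ((- 11701656 - 2919532 * a) * x^2 + (11997548 + 7690955 * a) * (x * y) + 0 * y^2) * g2 = 834 * (x^4 * y^3) + (a^2 + a + 1) * ((- 121936896) * x^7 + 90107136 * x^6 * y + 675402336 * x^5 * y^2 + (- 1742393718) * x^4 * y^3 + 1435622454 * x^3 * y^4 + 153027126 * x^2 * y^5 + (- 976876740) * x * y^6 + 490560462 * y^7)"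
    unfolding assms(1-3) by algebra
  then show "834 * (x^4 * y^3) =
      ((- 4031384 - 51148 * a) * x^2 + (- 1219600 - 1250551 * a) * (x * y) + (7786674 + 1802556 * a) * y^2) * g0 +
      ((- 5318208 + 786816 * a) * x^2 + (324956 + 266582 * a) * (x * y) + (1660004 - 682621 * a) * y^2) * g1 +
      ((- 11701656 - 2919532 * a) * x^2 + (11997548 + 7690955 * a) * (x * y) + 0 * y^2) * g2"
    unfolding a by simp
  have "((- 1383924 + 2583188 * a) * x^2 + (- 1200307 - 422881 * a) * (x * y) + (3796884 - 3331818 * a) * y^2) * g0 +
      ((- 1279560 + 4251960 * a) * x^2 + (290710 + 42752 * a) * (x * y) + (107645 - 1769863 * a) * y^2) * g1 +
      ((- 5738716 + 4850060 * a) * x^2 + (9010103 - 353917 * a) * (x * y) + 0 * y^2) * g2 = 834 * (x^3 * y^4) + (a^2 + a + 1) * ((- 48597120) * x^7 + (- 177796800) * x^6 * y + 890599248 * x^5 * y^2 + (- 1441044666) * x^4 * y^3 + 741044484 * x^3 * y^4 + 425016648 * x^2 * y^5 + (- 728227206) * x * y^6 + 239203692 * y^7)"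
    unfolding assms(1-3) by algebra
  then show "834 * (x^3 * y^4) =
      ((- 1383924 + 2583188 * a) * x^2 + (- 1200307 - 422881 * a) * (x * y) + (3796884 - 3331818 * a) * y^2) * g0 +
      ((- 1279560 + 4251960 * a) * x^2 + (290710 + 42752 * a) * (x * y) + (107645 - 1769863 * a) * y^2) * g1 +
      ((- 5738716 + 4850060 * a) * x^2 + (9010103 - 353917 * a) * (x * y) + 0 * y^2) * g2"
    unfolding a by simp
  have "((1220940 + 3472481 * a) * x^2 + (- 668183 + 386840 * a) * (x * y) + (- 863226 - 5795622 * a) * y^2) * g0 +
      ((2337018 + 5055246 * a) * x^2 + (140014 - 145309 * a) * (x * y) + (- 1116659 - 1834000 * a) * y^2) * g1 +
      ((1257734 + 8660015 * a) * x^2 + (2872921 - 6300988 * a) * (x * y) + 0 * y^2) * g2 = 834 * (x^2 * y^5) + (a^2 + a + 1) * (27879840 * x^7 + (- 304462584) * x^6 * y + 670778298 * x^5 * y^2 + (- 592763058) * x^4 * y^3 + (- 104533650) * x^3 * y^4 + 448586298 * x^2 * y^5 + (- 226432332) * x * y^6 + (- 54383238) * y^7)"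
    unfolding assms(1-3) by algebra
  then show "834 * (x^2 * y^5) =
      ((1220940 + 3472481 * a) * x^2 + (- 668183 + 386840 * a) * (x * y) + (- 863226 - 5795622 * a) * y^2) * g0 +
      ((2337018 + 5055246 * a) * x^2 + (140014 - 145309 * a) * (x * y) + (- 1116659 - 1834000 * a) * y^2) * g1 +
      ((1257734 + 8660015 * a) * x^2 + (2872921 - 6300988 * a) * (x * y) + 0 * y^2) * g2"
    unfolding a by simp
  have "((1336776 + 1327321 * a) * x^2 + (11641 + 416941 * a) * (x * y) + (- 2014236 - 2586780 * a) * y^2) * g0 +
      ((2039238 + 1746030 * a) * x^2 + (- 17162 - 112779 * a) * (x * y) + (- 782822 - 547084 * a) * y^2) * g1 +
      ((3013598 + 3912215 * a) * x^2 + (- 1507283 - 4050873 * a) * (x * y) + 0 * y^2) * g2 = 417 * (x^1 * y^6) + (a^2 + a + 1) * (36964320 * x^7 + (- 134876712) * x^6 * y + 107874846 * x^5 * y^2 + 152813610 * x^4 * y^3 + (- 350628510) * x^3 * y^4 + 136859322 * x^2 * y^5 + 125815497 * x * y^6 + (- 126896868) * y^7)"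
    unfolding assms(1-3) by algebra
  then show "417 * (x^1 * y^6) =
      ((1336776 + 1327321 * a) * x^2 + (11641 + 416941 * a) * (x * y) + (- 2014236 - 2586780 * a) * y^2) * g0 +
      ((2039238 + 1746030 * a) * x^2 + (- 17162 - 112779 * a) * (x * y) + (- 782822 - 547084 * a) * y^2) * g1 +
      ((3013598 + 3912215 * a) * x^2 + (- 1507283 - 4050873 * a) * (x * y) + 0 * y^2) * g2"
    unfolding a by simp
  have "((7880580 + 2677217 * a) * x^2 + (1612200 + 2439788 * a) * (x * y) + (- 14095320 - 7431558 * a) * y^2) * g0 +
      ((10942578 + 2411862 * a) * x^2 + (- 455378 - 568895 * a) * (x * y) + (- 3699674 - 186940 * a) * y^2) * g1 +
      ((21159542 + 11466711 * a) * x^2 + (- 18547336 - 17955322 * a) * (x * y) + 0 * y^2) * g2 = 2502 * (x^0 * y^7) + (a^2 + a + 1) * (231429408 * x^7 + (- 383033688) * x^6 * y + (- 665705886) * x^5 * y^2 + 2567071650 * x^4 * y^3 + (- 2557966536) * x^3 * y^4 + 70674978 * x^2 * y^5 + 1518332076 * x * y^6 + (- 888007662) * y^7)"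
    unfolding assms(1-3) by algebra
  then show "2502 * (x^0 * y^7) =
      ((7880580 + 2677217 * a) * x^2 + (1612200 + 2439788 * a) * (x * y) + (- 14095320 - 7431558 * a) * y^2) * g0 +
      ((10942578 + 2411862 * a) * x^2 + (- 455378 - 568895 * a) * (x * y) + (- 3699674 - 186940 * a) * y^2) * g1 +
      ((21159542 + 11466711 * a) * x^2 + (- 18547336 - 17955322 * a) * (x * y) + 0 * y^2) * g2"
    unfolding a by simp
qed

section \<open>Derivatives and degree of the sextic, and its certificates\<close>

lemma pd_nodal: "pd 0 nodal = Y * Z - 3 * X\<^sup>2" "pd 1 nodal = X * Z - 3 * Y\<^sup>2" "pd 2 nodal = X * Y"
  by (simp_all add: nodal_def)

lemma pd_conic: "pd 0 conic = 42 * X - 6 * Z - 22 * Y" "pd 1 conic = 42 * Y - 6 * Z - 22 * X"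
    "pd 2 conic = 2 * Z - 6 * X - 6 * Y"
  by (simp_all add: conic_def)

lemma pd_flex_line: "pd 0 (flex_line a) = const3 (3 * a\<^sup>2)" "pd 1 (flex_line a) = const3 (3 * a)" "pd 2 (flex_line a) = 1"
  by (simp_all add: flex_line_def)

lemma homog_nodal: "homog 3 nodal"
proof -
  have "homog (1 + 1 + 1) (X * Y * Z)" by (intro homog_mult homog_var)
  then show ?thesis
    unfolding nodal_def using homog_power[OF homog_var(1), of 3] by (intro homog_diff) (simp_all add: numeral_3_eq_3)
qed

lemma homog_conic: "homog 2 conic"
proof -
  have m: "homog 2 (var3 i * var3 j)" for i j
    using homog_mult[OF homog_var(1) homog_var(1), of i j] by (simp add: numeral_2_eq_2)
  have n: "homog 2 (numeral n * f)" if "homog 2 f" for n f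
    using homog_mult[OF homog_numeral that] unfolding add_0 .
  show ?thesis
    unfolding conic_def power2_eq_square by (intro homog_add homog_diff n m)
qed

lemma homog_flex_line: "homog 1 (flex_line a)"
  unfolding flex_line_def by (intro homog_add homog_const_mult homog_var)

definition sextic :: "complex \<Rightarrow> poly3" where
  "sextic a = nodal * conic * flex_line a"

lemma homog_sextic: "homog 6 (sextic a)"
  unfolding sextic_def using homog_mult[OF homog_mult[OF homog_nodal homog_conic] homog_flex_line[of a]] by simp

lemma (in coeff_hom) ev_pd_sextic:
  "ev \<kappa> p (pd v (sextic a)) =
    (ev \<kappa> p (pd v nodal) * ev \<kappa> p conic + ev \<kappa> p nodal * ev \<kappa> p (pd v conic)) * ev \<kappa> p (flex_line a) +
    ev \<kappa> p nodal * ev \<kappa> p conic * ev \<kappa> p (pd v (flex_line a))"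
  by (simp add: sextic_def ev_add ev_mult)

lemma (in coeff_hom) ev_sextic: "ev \<kappa> p (sextic a) = ev \<kappa> p nodal * ev \<kappa> p conic * ev \<kappa> p (flex_line a)"
  by (simp add: sextic_def ev_mult)

lemma cube_root_of_unity_cases:
  fixes a :: complex
  assumes "a ^ 3 = 1"
  obtains "a = 1" | "a\<^sup>2 + a + 1 = 0"
proof -
  have "(a - 1) * (a\<^sup>2 + a + 1) = 0" using assms by (simp add: algebra_simps power2_eq_square power3_eq_cube)
  then show ?thesis using that by auto
qed

lemma liftable_sextic_one:
  assumes "i + j = 7"
  shows "liftable (jacobian (sextic 1)) (Z - const3 1 * X - const3 (- 3) * Y) 6 (X ^ i * Y ^ j)"
proof -
  have q: "peval (pd 0 (sextic 1)) (x, y, 1 * x + - 3 * y) = (- 384) * x^5 + 512 * x^4 * y + (- 1616) * x^3 * y^2 + 528 * x^2 * y^3 + (- 944) * x * y^4 + (- 144) * y^5"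
    "peval (pd 1 (sextic 1)) (x, y, 1 * x + - 3 * y) = 128 * x^5 + (- 512) * x^4 * y + 432 * x^3 * y^2 + (- 752) * x^2 * y^3 + (- 1200) * x * y^4 + (- 144) * y^5"
    "peval (pd 2 (sextic 1)) (x, y, 1 * x + - 3 * y) = 128 * x^4 * y + (- 176) * x^3 * y^2 + 432 * x^2 * y^3 + (- 80) * x * y^4 + (- 48) * y^5"
    for x y
    unfolding peval_eq_ev peval.ev_pd_sextic pd_nodal pd_conic pd_flex_line nodal_def conic_def flex_line_def
    by (simp_all add: peval.ev_simps) algebra+
  let ?l = "\<lambda>i j. liftable (jacobian (sextic 1)) (Z - const3 1 * X - const3 (- 3) * Y) 6 (X ^ i * Y ^ j)"
  have l0: "?l 7 0"
    by (rule liftable_combination[OF homog_sextic, of 3072], simp, unfold q, rule quintic_combinations_one(1))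
  have l1: "?l 6 1"
    by (rule liftable_combination[OF homog_sextic, of 3072], simp, unfold q, rule quintic_combinations_one(2))
  have l2: "?l 5 2"
    by (rule liftable_combination[OF homog_sextic, of 3072], simp, unfold q, rule quintic_combinations_one(3))
  have l3: "?l 4 3"
    by (rule liftable_combination[OF homog_sextic, of 3072], simp, unfold q, rule quintic_combinations_one(4))
  have l4: "?l 3 4"
    by (rule liftable_combination[OF homog_sextic, of 3072], simp, unfold q, rule quintic_combinations_one(5))
  have l5: "?l 2 5"
    by (rule liftable_combination[OF homog_sextic, of 3072], simp, unfold q, rule quintic_combinations_one(6))
  have l6: "?l 1 6"
    by (rule liftable_combination[OF homog_sextic, of 3072], simp, unfold q, rule quintic_combinations_one(7))
  have l7: "?l 0 7"
    by (rule liftable_combination[OF homog_sextic, of 3072], simp, unfold q, rule quintic_combinations_one(8))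
  have j: "j = 7 - i" and "i < 8" using assms by auto
  from \<open>i < 8\<close> have "i = 0 \<or> i = 1 \<or> i = 2 \<or> i = 3 \<or> i = 4 \<or> i = 5 \<or> i = 6 \<or> i = 7"
    by (auto simp: eval_nat_numeral less_Suc_eq)
  then show ?thesis
    unfolding j using l0 l1 l2 l3 l4 l5 l6 l7 by (elim disjE) simp_all
qed

lemma liftable_sextic_omega:
  assumes a: "a\<^sup>2 + a + 1 = 0" and "i + j = 7"
  shows "liftable (jacobian (sextic a)) (Z - const3 1 * X - const3 0 * Y) 6 (X ^ i * Y ^ j)"
proof -
  have a2: "a\<^sup>2 = - 1 - a" using a by algebra
  have q: "peval (pd 0 (sextic a)) (x, y, 1 * x + 0 * y) = (216 + 300 * a) * x^5 + (- 448 - 858 * a) * x^4 * y + (373 + 960 * a) * x^3 * y^2 + (15 - 309 * a) * x^2 * y^3 + (- 128 - 195 * a) * x * y^4 + (63 + 129 * a) * y^5"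
    "peval (pd 1 (sextic a)) (x, y, 1 * x + 0 * y) = (- 88 - 180 * a) * x^5 + (196 + 558 * a) * x^4 * y + (- 30 - 486 * a) * x^3 * y^2 + (- 224 - 276 * a) * x^2 * y^3 + (210 + 735 * a) * x * y^4 + (- 378 * a) * y^5"
    "peval (pd 2 (sextic a)) (x, y, 1 * x + 0 * y) = (- 24 - 12 * a) * x^5 + (8 - 42 * a) * x^4 * y + (19 + 156 * a) * x^3 * y^2 + (- 45 - 177 * a) * x^2 * y^3 + (16 + 57 * a) * x * y^4 + (- 21 + 18 * a) * y^5"
    for x y
    unfolding peval_eq_ev peval.ev_pd_sextic pd_nodal pd_conic pd_flex_line nodal_def conic_def flex_line_def a2
    by (simp_all add: peval.ev_simps) algebra+
  let ?l = "\<lambda>i j. liftable (jacobian (sextic a)) (Z - const3 1 * X - const3 0 * Y) 6 (X ^ i * Y ^ j)"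
  have l0: "?l 7 0"
    by (rule liftable_combination[OF homog_sextic, of 6672], simp, unfold q, rule quintic_combinations_omega(1)[OF a])
  have l1: "?l 6 1"
    by (rule liftable_combination[OF homog_sextic, of 3336], simp, unfold q, rule quintic_combinations_omega(2)[OF a])
  have l2: "?l 5 2"
    by (rule liftable_combination[OF homog_sextic, of 834], simp, unfold q, rule quintic_combinations_omega(3)[OF a])
  have l3: "?l 4 3"
    by (rule liftable_combination[OF homog_sextic, of 834], simp, unfold q, rule quintic_combinations_omega(4)[OF a])
  have l4: "?l 3 4"
    by (rule liftable_combination[OF homog_sextic, of 834], simp, unfold q, rule quintic_combinations_omega(5)[OF a])
  have l5: "?l 2 5"
    by (rule liftable_combination[OF homog_sextic, of 834], simp, unfold q, rule quintic_combinations_omega(6)[OF a])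
  have l6: "?l 1 6"
    by (rule liftable_combination[OF homog_sextic, of 417], simp, unfold q, rule quintic_combinations_omega(7)[OF a])
  have l7: "?l 0 7"
    by (rule liftable_combination[OF homog_sextic, of 2502], simp, unfold q, rule quintic_combinations_omega(8)[OF a])
  have j: "j = 7 - i" and "i < 8" using assms(2) by auto
  from \<open>i < 8\<close> have "i = 0 \<or> i = 1 \<or> i = 2 \<or> i = 3 \<or> i = 4 \<or> i = 5 \<or> i = 6 \<or> i = 7"
    by (auto simp: eval_nat_numeral less_Suc_eq)
  then show ?thesis
    unfolding j using l0 l1 l2 l3 l4 l5 l6 l7 by (elim disjE) simp_all
qed

lemma sextic_step:
  assumes "a ^ 3 = 1"
  shows "\<exists>\<alpha> \<beta>. \<forall>n h. 6 \<le> n \<longrightarrow> homog (Suc n) h \<longrightarrow>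
    liftable (jacobian (sextic a)) (Z - const3 \<alpha> * X - const3 \<beta> * Y) n h"
  using assms
proof (cases rule: cube_root_of_unity_cases)
  case 1
  show ?thesis
    unfolding 1 by (intro exI[of _ 1] exI[of _ "- 3"] allI impI) (rule liftable_if_binary[OF liftable_sextic_one])
next
  case 2
  show ?thesis
    by (intro exI[of _ 1] exI[of _ 0] allI impI) (rule liftable_if_binary[OF liftable_sextic_omega[OF 2]])
qed

subsection \<open>No linear syzygies\<close>

text \<open>On the cubic, a syzygy restricts to a vector field tangent to the nodal cubic, and the only linear
  vector fields with that property are the multiples of the Euler field.\<close>

lemma no_linear_syzygy_sextic:
  assumes "a \<noteq> 0"
  shows "\<not> AR_nonzero (sextic a) 1"
proof
  let ?\<phi> = "([:0, 1:], [:0, 0, 1:], [:1, 0, 0, 1:]) :: complex poly \<times> complex poly \<times> complex poly"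
  assume "AR_nonzero (sextic a) 1"
  then obtain A B C where ABC: "homog 1 A" "homog 1 B" "homog 1 C" "(A, B, C) \<noteq> (0, 0, 0)"
    "A * pd 0 (sextic a) + B * pd 1 (sextic a) + C * pd 2 (sextic a) = 0"
    unfolding AR_nonzero_def by blast
  obtain a1 a2 a3 where A: "A = const3 a1 * X + const3 a2 * Y + const3 a3 * Z" using ABC(1) by (rule homog_1_expand)
  obtain b1 b2 b3 where B: "B = const3 b1 * X + const3 b2 * Y + const3 b3 * Z" using ABC(2) by (rule homog_1_expand)
  obtain c1 c2 c3 where C: "C = const3 c1 * X + const3 c2 * Y + const3 c3 * Z" using ABC(3) by (rule homog_1_expand)
  \<comment> \<open>Along the cubic only the terms that differentiate \<open>nodal\<close> survive;
    their common factor, conic times line, is not identically zero there and can be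
    cancelled.\<close>
  have E: "jet ?\<phi> nodal = 0" by (simp add: nodal_def power3_eq_cube)
  have "jet ?\<phi> (A * pd 0 (sextic a) + B * pd 1 (sextic a) + C * pd 2 (sextic a)) = 0"
    unfolding ABC(5) by simp
  then have "jet ?\<phi> (A * pd 0 nodal + B * pd 1 nodal + C * pd 2 nodal) * (jet ?\<phi> conic * jet ?\<phi> (flex_line a)) = 0"
    by (simp add: const1.ev_pd_sextic E algebra_simps)
  moreover have "poly (jet ?\<phi> conic) 0 = 1" "poly (jet ?\<phi> (flex_line a)) 0 = 1"
    by (simp_all add: poly_jet conic_def flex_line_def)
  then have "jet ?\<phi> conic \<noteq> 0" "jet ?\<phi> (flex_line a) \<noteq> 0" by auto
  ultimately have "jet ?\<phi> (A * pd 0 nodal + B * pd 1 nodal + C * pd 2 nodal) = 0" by simp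
  moreover have "jet ?\<phi> (A * pd 0 nodal + B * pd 1 nodal + C * pd 2 nodal) =
    [:0, b3, b1 - 2 * a3, c3 + b2 - 2 * a1, c1 - 2 * a2 - b3, c2 - 2 * b1 - a3, a1 - 2 * b2 + c3, a2 - 2 * b3, a3:]"
    unfolding A B C pd_nodal by (simp add: power2_eq_square numeral_poly algebra_simps)
  ultimately have "[:0, b3, b1 - 2 * a3, c3 + b2 - 2 * a1, c1 - 2 * a2 - b3, c2 - 2 * b1 - a3, a1 - 2 * b2 + c3, a2 - 2 * b3, a3:] = 0" by metis
  then have z: "b3 = 0" "b1 - 2 * a3 = 0" "c3 + b2 - 2 * a1 = 0" "c1 - 2 * a2 - b3 = 0" "c2 - 2 * b1 - a3 = 0"
    "a1 - 2 * b2 + c3 = 0" "a2 - 2 * b3 = 0" "a3 = 0"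
    unfolding pCons_eq_0_iff by blast+
  have "3 * b2 = 3 * a1" using z(3,6) by algebra
  then have d: "b2 = a1" by simp
  with z(3) have d': "c3 = a1" by algebra
  have ab: "a2 = 0" "a3 = 0" "b1 = 0" "b3 = 0" using z(1,2,7,8) by simp_all
  have zero: "a2 = 0" "a3 = 0" "b1 = 0" "b3 = 0" "c1 = 0" "c2 = 0" using z(4,5) by (simp_all add: ab)
  \<comment> \<open>What remains is \<open>a1\<close> times the Euler field, which sends the sextic
    to \<open>6 * a1\<close> times itself.\<close>
  have "const3 a1 * (X * pd 0 (sextic a) + Y * pd 1 (sextic a) + Z * pd 2 (sextic a)) = 0"
    using ABC(5) by (simp add: A B C zero d d' algebra_simps)
  then have "const3 a1 * (of_nat 6 * sextic a) = 0" unfolding euler[OF homog_sextic] .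
  then have "peval (const3 a1 * (of_nat 6 * sextic a)) (1, 0, 0) = 0" by simp
  then have "a1 = 0" using assms by (simp add: sextic_def nodal_def conic_def flex_line_def)
  then have "A = 0" "B = 0" "C = 0" by (simp_all add: A B C zero d d')
  with ABC(4) show False by simp
qed

subsection \<open>The singular points\<close>

text \<open>The curve is \<open>D \<phi> + (0, 0, u^6)\<close>, where \<open>\<phi>\<close> parametrises the cubic and \<open>D\<close> is \<open>- 2\<close> times the
  \<open>z\<close>-derivative of the conic along \<open>\<phi>\<close>. This makes the \<open>z\<close>-derivative of the product of cubic and conic
  vanish to order twelve; since the gradients of the two curves are parallel to order five, the other
  derivatives vanish to order eleven. The curve at the flex below is found in the same way.\<close>

lemma sextactic_jet:
  fixes u D :: "complex poly"
  defines "u \<equiv> [:0, 1:]" and "D \<equiv> 16 + 24 * u - 4 * u ^ 3"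
  defines "\<psi> \<equiv> (D * (1 + u), D * (1 + u)\<^sup>2, D * (1 + (1 + u) ^ 3) + u ^ 6)"
  assumes "g \<in> set (sextic a # jacobian (sextic a))"
  shows "monom 1 11 dvd jet \<psi> g"
proof -
  \<comment> \<open>On \<open>D \<phi>\<close> the conic is \<open>D^2 u^6\<close> with
    \<open>Z\<close>-derivative \<open>- D^2 / 2\<close>; adding \<open>u^6\<close> to
    \<open>Z\<close> gives \<open>u^6 (D^2 / 2 + u^6)\<close>, hence \<open>B\<close>. The cubic is
    linear in \<open>Z\<close>, so its value becomes \<open>u^6\<close> times \<open>X Y\<close>,
    hence \<open>A\<close>.\<close>
  define A B where "A = D\<^sup>2 * (1 + u) ^ 3" and "B = 8 * (4 + 6 * u - u ^ 3)\<^sup>2 + u ^ 6"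
  have E: "jet \<psi> nodal = u ^ 6 * A"
    unfolding A_def \<psi>_def nodal_def const1.ev_simps by algebra
  have Q: "jet \<psi> conic = u ^ 6 * B"
    unfolding B_def \<psi>_def D_def conic_def const1.ev_simps by algebra
  have F: "monom 1 11 dvd jet \<psi> (sextic a)"
    unfolding const1.ev_sextic E Q monom_1_eq u_def[symmetric]
    by (rule dvdI[of _ _ "u * (A * B * jet \<psi> (flex_line a))"]) algebra
  \<comment> \<open>The product rule leaves a factor \<open>u ^ 6\<close> throughout, so order 11
    needs only \<open>u ^ 5\<close> in the remaining bracket; the polynomials \<open>W\<close>
    supplied below are the quotients.\<close>
  have key: "monom 1 11 dvd jet \<psi> (pd v (sextic a))" if "jet \<psi> (pd v nodal) * B + A * jet \<psi> (pd v conic) = u ^ 5 * W" for v W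
  proof -
    have "jet \<psi> (pd v (sextic a)) = u ^ 6 * (jet \<psi> (pd v nodal) * B + A * jet \<psi> (pd v conic)) * jet \<psi> (flex_line a)
      + u ^ 12 * (A * B * jet \<psi> (pd v (flex_line a)))"
      unfolding const1.ev_pd_sextic E Q by algebra
    also have "\<dots> = u ^ 11 * (W * jet \<psi> (flex_line a) + u * (A * B * jet \<psi> (pd v (flex_line a))))"
      unfolding that by algebra
    finally show ?thesis unfolding monom_1_eq u_def[symmetric] by (rule dvdI)
  qed
  have "monom 1 11 dvd jet \<psi> (pd 0 (sextic a))"
    by (rule key[of _ "(- 24576) + (- 167680) * u^1 + (- 461312) * u^2 + (- 629440) * u^3 + (- 381888) * u^4 + 29760 * u^5 + 166464 * u^6 + 63712 * u^7 + (- 13144) * u^8 + (- 12320) * u^9 + (- 972) * u^10 + 648 * u^11 + 108 * u^12"],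
      unfold A_def B_def \<psi>_def D_def pd_nodal pd_conic const1.ev_simps) algebra
  moreover have "monom 1 11 dvd jet \<psi> (pd 1 (sextic a))"
    by (rule key[of _ "24576 + 151808 * u^1 + 366080 * u^2 + 406848 * u^3 + 141888 * u^4 + (- 113856) * u^5 + (- 110400) * u^6 + (- 9824) * u^7 + 18136 * u^8 + 4728 * u^9 + (- 900) * u^10 + (- 324) * u^11"],
      unfold A_def B_def \<psi>_def D_def pd_nodal pd_conic const1.ev_simps) algebra
  moreover have "monom 1 11 dvd jet \<psi> (pd 2 (sextic a))"
    by (rule key[of _ "768 * u^1 + 4608 * u^2 + 10944 * u^3 + 12480 * u^4 + 5760 * u^5 + (- 1152) * u^6 + (- 2064) * u^7 + (- 432) * u^8 + 144 * u^9 + 48 * u^10"],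
      unfold A_def B_def \<psi>_def D_def pd_nodal pd_conic const1.ev_simps) algebra
  ultimately show ?thesis using F assms(4) by auto
qed

lemma flex_jet:
  fixes u \<tau> :: "complex poly" and a :: complex
  defines "u \<equiv> [:0, 1:]" and "\<tau> \<equiv> [:- a, 1:]"
  defines "\<psi> \<equiv> (- 2 * \<tau>, - 2 * \<tau>\<^sup>2, - 2 * (1 + \<tau> ^ 3) + u ^ 3)"
  assumes a: "a ^ 3 = 1" and g: "g \<in> set (sextic a # jacobian (sextic a))"
  shows "monom 1 5 dvd jet \<psi> g"
proof -
  define A where "A = const1 a"
  have \<tau>: "\<tau> = u - A" by (simp add: \<tau>_def u_def A_def)
  have A3: "A ^ 3 = 1" using a by (simp add: A_def power3_eq_cube one_pCons mult.assoc)
  have c: "const1 (3 * a\<^sup>2) = 3 * A\<^sup>2" "const1 (3 * a) = 3 * A"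
    by (simp_all add: A_def power2_eq_square numeral_poly)
  \<comment> \<open>With a factor \<open>c\<close> in place of - 2 the line takes the value
    \<open>(c + 1) * u ^ 3\<close>, and the \<open>Z\<close>-derivative of cubic times line is a
    multiple of \<open>c + 2\<close>; this explains the - 2.\<close>
  have E: "jet \<psi> nodal = u ^ 3 * (4 * \<tau> ^ 3)"
    unfolding \<psi>_def nodal_def const1.ev_simps by algebra
  have L: "jet \<psi> (flex_line a) = - (u ^ 3)"
    unfolding \<psi>_def flex_line_def const1.ev_simps c \<tau> using A3 by algebra
  have F: "monom 1 5 dvd jet \<psi> (sextic a)"
    unfolding const1.ev_sextic E L monom_1_eq u_def[symmetric]
    by (rule dvdI[of _ _ "- u * (4 * \<tau> ^ 3 * jet \<psi> conic)"]) algebra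
  have key: "monom 1 5 dvd jet \<psi> (pd v (sextic a))" if "4 * \<tau> ^ 3 * jet \<psi> (pd v (flex_line a)) - jet \<psi> (pd v nodal) = u\<^sup>2 * W" for v W
  proof -
    have "jet \<psi> (pd v (sextic a)) = u ^ 3 * jet \<psi> conic * (4 * \<tau> ^ 3 * jet \<psi> (pd v (flex_line a)) - jet \<psi> (pd v nodal))
      - u ^ 6 * (4 * \<tau> ^ 3 * jet \<psi> (pd v conic))"
      unfolding const1.ev_pd_sextic E L by algebra
    also have "\<dots> = u ^ 5 * (jet \<psi> conic * W - u * (4 * \<tau> ^ 3 * jet \<psi> (pd v conic)))"
      unfolding that by algebra
    finally show ?thesis unfolding monom_1_eq u_def[symmetric] by (rule dvdI)
  qed
  have "monom 1 5 dvd jet \<psi> (pd 0 (sextic a))"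
    by (rule key[of _ "2 * \<tau>\<^sup>2 * u - 4 * \<tau>\<^sup>2 * (u - 3 * A)"],
      unfold \<psi>_def pd_nodal pd_flex_line const1.ev_simps c \<tau>) (use A3 in algebra)
  moreover have "monom 1 5 dvd jet \<psi> (pd 1 (sextic a))"
    by (rule key[of _ "2 * \<tau> * u + 4 * \<tau> * (2 * u - 3 * A)"],
      unfold \<psi>_def pd_nodal pd_flex_line const1.ev_simps c \<tau>) (use A3 in algebra)
  moreover have "monom 1 5 dvd jet \<psi> (pd 2 (sextic a))"
    by (rule key[of _ 0],
      unfold \<psi>_def pd_nodal pd_flex_line const1.ev_simps c \<tau>) algebra
  ultimately show ?thesis using F g by auto
qed

text \<open>Solving the line for \<open>z\<close> turns the conic into
  \<open>b0 x^2 + b1 x y + b2 y^2\<close>. Its discriminant is nonzero in both cases for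
  \<open>a\<close>, so the line is not tangent to the conic; \<open>M\<close> tells the two points
  apart.\<close>

lemma conic_flex_line_points:
  assumes "a ^ 3 = 1"
  obtains p q M where "p \<noteq> 0" "q \<noteq> 0" "peval conic p = 0" "peval (flex_line a) p = 0"
    "peval conic q = 0" "peval (flex_line a) q = 0" "homog 1 M" "peval M p = 0" "peval M q \<noteq> 0"
proof -
  define b0 b1 b2 where "b0 = 9 * a + 18 * a\<^sup>2 + 21" and "b1 = 18 * (a\<^sup>2 + a) - 4" and "b2 = 9 * a\<^sup>2 + 18 * a + 21"
  have "b1\<^sup>2 \<noteq> 4 * b0 * b2"
    using assms
  proof (cases rule: cube_root_of_unity_cases)
    case 1
    then show ?thesis by (simp add: b0_def b1_def b2_def)
  next
    case 2
    then have "b1\<^sup>2 - 4 * b0 * b2 = 16" unfolding b0_def b1_def b2_def by algebra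
    then show ?thesis by auto
  qed
  then obtain \<alpha> \<beta> \<gamma> \<delta> where D: "\<alpha> * \<delta> - \<beta> * \<gamma> \<noteq> 0" and b: "b0 = \<alpha> * \<gamma>" "b1 = \<alpha> * \<delta> + \<beta> * \<gamma>" "b2 = \<beta> * \<delta>"
    by (rule binary_quadratic_split)
  define pt where "pt x y = (x, y, - 3 * (a\<^sup>2 * x + a * y))" for x y
  have con: "peval conic (pt x y) = (\<alpha> * x + \<beta> * y) * (\<gamma> * x + \<delta> * y)" for x y
  proof -
    have "peval conic (pt x y) = b0 * x\<^sup>2 + b1 * (x * y) + b2 * y\<^sup>2"
      unfolding pt_def b0_def b1_def b2_def conic_def peval_eq_ev peval.ev_simps using assms by algebra
    then show ?thesis unfolding b by algebra
  qed
  have line: "peval (flex_line a) (pt x y) = 0" for x y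
    by (simp add: pt_def flex_line_def algebra_simps)
  show ?thesis
  proof (rule that[of "pt \<beta> (- \<alpha>)" "pt \<delta> (- \<gamma>)" "const3 \<alpha> * X + const3 \<beta> * Y"])
    show "pt \<beta> (- \<alpha>) \<noteq> 0" "pt \<delta> (- \<gamma>) \<noteq> 0" using D by (auto simp: pt_def zero_prod_def)
    show "peval conic (pt \<beta> (- \<alpha>)) = 0" "peval conic (pt \<delta> (- \<gamma>)) = 0"
      unfolding con by (simp_all add: mult.commute)
    show "homog 1 (const3 \<alpha> * X + const3 \<beta> * Y)" by (intro homog_add homog_const_mult homog_var)
    show "peval (const3 \<alpha> * X + const3 \<beta> * Y) (pt \<beta> (- \<alpha>)) = 0" by (simp add: pt_def)
    show "peval (const3 \<alpha> * X + const3 \<beta> * Y) (pt \<delta> (- \<gamma>)) \<noteq> 0"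
      using D by (simp add: pt_def)
  qed (rule line)+
qed

lemma not_in_projI:
  assumes "homog d f" "peval f p = 0" "peval f q \<noteq> 0"
  shows "q \<notin> proj p" "p \<notin> proj q"
proof -
  show "q \<notin> proj p"
    using assms by (auto elim!: in_projE simp: peval_scale)
  then show "p \<notin> proj q" by (simp add: proj_sym)
qed

definition const_curve :: "pt \<Rightarrow> complex poly \<times> complex poly \<times> complex poly" where
  "const_curve p = (case p of (x, y, z) \<Rightarrow> ([:x:], [:y:], [:z:]))"

lemma base_const_curve [simp]: "base (const_curve p) = p"
  by (cases p) (simp add: const_curve_def base_def)

lemma free_sextic:
  assumes a: "a ^ 3 = 1"
  shows "free_with_exponents (sextic a) 6 2 3 \<and> mdr (sextic a) = 2 \<and> total_tjurina (sextic a) = 19"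
proof -
  have a0: "a \<noteq> 0" using a by auto
  obtain p q M where pq: "p \<noteq> 0" "q \<noteq> 0" "peval conic p = 0" "peval (flex_line a) p = 0"
    "peval conic q = 0" "peval (flex_line a) q = 0" and M: "homog 1 M" "peval M p = 0" "peval M q \<noteq> 0"
    using a by (rule conic_flex_line_points)
  define u D \<tau> :: "complex poly" where "u = [:0, 1:]" and "D = 16 + 24 * u - 4 * u ^ 3" and "\<tau> = [:- a, 1:]"
  define \<psi>1 where "\<psi>1 = (D * (1 + u), D * (1 + u)\<^sup>2, D * (1 + (1 + u) ^ 3) + u ^ 6)"
  define \<psi>2 where "\<psi>2 = (- 2 * \<tau>, - 2 * \<tau>\<^sup>2, - 2 * (1 + \<tau> ^ 3) + u ^ 3)"
  \<comment> \<open>In this order: the node, the sextactic point, the flex, and the two points where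
    conic and line meet.\<close>
  define \<psi> where "\<psi> = (\<lambda>i :: nat. [const_curve (0, 0, 1), \<psi>1, \<psi>2, const_curve p, const_curve q] ! i)"
  define m where "m = (\<lambda>i :: nat. [1, 11, 5, 1, 1 :: nat] ! i)"
  have \<psi>: "\<psi> 0 = const_curve (0, 0, 1)" "\<psi> 1 = \<psi>1" "\<psi> 2 = \<psi>2" "\<psi> 3 = const_curve p" "\<psi> 4 = const_curve q"
    by (simp_all add: \<psi>_def)
  have m: "m 0 = 1" "m 1 = 11" "m 2 = 5" "m 3 = 1" "m 4 = 1"
    by (simp_all add: m_def)
  have D0: "poly u 0 = 0" "poly D 0 = 16" "poly \<tau> 0 = - a" by (simp_all add: u_def D_def \<tau>_def)
  have b1: "base \<psi>1 = (16, 16, 32)" by (simp add: \<psi>1_def base_def D0)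
  have b2: "base \<psi>2 = (2 * a, - 2 * a\<^sup>2, 0)" using a by (simp add: \<psi>2_def base_def D0)
  have less5: "i = 0 \<or> i = 1 \<or> i = 2 \<or> i = 3 \<or> i = 4" if "i \<in> {..<5}" for i :: nat
    using that by auto
  have jets: "jet_system (sextic a # jacobian (sextic a)) {..<5} \<psi> m"
  proof
    show "finite {..<5 :: nat}" by simp
    show "0 < m i" if "i \<in> {..<5}" for i using less5[OF that] m by auto
    show "base (\<psi> i) \<noteq> 0" if "i \<in> {..<5}" for i
      using less5[OF that] by (elim disjE) (simp_all add: \<psi>[unfolded One_nat_def] b1 b2 pq a0, simp_all add: a0 zero_prod_def)
    have node: "peval g (0, 0, 1) = 0" if "g \<in> set (sextic a # jacobian (sextic a))" for g
      using that by (auto simp: peval_eq_ev peval.ev_pd_sextic peval.ev_sextic)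
        (simp_all add: pd_nodal[unfolded One_nat_def] nodal_def flip: peval_eq_ev)
    have double: "peval g x = 0" if "g \<in> set (sextic a # jacobian (sextic a))" "peval conic x = 0" "peval (flex_line a) x = 0" for g x
      using that by (auto simp: peval_eq_ev peval.ev_pd_sextic peval.ev_sextic)
    have const: "monom 1 1 dvd jet (const_curve x) g" if "peval g x = 0" for g x
      using that by (simp add: monom_1_dvd_iff' coeff_jet_0)
    show "monom 1 (m i) dvd jet (\<psi> i) g" if "i \<in> {..<5}" and g: "g \<in> set (sextic a # jacobian (sextic a))" for i g
      using less5[OF that(1)]
    proof (elim disjE)
      show "monom 1 (m i) dvd jet (\<psi> i) g" if "i = 0"
        unfolding that \<psi> m by (rule const[OF node[OF g]])
      show "monom 1 (m i) dvd jet (\<psi> i) g" if "i = 1"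
        unfolding that \<psi> m \<psi>1_def D_def u_def by (rule sextactic_jet[OF g])
      show "monom 1 (m i) dvd jet (\<psi> i) g" if "i = 2"
        unfolding that \<psi> m \<psi>2_def \<tau>_def u_def by (rule flex_jet[OF a g])
      show "monom 1 (m i) dvd jet (\<psi> i) g" if "i = 3"
        unfolding that \<psi> m by (rule const[OF double[OF g pq(3,4)]])
      show "monom 1 (m i) dvd jet (\<psi> i) g" if "i = 4"
        unfolding that \<psi> m by (rule const[OF double[OF g pq(5,6)]])
    qed
    have L1: "peval (flex_line a) (16, 16, 32) \<noteq> 0"
      using a
    proof (cases rule: cube_root_of_unity_cases)
      case 2
      have "peval (flex_line a) (16, 16, 32) = 48 * (a\<^sup>2 + a + 1) - 16" by (simp add: flex_line_def)
      with 2 show ?thesis by simp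
    qed (simp add: flex_line_def)
    have Q2: "peval conic (2 * a, - 2 * a\<^sup>2, 0) \<noteq> 0"
    proof -
      have "peval conic (2 * a, - 2 * a\<^sup>2, 0) = 84 * a\<^sup>2 + 88 * a ^ 3 + 84 * a ^ 3 * a"
        by (simp add: conic_def) algebra
      also have "\<dots> = 84 * (a\<^sup>2 + a + 1) + 4" unfolding a by simp
      finally have "peval conic (2 * a, - 2 * a\<^sup>2, 0) = 84 * (a\<^sup>2 + a + 1) + 4" .
      moreover have "\<dots> \<noteq> 0"
        using a by (cases rule: cube_root_of_unity_cases) simp_all
      ultimately show ?thesis by simp
    qed
    have h: "homog 1 X" "homog 1 Z" by simp_all
    \<comment> \<open>Each pair is separated by a form vanishing at exactly one of its points. The
      line and the conic both contain \<open>p\<close> and \<open>q\<close>, but the line misses the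
      node and the sextactic point, and the conic misses the flex.\<close>
    note sep = not_in_projI[OF h(1), of "(0, 0, 1)" "(16, 16, 32)"] not_in_projI[OF h(1), of "(0, 0, 1)" "(2 * a, - 2 * a\<^sup>2, 0)"]
      not_in_projI[OF homog_flex_line pq(4), of "(0, 0, 1)"] not_in_projI[OF homog_flex_line pq(6), of "(0, 0, 1)"]
      not_in_projI[OF h(2), of "(2 * a, - 2 * a\<^sup>2, 0)" "(16, 16, 32)"]
      not_in_projI[OF homog_flex_line pq(4) L1] not_in_projI[OF homog_flex_line pq(6) L1]
      not_in_projI[OF homog_conic pq(3) Q2] not_in_projI[OF homog_conic pq(5) Q2] not_in_projI[OF M]
    have L0: "peval (flex_line a) (0, 0, 1) = 1" by (simp add: flex_line_def)
    show "base (\<psi> j) \<notin> proj (base (\<psi> i))" if "i \<in> {..<5}" "j \<in> {..<5}" "i \<noteq> j" for i j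
      using less5[OF that(1)] less5[OF that(2)] that(3) sep a0
      by (elim disjE) (simp_all add: \<psi>[unfolded One_nat_def] b1 b2 L0)
    show "m i = 1 \<or> (\<exists>l. homog 1 l \<and> coeff (jet (\<psi> i) l) 0 = 0 \<and> coeff (jet (\<psi> i) l) 1 \<noteq> 0)"
      if "i \<in> {..<5}" for i
    proof -
      \<comment> \<open>On the cubic \<open>Y - X\<close> is \<open>t (t - 1)\<close> and
        \<open>a X + Y\<close> is \<open>t (t + a)\<close>, with simple zeros at the sextactic point
        and at the flex.\<close>
      have "homog 1 (Y - X)" by (intro homog_diff homog_var)
      moreover have "jet \<psi>1 (Y - X) = [:0, 1:] * (D * (1 + u))"
        unfolding \<psi>1_def const1.ev_simps u_def[symmetric] by algebra
      then have "coeff (jet \<psi>1 (Y - X)) 0 = 0" "coeff (jet \<psi>1 (Y - X)) 1 = 16"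
        by (simp_all add: D0 flip: poly_0_coeff_0)
      moreover have "homog 1 (const3 a * X + Y)" by (intro homog_add homog_const_mult homog_var)
      moreover have "jet \<psi>2 (const3 a * X + Y) = [:0, 1:] * (- 2 * \<tau>)"
        by (simp add: \<psi>2_def \<tau>_def power2_eq_square numeral_poly algebra_simps)
      then have "coeff (jet \<psi>2 (const3 a * X + Y)) 0 = 0" "coeff (jet \<psi>2 (const3 a * X + Y)) 1 = 2 * a"
        by (simp_all add: D0 flip: poly_0_coeff_0)
      ultimately have "\<exists>l. homog 1 l \<and> coeff (jet \<psi>1 l) 0 = 0 \<and> coeff (jet \<psi>1 l) 1 \<noteq> 0"
        "\<exists>l. homog 1 l \<and> coeff (jet \<psi>2 l) 0 = 0 \<and> coeff (jet \<psi>2 l) 1 \<noteq> 0"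
        using a0 by (metis mult_eq_0_iff zero_neq_numeral)+
      then show ?thesis using less5[OF that] m \<psi> by (elim disjE) simp_all
    qed
  qed
  have M: "(\<Sum>j<5. m j) = 19"
    by (simp add: m_def eval_nat_numeral)
  obtain \<alpha> \<beta> where step: "6 \<le> n \<Longrightarrow> homog (Suc n) h \<Longrightarrow>
    liftable (jacobian (sextic a)) (Z - const3 \<alpha> * X - const3 \<beta> * Y) n h" for n h
    using sextic_step[OF a] by blast
  show ?thesis
    by (rule free_2_3_criterion[OF homog_sextic jets M no_linear_syzygy_sextic[OF a0] step[unfolded liftable_def]])
qed

theorem theorem1:
  fixes e q l :: poly3
  assumes "nodal_cubic e"
    and "hyperosculating_conic e q"
    and "inflectional_line e l"
  shows "free_with_exponents (e * q * l) 6 2 3 \<and> mdr (e * q * l) = 2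
         \<and> total_tjurina (e * q * l) = 19"
proof -
  obtain S T a where S: "coord_change S T" "a ^ 3 = 1" "e * q * l = sub S (sextic a)"
    unfolding sextic_def using assms by (rule sextic_normal_form)
  interpret coord_change S T by (rule S(1))
  show ?thesis
    unfolding S(3) mdr_sub total_tjurina_sub
    using free_sextic[OF S(2)] free_with_exponents_sub by blast
qed

end
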